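(* Let $\frac12<\alpha<1$, let $A$ be a selfadjoint operator in a separable Hilbert space $H$, and let $\frac{1}{2\alpha-1}<q<\infty$ with conjugate exponent $q'$, $\frac1q+\frac1{q'}=1$. There is a constant $C>0$, independent of $T$, $\delta$, $x$ and $F$, such that the following holds. For $T>0$, let $x\in H$, $F\in L^q((0,T);H)$, and let $u$ be the mild solution on $[0,T]$ of $$iD_t^\alpha u+Au+F(t)=0\quad(t>0),\qquad u(0)=x.$$ Then $u\in C^{1-\alpha}([\delta,T];H)$ for any $0<\delta<T$, with $$[u]_{C^{1-\alpha}([\delta,T];H)}\le C\Big((1+\delta^{-1})T^\alpha\|x\|_H+\big(T^{\frac1{q'}+4\alpha-3}+T^{\frac1{q'}+2\alpha-1}+T^{\frac1{q'}-2(1-\alpha)}\big)\|F\|_{L^q((0,T);H)}\Big).$$ If moreover $x\in D(A)$, then $u\in C^{1-\alpha}([0,T];H)$, with $$[u]_{C^{1-\alpha}([0,T];H)}\le C\Big((T^{2\alpha-1}+T^{2\alpha})\|x\|_{D(A)}+\big(T^{\frac1{q'}+4\alpha-3}+T^{\frac1{q'}+2\alpha-1}+T^{\frac1{q'}-2(1-\alpha)}\big)\|F\|_{L^q((0,T);H)}\Big).$$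
   Context: $D(A)$ carries the graph norm $\|x\|_{D(A)}=\|x\|_H+\|Ax\|_H$. $D_t^\alpha$ is the Caputo derivative. $[u]_{C^{\gamma}(J;H)}=\sup_{t\ne s\in J}\|u(t)-u(s)\|_H/|t-s|^{\gamma}$ is the H\"older seminorm. $E_{\alpha,\beta}(z)=\sum_{k\ge0}z^k/\Gamma(\alpha k+\beta)$. By the spectral theorem fix a finite measure space $(\Omega,\mu)$, a unitary $U:L^2(\Omega)\to H$ and a real-valued function $a(\xi)$ on $\Omega$, finite a.e., such that $A$ is unitarily equivalent via $U$ to multiplication by $a$: $\psi\in D(A)$ iff $aU^{-1}\psi\in L^2(\Omega)$, and $A\psi=U(a(\xi)U^{-1}\psi)$. Define for $t\ge0$ (resp. $t>0$) $$S_t\phi=U\big(E_{\alpha,1}(ia(\xi)t^\alpha)U^{-1}\phi\big),\qquad P_t\phi=U\big(t^{\alpha-1}E_{\alpha,\alpha}(ia(\xi)t^\alpha)U^{-1}\phi\big),$$ and $Gv(t)=\int_0^tP_{t-\tau}v(\tau)\,d\tau$. The mild solution of the linear problem on $[0,T]$ is $u(t)=S_tx+iGF(t)$. *)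

theory Defs
  imports "HOL-Analysis.Analysis"
begin

text \<open>The inner product is linear in the first and conjugate-linear in the second argument.
  Nonnegativity and definiteness follow from \<open>norm_eq_sqrt_cinner\<close>.
  A separable complex Hilbert space is a type of sort
  \<open>{complex_inner, banach, second_countable_topology}\<close>.\<close>

class complex_inner = real_normed_vector +
  fixes scaleC :: "complex \<Rightarrow> 'a \<Rightarrow> 'a" (infixr "*\<^sub>C" 75)
    and cinner :: "'a \<Rightarrow> 'a \<Rightarrow> complex"
  assumes scaleC_add_right: "c *\<^sub>C (x + y) = c *\<^sub>C x + c *\<^sub>C y"
    and scaleC_add_left: "(c + d) *\<^sub>C x = c *\<^sub>C x + d *\<^sub>C x"
    and scaleC_scaleC: "c *\<^sub>C (d *\<^sub>C x) = (c * d) *\<^sub>C x"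
    and scaleR_eq_scaleC: "r *\<^sub>R x = complex_of_real r *\<^sub>C x"
    and cinner_commute: "cinner x y = cnj (cinner y x)"
    and cinner_add_left: "cinner (x + y) z = cinner x z + cinner y z"
    and cinner_scaleC_left: "cinner (c *\<^sub>C x) y = c * cinner x y"
    and norm_eq_sqrt_cinner: "norm x = sqrt (Re (cinner x x))"

instantiation complex :: complex_inner
begin

definition scaleC_complex :: "complex \<Rightarrow> complex \<Rightarrow> complex" where
  "scaleC_complex c x = c * x"

definition cinner_complex :: "complex \<Rightarrow> complex \<Rightarrow> complex" where
  "cinner_complex x y = x * cnj y"

instance
  by standard
    (auto simp: scaleC_complex_def cinner_complex_def algebra_simps scaleR_conv_of_real
      cmod_def power2_eq_square)

end

text \<open>An operator is a pair of a domain \<open>D\<close> and a total function \<open>A\<close> whose values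
  outside \<open>D\<close> are irrelevant.\<close>

definition linear_operator :: "'h::complex_inner set \<Rightarrow> ('h \<Rightarrow> 'h) \<Rightarrow> bool" where
  "linear_operator D A \<longleftrightarrow> 0 \<in> D \<and>
     (\<forall>x\<in>D. \<forall>y\<in>D. x + y \<in> D \<and> A (x + y) = A x + A y) \<and>
     (\<forall>c. \<forall>x\<in>D. c *\<^sub>C x \<in> D \<and> A (c *\<^sub>C x) = c *\<^sub>C A x)"

definition operator_graph :: "'h set \<Rightarrow> ('h \<Rightarrow> 'h) \<Rightarrow> ('h \<times> 'h) set" where
  "operator_graph D A = {(x, A x) | x. x \<in> D}"

definition adjoint_graph :: "'h::complex_inner set \<Rightarrow> ('h \<Rightarrow> 'h) \<Rightarrow> ('h \<times> 'h) set" where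
  "adjoint_graph D A = {(y, z). \<forall>x\<in>D. cinner (A x) y = cinner x z}"

definition selfadjoint_operator :: "'h::complex_inner set \<Rightarrow> ('h \<Rightarrow> 'h) \<Rightarrow> bool" where
  "selfadjoint_operator D A \<longleftrightarrow>
     linear_operator D A \<and> closure D = UNIV \<and> adjoint_graph D A = operator_graph D A"

definition graph_norm :: "('h::real_normed_vector \<Rightarrow> 'h) \<Rightarrow> 'h \<Rightarrow> real" where
  "graph_norm A x = norm x + norm (A x)"

text \<open>Elements of \<open>lp_space\<close> are functions, not classes modulo null sets.\<close>

definition lp_space :: "real \<Rightarrow> 'w measure \<Rightarrow> ('w \<Rightarrow> 'b::{banach,second_countable_topology}) set" where
  "lp_space p M = {f \<in> borel_measurable M. integrable M (\<lambda>w. norm (f w) powr p)}"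

definition lp_norm :: "real \<Rightarrow> 'w measure \<Rightarrow> ('w \<Rightarrow> 'b::{banach,second_countable_topology}) \<Rightarrow> real" where
  "lp_norm p M f = (\<integral>w. norm (f w) powr p \<partial>M) powr (1 / p)"

definition holder_quotients :: "real \<Rightarrow> real set \<Rightarrow> (real \<Rightarrow> 'b::real_normed_vector) \<Rightarrow> real set" where
  "holder_quotients \<gamma> J u =
     {norm (u t - u s) / \<bar>t - s\<bar> powr \<gamma> | t s. t \<in> J \<and> s \<in> J \<and> t \<noteq> s}"

text \<open>On the compact intervals considered here, boundedness of \<open>u\<close> follows from continuity.\<close>

definition holder_space :: "real \<Rightarrow> real set \<Rightarrow> (real \<Rightarrow> 'b::real_normed_vector) set" where
  "holder_space \<gamma> J = {u. continuous_on J u \<and> bdd_above (holder_quotients \<gamma> J u)}"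

text \<open>Meaningful only for \<open>u \<in> holder_space \<gamma> J\<close> and \<open>J\<close> with at least two points.\<close>

definition holder_seminorm :: "real \<Rightarrow> real set \<Rightarrow> (real \<Rightarrow> 'b::real_normed_vector) \<Rightarrow> real" where
  "holder_seminorm \<gamma> J u = Sup (holder_quotients \<gamma> J u)"

text \<open>\<open>U\<close> acts on square integrable functions; preservation of the inner product and linearity
  make it constant on classes modulo null sets and injective on these classes. Consequently
  \<open>inv_into (lp_space 2 M) U \<phi>\<close> is a representative of the class of the preimage of \<open>\<phi>\<close>.\<close>

definition unitary_from_L2 :: "'w measure \<Rightarrow> (('w \<Rightarrow> complex) \<Rightarrow> 'h::complex_inner) \<Rightarrow> bool" where
  "unitary_from_L2 M U \<longleftrightarrow>
     (\<forall>f\<in>lp_space 2 M. \<forall>g\<in>lp_space 2 M. U (\<lambda>w. f w + g w) = U f + U g) \<and>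
     (\<forall>c. \<forall>f\<in>lp_space 2 M. U (\<lambda>w. c * f w) = c *\<^sub>C U f) \<and>
     (\<forall>f\<in>lp_space 2 M. \<forall>g\<in>lp_space 2 M. cinner (U f) (U g) = (\<integral>w. f w * cnj (g w) \<partial>M)) \<and>
     U ` lp_space 2 M = UNIV"

definition L2_inv :: "'w measure \<Rightarrow> (('w \<Rightarrow> complex) \<Rightarrow> 'h) \<Rightarrow> 'h \<Rightarrow> 'w \<Rightarrow> complex" where
  "L2_inv M U = inv_into (lp_space 2 M) U"

definition spectral_representation ::
  "'h::complex_inner set \<Rightarrow> ('h \<Rightarrow> 'h) \<Rightarrow> 'w measure \<Rightarrow> (('w \<Rightarrow> complex) \<Rightarrow> 'h) \<Rightarrow> ('w \<Rightarrow> real) \<Rightarrow> bool"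
where
  "spectral_representation D A M U a \<longleftrightarrow>
     finite_measure M \<and> unitary_from_L2 M U \<and> a \<in> borel_measurable M \<and>
     (\<forall>\<psi>. \<psi> \<in> D \<longleftrightarrow> (\<lambda>w. complex_of_real (a w) * L2_inv M U \<psi> w) \<in> lp_space 2 M) \<and>
     (\<forall>\<psi>\<in>D. A \<psi> = U (\<lambda>w. complex_of_real (a w) * L2_inv M U \<psi> w))"

definition mittag_leffler :: "real \<Rightarrow> real \<Rightarrow> complex \<Rightarrow> complex" where
  "mittag_leffler \<alpha> \<beta> z = (\<Sum>k. z ^ k / complex_of_real (Gamma (\<alpha> * real k + \<beta>)))"

definition S_op ::
  "real \<Rightarrow> 'w measure \<Rightarrow> (('w \<Rightarrow> complex) \<Rightarrow> 'h) \<Rightarrow> ('w \<Rightarrow> real) \<Rightarrow> real \<Rightarrow> 'h \<Rightarrow> 'h"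
where
  "S_op \<alpha> M U a t \<phi> =
     U (\<lambda>w. mittag_leffler \<alpha> 1 (\<i> * complex_of_real (a w * t powr \<alpha>)) * L2_inv M U \<phi> w)"

definition P_op ::
  "real \<Rightarrow> 'w measure \<Rightarrow> (('w \<Rightarrow> complex) \<Rightarrow> 'h) \<Rightarrow> ('w \<Rightarrow> real) \<Rightarrow> real \<Rightarrow> 'h \<Rightarrow> 'h"
where
  "P_op \<alpha> M U a t \<phi> =
     U (\<lambda>w. complex_of_real (t powr (\<alpha> - 1)) *
            mittag_leffler \<alpha> \<alpha> (\<i> * complex_of_real (a w * t powr \<alpha>)) * L2_inv M U \<phi> w)"

definition G_op ::
  "real \<Rightarrow> 'w measure \<Rightarrow> (('w \<Rightarrow> complex) \<Rightarrow> 'h) \<Rightarrow> ('w \<Rightarrow> real) \<Rightarrow>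
   (real \<Rightarrow> 'h::{banach,second_countable_topology}) \<Rightarrow> real \<Rightarrow> 'h"
where
  "G_op \<alpha> M U a v t = (LINT \<tau>:{0<..<t}|lebesgue. P_op \<alpha> M U a (t - \<tau>) (v \<tau>))"

definition mild_solution ::
  "real \<Rightarrow> 'w measure \<Rightarrow> (('w \<Rightarrow> complex) \<Rightarrow> 'h) \<Rightarrow> ('w \<Rightarrow> real) \<Rightarrow> 'h \<Rightarrow>
   (real \<Rightarrow> 'h::{complex_inner,banach,second_countable_topology}) \<Rightarrow> real \<Rightarrow> 'h"
where
  "mild_solution \<alpha> M U a x F t = S_op \<alpha> M U a t x + \<i> *\<^sub>C G_op \<alpha> M U a F t"

end

theory Submission
  imports Defs "HOL-Complex_Analysis.Complex_Analysis" "HOL-Real_Asymp.Real_Asymp"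
begin

text \<open>
  Through the spectral representation the operators become multiplication by functions of the
  real number \<open>a w\<close>, so everything reduces to scalar bounds for \<open>e y = E\<^bsub>\<alpha>,1\<^esub>(i y)\<close> on the real line:
  \<open>e\<close>, \<open>y e'\<close> and \<open>y (y e')'\<close> are bounded.  With \<open>y = t\<^sup>\<alpha>\<close> these are the series
  \<open>\<Sum>k. k\<^sup>j i\<^sup>k t\<^bsup>\<alpha>k\<^esup> / \<Gamma>(\<alpha>k + 1)\<close>, \<open>j = 0, 1, 2\<close>.  Their Laplace transforms are rational in
  \<open>\<zeta> = i s\<^bsup>-\<alpha>\<^esup>\<close> with a pole only at \<open>\<zeta> = 1\<close>, and since \<open>\<alpha> < 1\<close> the values \<open>\<zeta>\<close> stay in a sector
  away from \<open>1\<close> for \<open>Re s > 0\<close>.  After subtracting \<open>1 / (s + 1)\<close> when \<open>j = 0\<close>, they are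
  integrable along vertical lines uniformly up to the imaginary axis, and Laplace inversion there
  gives the bounds.  Inversion itself is obtained by comparing real Laplace transforms, which are
  injective by the Weierstrass approximation theorem.

  The bounds make \<open>t \<mapsto> S\<^sub>t x\<close> Lipschitz away from \<open>0\<close> (and \<open>\<alpha>\<close>-Hoelder on \<open>D\<close>), and give
  \<open>\<parallel>P\<^sub>r\<parallel> \<le> C r\<^bsup>\<alpha>-1\<^esup>\<close>, \<open>\<parallel>P\<^sub>r - P\<^sub>s\<parallel> \<le> C \<bar>r\<^bsup>\<alpha>-1\<^esup> - s\<^bsup>\<alpha>-1\<^esup>\<bar>\<close>.  Hoelder's inequality then estimates
  the increments of \<open>G F\<close> by \<open>\<bar>t - s\<bar>\<^bsup>\<alpha> - 1 + 1/q'\<^esup>\<close>.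
\<close>

section \<open>Laplace transforms of powers and their inversion\<close>

text \<open>No contour is bent around the branch cut: only vertical lines with
  \<open>Re s > 0\<close> occur. A priori each series grows at most like \<open>exp (2 * t)\<close>,
  so its transform is identified only for \<open>s > 2\<close>. Boundedness is gained because the
  rational expression in \<zeta> lives on the whole half-plane and its integral over
  \<open>Re s = \<epsilon>\<close> is bounded independently of \<epsilon>, while the factor
  \<open>exp (\<epsilon> * t)\<close> tends to 1. Each transform is \<open>1 / s\<close> times a
  function of \<zeta>. Uniform integrability over the lines asks for size \<open>|\<zeta>|\<close>
  at infinity and \<open>1 / |\<zeta>|\<close> at 0, that is \<open>|s| powr (- 1 - a)\<close> and
  \<open>|s| powr (a - 1)\<close>. For j = 0 the function \<open>1 / (1 - \<zeta>)\<close> tends to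
  1 at infinity, reflecting e(0) = 1; \<open>exp (- t)\<close> has the same value at 0 and is itself
  bounded. The operator \<open>y d/dy\<close> is the right one because d/dt of e(b t^\<alpha>) is
  \<alpha>/t times y e'(y) at y = b t^\<alpha>: such bounds are uniform in the spectral value b. The
  lower bound on q says exactly that \<alpha> - 1 + 1/q' exceeds the Hoelder exponent 1 -
  \<alpha>.\<close>

lemma nonneg_has_integral_imp_set_integral_lborel:
  fixes f :: "real \<Rightarrow> real"
  assumes f: "f \<in> borel_measurable borel" and S: "S \<in> sets borel"
    and nn: "\<And>x. x \<in> S \<Longrightarrow> 0 \<le> f x" and I: "(f has_integral I) S"
  shows "set_integrable lborel S f" "(LINT x:S|lborel. f x) = I"
proof -
  have I0: "0 \<le> I" by (rule has_integral_nonneg[OF I]) (use nn in auto)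
  have "(\<integral>\<^sup>+x. ennreal (indicator S x * f x) \<partial>lborel) = ennreal I"
  proof (rule nn_integral_has_integral_lborel)
    have "(\<lambda>x. indicator S x * f x) = (\<lambda>x. if x \<in> S then f x else 0)"
      by (auto simp: indicator_def)
    with I show "((\<lambda>x. indicator S x * f x) has_integral I) UNIV"
      by (simp add: has_integral_restrict_UNIV)
  qed (use f S nn in \<open>auto simp: indicator_def\<close>)
  then have "integrable lborel (\<lambda>x. indicator S x * f x) \<and> (LINT x|lborel. indicator S x * f x) = I"
    using f S nn I0
    by (subst nn_integral_eq_integrable[symmetric]) (auto simp: indicator_def)
  then show "set_integrable lborel S f" "(LINT x:S|lborel. f x) = I"
    by (auto simp: set_integrable_def set_lebesgue_integral_def)
qed

lemma laplace_powr:
  fixes s b :: real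
  assumes s: "s > 0" and b: "b > -1"
  shows "set_integrable lborel {0..} (\<lambda>t. exp (- s * t) * t powr b)"
    and "(LINT t:{0..}|lborel. exp (- s * t) * t powr b) = Gamma (b + 1) / s powr (b + 1)"
proof -
  let ?f = "\<lambda>t::real. t powr b / exp t"
  have G: "((\<lambda>t. t powr b / exp t) has_integral Gamma (b+1)) {0..}"
    using Gamma_integral_real[of "b+1"] b by simp
  have 1: "set_integrable lborel {0..} ?f" "(LINT x:{0..}|lborel. ?f x) = Gamma (b+1)"
    by (rule nonneg_has_integral_imp_set_integral_lborel[OF _ _ _ G]; simp)+
  then have 2: "has_bochner_integral lborel (\<lambda>t. indicator {0..} t *\<^sub>R ?f t) (Gamma (b+1))"
    by (auto simp: set_integrable_def set_lebesgue_integral_def has_bochner_integral_iff)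
  have "has_bochner_integral lborel (\<lambda>t. indicator {0..} (0 + s * t) *\<^sub>R ?f (0 + s * t)) (Gamma (b+1) /\<^sub>R \<bar>s\<bar>)"
    by (rule lborel_has_bochner_integral_real_affine_iff[THEN iffD1, OF _ 2]) (use s in simp)
  then have "has_bochner_integral lborel (\<lambda>t. (1 / s powr b) *\<^sub>R (indicator {0..} (0 + s * t) *\<^sub>R ?f (0 + s * t)))
      ((1 / s powr b) *\<^sub>R (Gamma (b+1) /\<^sub>R \<bar>s\<bar>))"
    by (rule has_bochner_integral_scaleR_right)
  also have "(\<lambda>t. (1 / s powr b) *\<^sub>R (indicator {0..} (0 + s * t) *\<^sub>R ?f (0 + s * t)))
     = (\<lambda>t. indicator {0..} t *\<^sub>R (exp (- s * t) * t powr b))"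
    using s by (auto simp: fun_eq_iff indicator_def powr_mult exp_minus field_simps zero_le_mult_iff)
  also have "((1 / s powr b) *\<^sub>R (Gamma (b+1) /\<^sub>R \<bar>s\<bar>)) = Gamma (b + 1) / s powr (b + 1)"
    using s by (simp add: powr_add field_simps)
  finally show "set_integrable lborel {0..} (\<lambda>t. exp (- s * t) * t powr b)"
    and "(LINT t:{0..}|lborel. exp (- s * t) * t powr b) = Gamma (b + 1) / s powr (b + 1)"
    by (auto simp: set_integrable_def set_lebesgue_integral_def has_bochner_integral_iff)
qed

lemma set_integrable_exp_minus:
  fixes s :: real
  assumes "s > 0"
  shows "set_integrable lborel {0..} (\<lambda>t. exp (- s * t))"
  by (rule nonneg_has_integral_imp_set_integral_lborel(1)[where I="exp (- s * 0) / s"])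
     (use has_integral_exp_minus_to_infinity[of s 0] assms in \<open>auto simp: exp_minus\<close>)

text \<open>On the tail \<open>u \<ge> x\<close> of the Gamma integral, x = s t, one has
  \<open>u powr b \<ge> x powr b\<close>, and \<open>exp (- u)\<close> integrates to
  \<open>exp (- x)\<close>. With \<open>b = a * k\<close> this serves as a weak Stirling bound,
  giving both the convergence of the series and their exponential growth rate.\<close>

lemma powr_exp_le_Gamma:
  fixes s t b :: real
  assumes s: "s > 0" and t: "t \<ge> 0" and b: "b \<ge> 0"
  shows "(s * t) powr b * exp (- (s * t)) \<le> Gamma (b + 1)"
proof -
  let ?x = "s * t"
  have x: "?x \<ge> 0" using s t by simp
  have I: "((\<lambda>u. u powr b / exp u) has_integral Gamma (b+1)) {0..}"
    using Gamma_integral_real[of "b+1"] b by simp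
  have J: "((\<lambda>u. exp (- 1 * u)) has_integral exp (- 1 * ?x) / 1) {?x..}"
    by (rule has_integral_exp_minus_to_infinity) simp
  have J': "((\<lambda>u. ?x powr b * exp (- 1 * u)) has_integral ?x powr b * (exp (- 1 * ?x) / 1)) {?x..}"
    by (rule has_integral_mult_right[OF J])
  have "?x powr b * (exp (- 1 * ?x) / 1) \<le> Gamma (b+1)"
  proof (rule has_integral_le)
    show "((\<lambda>u. if u \<in> {?x..} then ?x powr b * exp (- 1 * u) else 0) has_integral ?x powr b * (exp (- 1 * ?x) / 1)) {0..}"
      using J' x by (subst has_integral_restrict) auto
    show "((\<lambda>u. u powr b / exp u) has_integral Gamma (b+1)) {0..}" by (rule I)
    fix u :: real assume "u \<in> {0..}"
    then show "(if u \<in> {?x..} then ?x powr b * exp (- 1 * u) else 0) \<le> u powr b / exp u"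
      using powr_mono2[of b ?x u] x b by (auto simp: exp_minus field_simps)
  qed
  then show ?thesis by simp
qed

text \<open>In the variable x = exp(-t) the hypothesis is orthogonality to all monomials, hence by
  Weierstrass to all continuous functions of x on [0,1]. A test function built from \<open>g\<close>
  itself then produces the integral of a weighted square.\<close>

lemma laplace_injective_weighted:
  fixes g :: "real \<Rightarrow> real"
  assumes cont: "continuous_on {0..} g" and bd: "\<And>t. t \<ge> 0 \<Longrightarrow> \<bar>g t\<bar> \<le> K"
    and int: "set_integrable lborel {0..} g"
    and zero: "\<And>n::nat. (LINT t:{0..}|lborel. exp (- t) ^ n * g t) = 0"
    and t: "t \<ge> 0"
  shows "g t = 0"
proof -
  have int_mult: "set_integrable lborel {0..} (\<lambda>t. h (exp (- t)) * g t)"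
    if h: "continuous_on {0..1} h" for h :: "real \<Rightarrow> real"
  proof -
    have "compact (h ` {0..1})" using compact_continuous_image[OF h] by simp
    then obtain B where B: "\<And>x. x \<in> {0..1} \<Longrightarrow> \<bar>h x\<bar> \<le> B"
      using compact_imp_bounded bounded_real by fastforce
    have "continuous_on {0..} (\<lambda>t::real. h (exp (- t)))"
      by (rule continuous_on_compose2[OF h]) (auto intro!: continuous_intros)
    then have meas: "set_borel_measurable lborel {0..} (\<lambda>t::real. h (exp (- t)) * g t)"
      using borel_measurable_continuous_on_indicator[OF _ continuous_on_mult[OF _ cont]]
      unfolding set_borel_measurable_def by simp
    have "set_integrable lborel {0..} (\<lambda>t. B * g t)" using int by (rule set_integrable_mult_right)
    then show ?thesis
    proof (rule set_integrable_bound[OF _ meas])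
      have "B \<ge> 0" using B[of 0] by auto
      then show "AE x in lborel. x \<in> {0..} \<longrightarrow> norm (h (exp (- x)) * g x) \<le> norm (B * g x)"
        using B by (auto intro!: AE_I2 simp: abs_mult intro: mult_right_mono)
    qed
  qed
  have poly0: "(LINT t:{0..}|lborel. p (exp (- t)) * g t) = 0" if p: "real_polynomial_function p" for p :: "real \<Rightarrow> real"
  proof -
    obtain a n where p: "p = (\<lambda>x. \<Sum>i\<le>n. a i * x ^ i)"
      using p unfolding real_polynomial_function_iff_sum by auto
    have I: "set_integrable lborel {0..} (\<lambda>t. exp (- t) ^ i * g t)" for i :: nat
      by (rule int_mult[of "\<lambda>x. x ^ i"]) (intro continuous_intros)
    have "(LINT t:{0..}|lborel. p (exp (- t)) * g t) = (LINT t:{0..}|lborel. (\<Sum>i\<le>n. a i * (exp (- t) ^ i * g t)))"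
      by (simp add: p sum_distrib_right mult.assoc)
    also have "\<dots> = (\<Sum>i\<le>n. LINT t:{0..}|lborel. a i * (exp (- t) ^ i * g t))"
    proof -
      have "integrable lborel (\<lambda>x. indicator {0..} x *\<^sub>R (a i * (exp (- x) ^ i * g x)))" for i
        using set_integrable_mult_right[OF I] unfolding set_integrable_def .
      then show ?thesis
        unfolding set_lebesgue_integral_def scaleR_sum_right by (intro Bochner_Integration.integral_sum)
    qed
    also have "\<dots> = 0" by (simp only: set_integral_mult_right zero) simp
    finally show ?thesis .
  qed
  have all0: "(LINT t:{0..}|lborel. h (exp (- t)) * g t) = 0" if h: "continuous_on {0..1} h" for h :: "real \<Rightarrow> real"
  proof -
    let ?N = "LINT t:{0..}|lborel. \<bar>g t\<bar>"
    have intabs: "set_integrable lborel {0..} (\<lambda>t. \<bar>g t\<bar>)"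
      using set_integrable_abs[OF int] .
    have N0: "?N \<ge> 0" unfolding set_lebesgue_integral_def by (intro integral_nonneg_AE AE_I2) (auto simp: indicator_def)
    have le: "\<bar>LINT t:{0..}|lborel. h (exp (- t)) * g t\<bar> \<le> e * ?N" if e: "e > 0" for e
    proof -
      obtain p where p: "real_polynomial_function p" "\<And>x. x \<in> {0..1} \<Longrightarrow> \<bar>h x - p x\<bar> < e"
        using Stone_Weierstrass_real_polynomial_function[OF compact_Icc h e] by auto
      have pc: "continuous_on {0..1} p"
        using p(1) continuous_real_polymonial_function continuous_at_imp_continuous_on by blast
      have "(LINT t:{0..}|lborel. h (exp (- t)) * g t)
          = (LINT t:{0..}|lborel. h (exp (- t)) * g t) - (LINT t:{0..}|lborel. p (exp (- t)) * g t)"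
        using poly0[OF p(1)] by simp
      also have "\<dots> = (LINT t:{0..}|lborel. h (exp (- t)) * g t - p (exp (- t)) * g t)"
        by (rule set_integral_diff(2)[symmetric]) (intro int_mult h pc)+
      finally have "\<bar>LINT t:{0..}|lborel. h (exp (- t)) * g t\<bar>
         = norm (LINT t:{0..}|lborel. h (exp (- t)) * g t - p (exp (- t)) * g t)" by simp
      also have "\<dots> \<le> (LINT t:{0..}|lborel. norm (h (exp (- t)) * g t - p (exp (- t)) * g t))"
        unfolding set_lebesgue_integral_def
        by (rule order_trans[OF integral_norm_bound]) (simp add: abs_mult)
      also have "\<dots> \<le> (LINT t:{0..}|lborel. e * \<bar>g t\<bar>)"
      proof (rule set_integral_mono)
        show "set_integrable lborel {0..} (\<lambda>t. norm (h (exp (- t)) * g t - p (exp (- t)) * g t))"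
          by (intro set_integrable_norm set_integral_diff(1) int_mult h pc)
        show "set_integrable lborel {0..} (\<lambda>t. e * \<bar>g t\<bar>)"
          by (intro set_integrable_mult_right intabs)
        fix x :: real assume "x \<in> {0..}"
        then have "\<bar>h (exp (- x)) - p (exp (- x))\<bar> \<le> e" using p(2)[of "exp (- x)"] by auto
        then show "norm (h (exp (- x)) * g x - p (exp (- x)) * g x) \<le> e * \<bar>g x\<bar>"
          by (simp add: left_diff_distrib[symmetric] abs_mult mult_right_mono)
      qed
      finally show ?thesis by simp
    qed
    \<comment> \<open>\<open>?N\<close> may vanish, hence the divisor \<open>?N + 1\<close>.\<close>
    have le2: "\<bar>LINT t:{0..}|lborel. h (exp (- t)) * g t\<bar> \<le> e" if "e > 0" for e
    proof -
      have "\<bar>LINT t:{0..}|lborel. h (exp (- t)) * g t\<bar> \<le> e / (?N + 1) * ?N"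
        using le[of "e / (?N + 1)"] that N0 by simp
      also have "\<dots> \<le> e"
      proof -
        have "N / (N + 1) \<le> 1" if "N \<ge> 0" for N :: real using that by simp
        from mult_left_mono[OF this[OF N0], of e] that show ?thesis by simp
      qed
      finally show ?thesis .
    qed
    have "\<bar>LINT t:{0..}|lborel. h (exp (- t)) * g t\<bar> \<le> 0"
    proof (rule field_le_epsilon)
      fix e :: real assume "e > 0"
      from le2[OF this] show "\<bar>LINT t:{0..}|lborel. h (exp (- t)) * g t\<bar> \<le> 0 + e" by simp
    qed
    then show ?thesis by simp
  qed
  \<comment> \<open>The factor x makes \<open>h\<close> continuous at 0, that is as t tends to
    infinity, where \<open>g\<close> is only known to be bounded. Its price is the positive weight
    \<open>exp (- t)\<close> in front of the square.\<close>
  define h where "h = (\<lambda>x. if x = 0 then 0 else x * g (- ln x))"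
  have hc: "continuous_on {0..1} h"
  proof (rule continuous_on_eq_continuous_within[THEN iffD2], rule ballI)
    fix x :: real assume x: "x \<in> {0..1}"
    show "continuous (at x within {0..1}) h"
    proof (cases "x = 0")
      case True
      have "((\<lambda>x. h x) \<longlongrightarrow> 0) (at 0 within {0..1})"
      proof (rule Lim_null_comparison)
        show "\<forall>\<^sub>F x in at 0 within {0..1}. norm (h x) \<le> K * x"
          unfolding eventually_at_filter h_def
          by (rule always_eventually) (use bd in \<open>auto simp: abs_mult mult.commute[of K] intro!: mult_left_mono\<close>)
        show "((\<lambda>x. K * x) \<longlongrightarrow> 0) (at 0 within {0..1})" by (auto intro!: tendsto_eq_intros)
      qed
      then show ?thesis using True by (simp add: continuous_within h_def)
    next
      case False
      have "continuous_on {0<..1} (\<lambda>x. x * g (- ln x))"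
        by (intro continuous_intros continuous_on_compose2[OF cont]) auto
      then have "continuous_on {0<..1} h" by (rule continuous_on_eq) (auto simp: h_def)
      moreover have "at x within {0..1} = at x within {0<..1}"
        by (rule at_within_nhd[of _ "{0<..}"]) (use x False in auto)
      ultimately show ?thesis using x False by (auto simp: continuous_on_eq_continuous_within)
    qed
  qed
  have sq: "h (exp (- t)) * g t = exp (- t) * (g t)\<^sup>2" for t by (simp add: h_def power2_eq_square)
  have int2: "set_integrable lborel {0..} (\<lambda>t. exp (- t) * (g t)\<^sup>2)"
    using int_mult[OF hc] by (simp add: sq)
  have z2: "(LINT t:{0..}|lborel. exp (- t) * (g t)\<^sup>2) = 0"
    using all0[OF hc] by (simp add: sq)
  \<comment> \<open>The criterion for a nonnegative continuous integrand with integral 0 is applied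
    on a compact interval; ending at \<open>t + 1\<close> keeps the interval nondegenerate even for
    \<open>t = 0\<close>.\<close>
  have sub: "set_integrable lborel {0..t+1} (\<lambda>t. exp (- t) * (g t)\<^sup>2)"
    by (rule set_integrable_subset[OF int2]) auto
  have "(LINT t:{0..t+1}|lborel. exp (- t) * (g t)\<^sup>2) \<le> (LINT t:{0..}|lborel. exp (- t) * (g t)\<^sup>2)"
    using int2 sub unfolding set_lebesgue_integral_def set_integrable_def
    by (intro integral_mono) (auto simp: indicator_def)
  moreover have "(LINT t:{0..t+1}|lborel. exp (- t) * (g t)\<^sup>2) \<ge> 0"
    unfolding set_lebesgue_integral_def by (intro integral_nonneg_AE AE_I2) (auto simp: indicator_def)
  ultimately have "(LINT t:{0..t+1}|lborel. exp (- t) * (g t)\<^sup>2) = 0" using z2 by linarith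
  then have "((\<lambda>t. exp (- t) * (g t)\<^sup>2) has_integral 0) (cbox 0 (t+1))"
    using set_borel_integral_eq_integral[OF sub] by (simp add: has_integral_integral)
  then have "exp (- t) * (g t)\<^sup>2 = 0"
    by (rule has_integral_0_cbox_imp_0[rotated 2])
       (use t in \<open>auto intro!: continuous_intros continuous_on_subset[OF cont]\<close>)
  then show ?thesis by simp
qed

text \<open>The line is closed to the right by a rectangle of size R. On its other three sides the
  integrand is at most \<open>B * R powr (- 1 - a) / (R - s)\<close> and their total length is 4 R,
  so they vanish in the limit. The left-hand side is the integral that Fubini produces from the
  Laplace transform of the inversion integral.\<close>

lemma Cauchy_integral_formula_half_plane:
  fixes H :: "complex \<Rightarrow> complex" and a B \<epsilon> s :: real
  assumes hol: "H holomorphic_on {z. 0 < Re z}" and a: "a > 0"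
    and bd: "\<And>z. 0 < Re z \<Longrightarrow> norm (H z) \<le> B * norm z powr (- 1 - a)"
    and \<epsilon>: "0 < \<epsilon>" "\<epsilon> < s"
    and int: "integrable lborel (\<lambda>\<omega>. H (Complex \<epsilon> \<omega>) / (s - Complex \<epsilon> \<omega>))"
  shows "(LINT \<omega>|lborel. H (Complex \<epsilon> \<omega>) / (s - Complex \<epsilon> \<omega>)) = 2 * pi * H s"
proof -
  let ?g = "\<lambda>w. H w / (w - s)"
  let ?k = "\<lambda>\<omega>. H (Complex \<epsilon> \<omega>) / (s - Complex \<epsilon> \<omega>)"
  let ?S = "{z::complex. 0 < Re z}"
  have "norm (H 1) \<le> B" using bd[of 1] by simp
  then have B: "B \<ge> 0" by (rule order_trans[OF norm_ge_zero])
  have key: "norm (2 * pi * H s - integral {-R..R} ?k) \<le> 4 * (B * R powr (- 1 - a) / (R - s) * (2 * R))"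
    if R: "R > s" for R
  proof -
    \<comment> \<open>Counterclockwise corners, starting at the lower end of the piece of the line
      \<open>Re z = \<epsilon>\<close>; the width R places the pole \<open>s\<close> inside as soon
      as \<open>R > s\<close>.\<close>
    define a1 a2 a3 a4 where A: "a1 = Complex \<epsilon> (-R)" "a2 = Complex (R+\<epsilon>) (-R)" "a3 = Complex (R+\<epsilon>) R" "a4 = Complex \<epsilon> R"
    have rp: "rectpath a1 a3 = linepath a1 a2 +++ linepath a2 a3 +++ linepath a3 a4 +++ linepath a4 a1"
      by (simp add: rectpath_def A Let_def)
    have R0: "R > 0" using R \<epsilon> by simp
    have s_in: "complex_of_real s \<in> box a1 a3" using R R0 \<epsilon> by (auto simp: in_box_complex_iff A)
    have img: "path_image (rectpath a1 a3) \<subseteq> ?S - {complex_of_real s}"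
      using \<epsilon> R R0 by (subst path_image_rectpath) (auto simp: A)
    have conv: "convex ?S" by (rule convex_halfspace_Re_gt)
    have opn: "open ?S" by (rule open_halfspace_Re_gt)
    have "(?g has_contour_integral (2*pi * \<i> * winding_number (rectpath a1 a3) s * H s)) (rectpath a1 a3)"
      using Cauchy_integral_formula_convex_simple[OF conv hol, of s "rectpath a1 a3"] img \<epsilon> opn
      by (auto simp: interior_open)
    then have C: "(?g has_contour_integral (2*pi * \<i> * H s)) (rectpath a1 a3)"
      by (simp add: winding_number_rectpath[OF s_in])
    have cont: "continuous_on (?S - {complex_of_real s}) ?g"
      by (intro continuous_intros holomorphic_on_imp_continuous_on[OF holomorphic_on_subset[OF hol]]) auto
    have segs: "closed_segment a1 a2 \<union> closed_segment a2 a3 \<union> closed_segment a3 a4 \<union> closed_segment a4 a1 \<subseteq> ?S - {complex_of_real s}"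
      using img unfolding rp by (auto simp: path_image_join)
    have ci: "?g contour_integrable_on linepath a1 a2" "?g contour_integrable_on linepath a2 a3"
       "?g contour_integrable_on linepath a3 a4" "?g contour_integrable_on linepath a4 a1"
      using segs by (auto intro!: contour_integrable_continuous_linepath continuous_on_subset[OF cont])
    have sum: "2*pi * \<i> * H s = contour_integral (linepath a1 a2) ?g + contour_integral (linepath a2 a3) ?g
        + contour_integral (linepath a3 a4) ?g + contour_integral (linepath a4 a1) ?g"
      using contour_integral_unique[OF C] ci unfolding rp
      by (simp add: contour_integral_join add_ac)
    have D0: "B * R powr (- 1 - a) / (R - s) \<ge> 0" using B R by simp
    have big: "norm (?g w) \<le> B * R powr (- 1 - a) / (R - s)" if w: "Re w > 0" "norm w \<ge> R" for w
    proof -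
      have "norm (w - s) \<ge> R - s"
        using norm_triangle_ineq2[of w "complex_of_real s"] w \<epsilon> by simp
      moreover have "norm (H w) \<le> B * R powr (- 1 - a)"
        by (rule order_trans[OF bd[OF w(1)] mult_left_mono[OF powr_mono2' B]]) (use a w R0 in auto)
      ultimately show ?thesis using R B by (auto simp: norm_divide intro!: frac_le)
    qed
    have b1: "norm (contour_integral (linepath a1 a2) ?g) \<le> B * R powr (- 1 - a) / (R - s) * norm (a2 - a1)"
    proof (rule contour_integral_bound_linepath[OF ci(1) D0 big])
      fix x assume "x \<in> closed_segment a1 a2"
      then have "Im x = - R" "Re x > 0" using \<epsilon> R0 by (auto simp: A closed_segment_same_Im closed_segment_eq_real_ivl)
      then show "Re x > 0" "norm x \<ge> R" using abs_Im_le_cmod[of x] R0 by auto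
    qed
    have b2: "norm (contour_integral (linepath a2 a3) ?g) \<le> B * R powr (- 1 - a) / (R - s) * norm (a3 - a2)"
    proof (rule contour_integral_bound_linepath[OF ci(2) D0 big])
      fix x assume "x \<in> closed_segment a2 a3"
      then have "Re x = R + \<epsilon>" using \<epsilon> R0 by (auto simp: A closed_segment_same_Re)
      then show "Re x > 0" "norm x \<ge> R" using abs_Re_le_cmod[of x] R0 \<epsilon> by auto
    qed
    have b3: "norm (contour_integral (linepath a3 a4) ?g) \<le> B * R powr (- 1 - a) / (R - s) * norm (a4 - a3)"
    proof (rule contour_integral_bound_linepath[OF ci(3) D0 big])
      fix x assume "x \<in> closed_segment a3 a4"
      then have "Im x = R" "Re x > 0" using \<epsilon> R0 by (auto simp: A closed_segment_same_Im closed_segment_eq_real_ivl)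
      then show "Re x > 0" "norm x \<ge> R" using abs_Im_le_cmod[of x] R0 by auto
    qed
    have n: "norm (a2 - a1) = R" "norm (a3 - a2) = 2 * R" "norm (a4 - a3) = R"
      using R0 by (auto simp: A complex_eq_iff cmod_def real_sqrt_mult)
    \<comment> \<open>The left side is run downwards; this sign cancels the one from replacing
      \<open>w - s\<close> by \<open>s - w\<close> in the denominator, and the parametrization
      contributes the factor \<i>.\<close>
    have "contour_integral (linepath a4 a1) ?g = - contour_integral (linepath a1 a4) ?g"
      using contour_integral_reversepath[of "linepath a1 a4" ?g] by simp
    also have "contour_integral (linepath a1 a4) ?g = \<i> * integral {-R..R} (\<lambda>\<omega>. ?g (Complex \<epsilon> \<omega>))"
      by (rule contour_integral_linepath_same_Re) (use R0 in \<open>auto simp: A\<close>)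
    also have "(\<lambda>\<omega>. ?g (Complex \<epsilon> \<omega>)) = (\<lambda>\<omega>. - ?k \<omega>)"
      by (auto simp: fun_eq_iff minus_divide_right)
    finally have last: "contour_integral (linepath a4 a1) ?g = \<i> * integral {-R..R} ?k"
      by simp
    have eq: "2*pi * \<i> * H s - \<i> * integral {-R..R} ?k = contour_integral (linepath a1 a2) ?g
        + contour_integral (linepath a2 a3) ?g + contour_integral (linepath a3 a4) ?g"
      unfolding sum last by (rule add_diff_cancel_right')
    have "norm (2 * pi * H s - integral {-R..R} ?k) = norm (\<i> * (2 * pi * H s - integral {-R..R} ?k))"
      by (simp add: norm_mult)
    also have "\<i> * (2 * pi * H s - integral {-R..R} ?k) = 2*pi * \<i> * H s - \<i> * integral {-R..R} ?k"
      by (simp add: algebra_simps)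
    also have "norm \<dots> = norm (contour_integral (linepath a1 a2) ?g
        + contour_integral (linepath a2 a3) ?g + contour_integral (linepath a3 a4) ?g)"
      by (simp only: eq)
    also have "\<dots> \<le> norm (contour_integral (linepath a1 a2) ?g) + norm (contour_integral (linepath a2 a3) ?g)
        + norm (contour_integral (linepath a3 a4) ?g)"
      using norm_triangle_mono[OF norm_triangle_ineq order_refl] .
    also have "\<dots> \<le> B * R powr (- 1 - a) / (R - s) * R + B * R powr (- 1 - a) / (R - s) * (2 * R) + B * R powr (- 1 - a) / (R - s) * R"
      by (rule add_mono[OF add_mono[OF b1[unfolded n] b2[unfolded n]] b3[unfolded n]])
    also have "\<dots> = 4 * (B * R powr (- 1 - a) / (R - s) * R)" by (simp add: algebra_simps)
    also have "\<dots> \<le> 4 * (B * R powr (- 1 - a) / (R - s) * (2 * R))"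
      using D0 R0 by (intro mult_left_mono) auto
    finally show ?thesis .
  qed
  have L1: "(\<lambda>n. integral {- real n..real n} ?k) \<longlonglongrightarrow> (LINT \<omega>|lborel. ?k \<omega>)"
  proof -
    have si: "set_integrable lborel {-real n..real n} ?k" for n
      using int by (simp add: set_integrable_def integrable_mult_indicator)
    have "(\<lambda>n. LINT \<omega>|lborel. indicator {-real n..real n} \<omega> *\<^sub>R ?k \<omega>) \<longlonglongrightarrow> (LINT \<omega>|lborel. ?k \<omega>)"
    proof (rule integral_dominated_convergence[where w="\<lambda>\<omega>. norm (?k \<omega>)"])
      show "AE x in lborel. (\<lambda>n. indicator {-real n..real n} x *\<^sub>R ?k x) \<longlonglongrightarrow> ?k x"
      proof (intro AE_I2 tendsto_eventually)
        fix x :: real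
        have "\<forall>\<^sub>F n in sequentially. real n \<ge> \<bar>x\<bar>" by real_asymp
        then show "\<forall>\<^sub>F n in sequentially. indicator {-real n..real n} x *\<^sub>R ?k x = ?k x"
          proof (rule eventually_mono)
            fix n assume "\<bar>x\<bar> \<le> real n"
            then have "x \<in> {-real n..real n}" by auto
            then show "indicator {-real n..real n} x *\<^sub>R ?k x = ?k x" by simp
          qed
      qed
    qed (use int in \<open>auto simp: indicator_def\<close>)
    also have "(\<lambda>n. LINT \<omega>|lborel. indicator {-real n..real n} \<omega> *\<^sub>R ?k \<omega>) = (\<lambda>n. integral {- real n..real n} ?k)"
      using set_borel_integral_eq_integral(2)[OF si] by (simp add: set_lebesgue_integral_def)
    finally show ?thesis .
  qed
  have L2: "(\<lambda>n. integral {- real n..real n} ?k) \<longlonglongrightarrow> 2 * pi * H s"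
  proof (rule LIM_zero_cancel, rule Lim_null_comparison)
    have "\<forall>\<^sub>F n in sequentially. real n > s" by real_asymp
    then show "\<forall>\<^sub>F n in sequentially. norm (integral {- real n..real n} ?k - 2 * pi * H s)
        \<le> 4 * (B * real n powr (- 1 - a) / (real n - s) * (2 * real n))"
    proof eventually_elim
      case (elim n)
      then show ?case using key[OF elim] by (subst norm_minus_commute)
    qed
    have "(\<lambda>n. real n powr (- 1 - a) / (real n - s) * (2 * real n)) \<longlonglongrightarrow> 0"
      using a by real_asymp
    from tendsto_mult_left[OF this, of "4 * B"]
    show "(\<lambda>n. 4 * (B * real n powr (- 1 - a) / (real n - s) * (2 * real n))) \<longlonglongrightarrow> 0"
      by (simp add: mult.assoc)
  qed
  show ?thesis by (rule LIMSEQ_unique[OF L1 L2])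
qed

section \<open>Inversion along vertical lines, with a majorant independent of the line\<close>

lemma integral_exp_atLeast_0:
  fixes c :: complex
  assumes c: "Re c < 0"
  shows "set_integrable lborel {0..} (\<lambda>t. exp (c * of_real t))"
    and "(LINT t:{0..}|lborel. exp (c * of_real t)) = - 1 / c"
proof -
  have c0: "c \<noteq> 0" using c by auto
  show int: "set_integrable lborel {0..} (\<lambda>t. exp (c * of_real t))"
  proof (rule set_integrable_bound[OF set_integrable_exp_minus[of "- Re c"]])
    show "set_borel_measurable lborel {0..} (\<lambda>t. exp (c * complex_of_real t))"
      unfolding set_borel_measurable_def by measurable
  qed (use c in auto)
  have 1: "((\<lambda>y. LINT t|lborel. indicator {..y} t *\<^sub>R (indicator {0..} t *\<^sub>R exp (c * of_real t)))
      \<longlongrightarrow> (LINT t|lborel. indicator {0..} t *\<^sub>R exp (c * of_real t))) at_top"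
    by (rule tendsto_integral_at_top) (use int in \<open>auto simp: set_integrable_def\<close>)
  have eq: "(LINT t|lborel. indicator {..y} t *\<^sub>R (indicator {0..} t *\<^sub>R exp (c * of_real t))) = (exp (c * of_real y) - 1) / c"
    if y: "y \<ge> 0" for y :: real
  proof -
    have F: "((\<lambda>t. exp (c * of_real t)) has_integral (exp (c * of_real y) / c - exp (c * of_real 0) / c)) {0..y}"
    proof (rule fundamental_theorem_of_calculus[OF y])
      fix x assume "x \<in> {0..y}"
      have "((\<lambda>w. exp (c * w) / c) has_field_derivative exp (c * of_real x)) (at (of_real x))"
        using c0 by (auto intro!: derivative_eq_intros)
      then have "((\<lambda>t. exp (c * of_real t) / c) has_vector_derivative exp (c * of_real x)) (at x)"
        by (rule has_vector_derivative_real_field)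
      then show "((\<lambda>t. exp (c * of_real t) / c) has_vector_derivative exp (c * of_real x)) (at x within {0..y})"
        by (rule has_vector_derivative_at_within)
    qed
    have "set_integrable lborel {0..y} (\<lambda>t. exp (c * of_real t))"
      by (rule set_integrable_subset[OF int]) auto
    from set_borel_integral_eq_integral(2)[OF this] F
    have "(LINT t:{0..y}|lborel. exp (c * of_real t)) = (exp (c * of_real y) - 1) / c"
      by (simp add: integral_unique diff_divide_distrib)
    also have "(LINT t:{0..y}|lborel. exp (c * of_real t)) = (LINT t|lborel. indicator {..y} t *\<^sub>R (indicator {0..} t *\<^sub>R exp (c * of_real t)))"
      unfolding set_lebesgue_integral_def by (rule Bochner_Integration.integral_cong) (auto simp: indicator_def)
    finally show ?thesis .
  qed
  have 2: "((\<lambda>y. LINT t|lborel. indicator {..y} t *\<^sub>R (indicator {0..} t *\<^sub>R exp (c * of_real t))) \<longlongrightarrow> (0 - 1) / c) at_top"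
  proof (rule Lim_transform_eventually)
    show "\<forall>\<^sub>F y in at_top. (exp (c * of_real y) - 1) / c = (LINT t|lborel. indicator {..y} t *\<^sub>R (indicator {0..} t *\<^sub>R exp (c * of_real t)))"
      using eventually_ge_at_top[of 0] by eventually_elim (use eq in simp)
    have "((\<lambda>y::real. exp (Re c * y)) \<longlongrightarrow> 0) at_top" using c by real_asymp
    then have "((\<lambda>y. norm (exp (c * of_real y))) \<longlongrightarrow> 0) at_top"
      by (simp add: norm_exp_eq_Re)
    then have "((\<lambda>y. exp (c * of_real y)) \<longlongrightarrow> 0) at_top"
      by (rule tendsto_norm_zero_cancel)
    then show "((\<lambda>y. (exp (c * of_real y) - 1) / c) \<longlongrightarrow> (0 - 1) / c) at_top"
      using c0 by (intro tendsto_intros)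
  qed
  show "(LINT t:{0..}|lborel. exp (c * of_real t)) = - 1 / c"
    using tendsto_unique[OF _ 1 2] by (simp add: set_lebesgue_integral_def)
qed

text \<open>Majorant in the imaginary part alone, hence uniform over all lines
  \<open>Re z = \<epsilon>\<close>. It is integrable because \<open>a - 1 > -1\<close> and
  \<open>- 1 - a < -1\<close>. At absolute value 1 both pieces count, which is harmless for an upper
  bound.\<close>

definition decay_kernel :: "real \<Rightarrow> real \<Rightarrow> real" where
  "decay_kernel a \<omega> = indicator {0..1} \<bar>\<omega>\<bar> * \<bar>\<omega>\<bar> powr (a - 1) + indicator {1..} \<bar>\<omega>\<bar> * \<bar>\<omega>\<bar> powr (- 1 - a)"

lemma decay_kernel_nonneg: "decay_kernel a \<omega> \<ge> 0"
  by (simp add: decay_kernel_def)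

lemma integrable_decay_kernel:
  assumes a: "a > 0"
  shows "integrable lborel (decay_kernel a)"
proof -
  let ?M = "\<lambda>\<omega>::real. indicator {0..1} \<omega> *\<^sub>R \<omega> powr (a - 1) + indicator {1..} \<omega> *\<^sub>R \<omega> powr (- 1 - a)"
  have "set_integrable lborel {0..1} (\<lambda>\<omega>. \<omega> powr (a - 1))"
    by (rule nonneg_has_integral_imp_set_integral_lborel(1)[OF _ _ _ has_integral_powr_from_0]) (use a in auto)
  moreover have "set_integrable lborel {1..} (\<lambda>\<omega>. \<omega> powr (- 1 - a))"
    by (rule nonneg_has_integral_imp_set_integral_lborel(1)[OF _ _ _ has_integral_powr_to_inf]) (use a in auto)
  ultimately have M: "integrable lborel ?M" unfolding set_integrable_def by (rule Bochner_Integration.integrable_add)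
  have "integrable lborel (\<lambda>\<omega>. ?M (0 + (-1) * \<omega>))"
    by (rule lborel_integrable_real_affine[OF M]) simp
  with M have "integrable lborel (\<lambda>\<omega>. ?M \<omega> + ?M (0 + (-1) * \<omega>))"
    by (rule Bochner_Integration.integrable_add)
  then show ?thesis
  proof (rule Bochner_Integration.integrable_bound)
    show "decay_kernel a \<in> borel_measurable lborel" unfolding decay_kernel_def by measurable
    show "AE \<omega> in lborel. norm (decay_kernel a \<omega>) \<le> norm (?M \<omega> + ?M (0 + (-1) * \<omega>))"
      by (intro AE_I2) (auto simp: decay_kernel_def indicator_def)
  qed
qed

text \<open>Both exponents are negative and \<open>\<bar>\<omega>\<bar> \<le> norm z\<close>, so
  passing from z to its imaginary part only enlarges the powers. The point \<omega> = 0 is excluded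
  since \<open>0 powr (a - 1) = 0\<close> makes the kernel vanish there.\<close>

lemma norm_le_decay_kernel:
  fixes a B :: real
  assumes a: "0 < a" "a < 1" and B: "B \<ge> 0" and \<omega>: "\<omega> \<noteq> 0"
    and bd: "h \<le> B * min (norm z powr (a - 1)) (norm z powr (- 1 - a))" and z: "Im z = \<omega>"
  shows "h \<le> B * decay_kernel a \<omega>"
proof -
  have n: "norm z \<ge> \<bar>\<omega>\<bar>" using abs_Im_le_cmod[of z] z by simp
  have "min (norm z powr (a - 1)) (norm z powr (- 1 - a)) \<le> decay_kernel a \<omega>"
  proof (cases "\<bar>\<omega>\<bar> \<le> 1")
    case True
    have "norm z powr (a - 1) \<le> \<bar>\<omega>\<bar> powr (a - 1)" by (rule powr_mono2') (use a n \<omega> in auto)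
    also have "\<dots> \<le> decay_kernel a \<omega>" using True by (simp add: decay_kernel_def)
    finally show ?thesis by simp
  next
    case False
    have "norm z powr (- 1 - a) \<le> \<bar>\<omega>\<bar> powr (- 1 - a)" by (rule powr_mono2') (use a n \<omega> in auto)
    also have "\<dots> \<le> decay_kernel a \<omega>" using False by (simp add: decay_kernel_def)
    finally show ?thesis by simp
  qed
  then show ?thesis using bd B by (meson mult_left_mono order_trans)
qed

lemma set_integrable_exp_growth:
  fixes g :: "real \<Rightarrow> complex"
  assumes g: "continuous_on {0..} g" "\<And>t. t \<ge> 0 \<Longrightarrow> norm (g t) \<le> L * exp (c * t)" and s: "s > c"
  shows "set_integrable lborel {0..} (\<lambda>t. exp (- s * t) *\<^sub>R g t)"
proof (rule set_integrable_bound)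
  show "set_integrable lborel {0..} (\<lambda>t. L * exp (- (s - c) * t))"
    by (rule set_integrable_mult_right[OF set_integrable_exp_minus]) (use s in simp)
  show "set_borel_measurable lborel {0..} (\<lambda>t. exp (- s * t) *\<^sub>R g t)"
  proof -
    have "continuous_on {0..} (\<lambda>t. exp (- s * t) *\<^sub>R g t)" by (intro continuous_intros g(1))
    from borel_measurable_continuous_on_indicator[OF _ this] show ?thesis
      by (simp add: set_borel_measurable_def)
  qed
  show "AE x in lborel. x \<in> {0..} \<longrightarrow> norm (exp (- s * x) *\<^sub>R g x) \<le> norm (L * exp (- (s - c) * x))"
  proof (intro AE_I2 impI)
    fix x :: real assume "x \<in> {0..}"
    then have "norm (exp (- s * x) *\<^sub>R g x) \<le> exp (- s * x) * (L * exp (c * x))"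
      using g(2)[of x] by (simp add: mult_left_mono)
    also have "\<dots> = L * (exp (- s * x) * exp (c * x))" by simp
    also have "exp (- s * x) * exp (c * x) = exp (- (s - c) * x)" by (simp add: exp_add[symmetric] algebra_simps)
    finally show "norm (exp (- s * x) *\<^sub>R g x) \<le> norm (L * exp (- (s - c) * x))" by simp
  qed
qed

text \<open>For each small \<epsilon> the inversion integral of \<open>H\<close> over
  \<open>Re z = \<epsilon>\<close> is a function \<open>j\<close> bounded by
  \<open>exp (\<epsilon> * t)\<close> times the claimed constant. By Fubini and the half-plane
  Cauchy formula its transform is again \<open>H\<close>, so \<open>f = j\<close> by injectivity;
  then \<epsilon> tends to 0. Thus \<open>f\<close> need not be recovered from \<open>H\<close> by
  any pointwise inversion theorem.\<close>

lemma laplace_transform_bound: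
  fixes f :: "real \<Rightarrow> complex" and H :: "complex \<Rightarrow> complex" and a B K c :: real
  assumes a: "0 < a" "a < 1" and c: "c > 0"
    and cont: "continuous_on {0..} f" and growth: "\<And>t. t \<ge> 0 \<Longrightarrow> norm (f t) \<le> K * exp (c * t)"
    and hol: "H holomorphic_on {z. 0 < Re z}"
    and bd: "\<And>z. 0 < Re z \<Longrightarrow> norm (H z) \<le> B * min (norm z powr (a - 1)) (norm z powr (- 1 - a))"
    and lap: "\<And>s. s > c \<Longrightarrow> (LINT t:{0..}|lborel. exp (- s * t) *\<^sub>R f t) = H s"
    and t: "t \<ge> 0"
  shows "norm (f t) \<le> B * integral\<^sup>L lborel (decay_kernel a)"
proof -
  have "norm (H 1) \<le> B" using bd[of 1] by simp
  then have B: "B \<ge> 0" by (rule order_trans[OF norm_ge_zero])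
  have "norm (f 0) \<le> K" using growth[of 0] by simp
  then have K: "K \<ge> 0" by (rule order_trans[OF norm_ge_zero])
  define W where "W = integral\<^sup>L lborel (decay_kernel a)"
  have W: "W \<ge> 0" unfolding W_def by (intro integral_nonneg_AE AE_I2 decay_kernel_nonneg)
  \<comment> \<open>Requiring \<open>\<epsilon> < c\<close> makes the transforms of \<open>f\<close>
    and of \<open>j\<close> both available for every \<open>s > c\<close>.\<close>
  have main: "norm (f t) \<le> exp (\<epsilon> * t) * (B * W)" if \<epsilon>: "0 < \<epsilon>" "\<epsilon> < c" for \<epsilon>
  proof -
    define k where "k = (\<lambda>\<omega>. H (Complex \<epsilon> \<omega>))"
    have kc: "continuous_on UNIV k" unfolding k_def
      by (rule continuous_on_compose2[OF holomorphic_on_imp_continuous_on[OF hol]])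
         (use \<epsilon> in \<open>auto simp: Complex_eq intro!: continuous_intros\<close>)
    then have km[measurable]: "k \<in> borel_measurable borel"
      by (rule borel_measurable_continuous_onI)
    have kb: "AE \<omega> in lborel. norm (k \<omega>) \<le> B * decay_kernel a \<omega>"
    proof -
      have "AE \<omega> in lborel. \<omega> \<noteq> (0::real)" by (rule AE_lborel_singleton)
      then show ?thesis
      proof eventually_elim
        case (elim \<omega>)
        show ?case unfolding k_def
          by (rule norm_le_decay_kernel[OF a B elim bd]) (use \<epsilon> in auto)
      qed
    qed
    have iD: "integrable lborel (\<lambda>\<omega>. B * decay_kernel a \<omega>)"
      using integrable_decay_kernel[OF a(1)] by simp
    have ik: "integrable lborel k"
      by (rule Bochner_Integration.integrable_bound[OF iD]) (use kb in \<open>auto elim!: eventually_mono\<close>)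
    have kn: "(LINT \<omega>|lborel. norm (k \<omega>)) \<le> B * W"
    proof -
      have "(LINT \<omega>|lborel. norm (k \<omega>)) \<le> (LINT \<omega>|lborel. B * decay_kernel a \<omega>)"
        by (rule integral_mono_AE) (use ik iD kb in auto)
      then show ?thesis by (simp add: W_def)
    qed
    define e where "e = (\<lambda>t \<omega>. exp (Complex \<epsilon> \<omega> * complex_of_real t))"
    have en: "norm (e t \<omega>) = exp (\<epsilon> * t)" for t \<omega> by (simp add: e_def norm_exp_eq_Re)
    have em: "(\<lambda>\<omega>. e t \<omega>) \<in> borel_measurable borel" for t
      unfolding e_def by (intro borel_measurable_continuous_onI) (auto simp: Complex_eq intro!: continuous_intros)
    \<comment> \<open>The complex inversion integral on the chosen line. Its factor
      \<open>1 / (2 * pi)\<close> is needed exactly for the transform, but is estimated by 1 in the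
      bound.\<close>
    define j where "j = (\<lambda>t. (1 / (2 * pi)) *\<^sub>R (LINT \<omega>|lborel. e t \<omega> * k \<omega>))"
    have jb: "norm (j t) \<le> exp (\<epsilon> * t) * (B * W)" for t
    proof -
      have "norm (LINT \<omega>|lborel. e t \<omega> * k \<omega>) \<le> (LINT \<omega>|lborel. norm (e t \<omega> * k \<omega>))"
        by (rule integral_norm_bound)
      also have "\<dots> = exp (\<epsilon> * t) * (LINT \<omega>|lborel. norm (k \<omega>))"
        by (simp add: norm_mult en)
      also have "\<dots> \<le> exp (\<epsilon> * t) * (B * W)" by (rule mult_left_mono[OF kn]) simp
      finally have 1: "norm (LINT \<omega>|lborel. e t \<omega> * k \<omega>) \<le> exp (\<epsilon> * t) * (B * W)" .
      have "2 * pi \<ge> 1" using pi_gt3 by simp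
      then have "1 / (2 * pi) \<le> 1" by simp
      then have "norm (j t) \<le> 1 * norm (LINT \<omega>|lborel. e t \<omega> * k \<omega>)"
        unfolding j_def norm_scaleR by (intro mult_right_mono) auto
      with 1 show ?thesis by simp
    qed
    have jc: "continuous_on {0..} j"
    proof -
      have "continuous_on {0..} (\<lambda>t. LINT \<omega>|lborel. e t \<omega> * k \<omega>)"
      proof (rule continuous_on_sequentiallyI)
        fix u :: "nat \<Rightarrow> real" and x assume u: "\<forall>n. u n \<in> {0..}" "x \<in> {0..}" "u \<longlonglongrightarrow> x"
        obtain R where R: "\<And>n. norm (u n) \<le> R" using convergent_imp_Bseq[OF convergentI[OF u(3)]] by (auto simp: Bseq_def)
        show "(\<lambda>n. LINT \<omega>|lborel. e (u n) \<omega> * k \<omega>) \<longlonglongrightarrow> (LINT \<omega>|lborel. e x \<omega> * k \<omega>)"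
        proof (rule integral_dominated_convergence[where w="\<lambda>\<omega>. exp (\<epsilon> * R) * norm (k \<omega>)"])
          show "AE \<omega> in lborel. (\<lambda>n. e (u n) \<omega> * k \<omega>) \<longlonglongrightarrow> e x \<omega> * k \<omega>"
            unfolding e_def by (intro AE_I2 tendsto_intros u)
          show "AE \<omega> in lborel. norm (e (u n) \<omega> * k \<omega>) \<le> exp (\<epsilon> * R) * norm (k \<omega>)" for n
          proof (intro AE_I2)
            fix \<omega>
            have "u n \<le> R" using R[of n] by simp
            then show "norm (e (u n) \<omega> * k \<omega>) \<le> exp (\<epsilon> * R) * norm (k \<omega>)"
              using \<epsilon> by (auto simp: norm_mult en intro!: mult_right_mono)
          qed
          show "(\<lambda>\<omega>. e x \<omega> * k \<omega>) \<in> borel_measurable lborel" using em[of x] by simp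
          show "(\<lambda>\<omega>. e (u n) \<omega> * k \<omega>) \<in> borel_measurable lborel" for n using em[of "u n"] by simp
          show "integrable lborel (\<lambda>\<omega>. exp (\<epsilon> * R) * norm (k \<omega>))" using ik by simp
        qed
      qed
      then show ?thesis unfolding j_def by (intro continuous_intros)
    qed
    have lapj: "(LINT t:{0..}|lborel. exp (- s * t) *\<^sub>R j t) = H s" if s: "s > c" for s
    proof -
      have s\<epsilon>: "\<epsilon> < s" using s \<epsilon> by simp
      \<comment> \<open>Integrand of the double integral. Its norm is a product of functions of
        \<omega> and of t, with decay rate \<open>s - \<epsilon> > 0\<close> in t, so Fubini
        applies; integrating over t first leaves the Cauchy kernel.\<close>
      define F where "F = (\<lambda>\<omega> t. indicator {0..} t *\<^sub>R (exp ((Complex \<epsilon> \<omega> - of_real s) * of_real t) * k \<omega>))"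
      have Fn: "norm (F \<omega> t) = norm (k \<omega>) * (indicator {0..} t *\<^sub>R exp (- (s - \<epsilon>) * t))" for \<omega> t
        by (simp add: F_def norm_mult norm_exp_eq_Re indicator_def)
      have ie: "integrable lborel (\<lambda>t. indicator {0..} t *\<^sub>R exp (- (s - \<epsilon>) * t))"
        using set_integrable_exp_minus[of "s - \<epsilon>"] s\<epsilon> by (simp add: set_integrable_def)
      have E: "set_integrable lborel {0..} (\<lambda>t. exp ((Complex \<epsilon> \<omega> - of_real s) * of_real t))"
          "(LINT t:{0..}|lborel. exp ((Complex \<epsilon> \<omega> - of_real s) * of_real t)) = - 1 / (Complex \<epsilon> \<omega> - of_real s)" for \<omega>
        using integral_exp_atLeast_0[of "Complex \<epsilon> \<omega> - of_real s"] s\<epsilon> by auto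
      have FE: "F \<omega> t = (indicator {0..} t *\<^sub>R exp ((Complex \<epsilon> \<omega> - of_real s) * of_real t)) * k \<omega>" for \<omega> t
        by (simp add: F_def)
      have Fi: "integrable lborel (F \<omega>)" for \<omega>
        unfolding FE using E(1)[of \<omega>] unfolding set_integrable_def by (rule integrable_mult_left)
      have FI: "(LINT t|lborel. F \<omega> t) = k \<omega> / (of_real s - Complex \<epsilon> \<omega>)" for \<omega>
      proof -
        have "(LINT t|lborel. F \<omega> t) = (- 1 / (Complex \<epsilon> \<omega> - of_real s)) * k \<omega>"
          unfolding FE Bochner_Integration.integral_mult_left_zero
          using E(2)[of \<omega>] unfolding set_lebesgue_integral_def by (simp only:)
        also have "\<dots> = k \<omega> / (of_real s - Complex \<epsilon> \<omega>)"
          by (metis (no_types, opaque_lifting) minus_diff_eq minus_divide_right mult.commute mult_minus_left mult_1 times_divide_eq_right divide_minus_left)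
        finally show ?thesis .
      qed
      have Fm: "case_prod F \<in> borel_measurable (lborel \<Otimes>\<^sub>M lborel)"
      proof -
        have "(\<lambda>p::real\<times>real. exp ((Complex \<epsilon> (fst p) - of_real s) * of_real (snd p))) \<in> borel_measurable borel"
          by (intro borel_measurable_continuous_onI) (auto simp: Complex_eq intro!: continuous_intros)
        then have [measurable]: "(\<lambda>p::real\<times>real. exp ((Complex \<epsilon> (fst p) - of_real s) * of_real (snd p))) \<in> borel_measurable (borel \<Otimes>\<^sub>M borel)"
          by (simp add: borel_prod)
        have "(\<lambda>p. indicator {0..} (snd p) *\<^sub>R (exp ((Complex \<epsilon> (fst p) - of_real s) * of_real (snd p)) * k (fst p))) \<in> borel_measurable (lborel \<Otimes>\<^sub>M lborel)"
          by measurable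
        then show ?thesis by (simp add: F_def case_prod_beta')
      qed
      have FF: "integrable (lborel \<Otimes>\<^sub>M lborel) (case_prod F)"
      proof (rule lborel_pair.Fubini_integrable[OF Fm])
        have "(\<lambda>\<omega>. LINT t|lborel. norm (case_prod F (\<omega>, t))) = (\<lambda>\<omega>. norm (k \<omega>) * (LINT t|lborel. indicator {0..} t *\<^sub>R exp (- (s - \<epsilon>) * t)))"
          by (simp only: prod.case Fn Bochner_Integration.integral_mult_right_zero)
        then show "integrable lborel (\<lambda>\<omega>. LINT t|lborel. norm (case_prod F (\<omega>, t)))"
          using ik by (simp only:) (intro integrable_mult_left integrable_norm)
        show "AE \<omega> in lborel. integrable lborel (\<lambda>t. case_prod F (\<omega>, t))" using Fi by simp
      qed
      have "(LINT t:{0..}|lborel. exp (- s * t) *\<^sub>R j t) = (LINT t|lborel. (1 / (2 * pi)) *\<^sub>R (LINT \<omega>|lborel. F \<omega> t))"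
        unfolding set_lebesgue_integral_def
      proof (rule Bochner_Integration.integral_cong[OF refl])
        fix t :: real
        have "F \<omega> t = complex_of_real (indicator {0..} t * exp (- s * t)) * (e t \<omega> * k \<omega>)" for \<omega>
          by (auto simp: F_def e_def indicator_def left_diff_distrib exp_diff exp_minus exp_of_real[symmetric] field_simps)
        then have "(LINT \<omega>|lborel. F \<omega> t) = complex_of_real (indicator {0..} t * exp (- s * t)) * (LINT \<omega>|lborel. e t \<omega> * k \<omega>)"
          by (simp only: Bochner_Integration.integral_mult_right_zero)
        then show "indicator {0..} t *\<^sub>R exp (- s * t) *\<^sub>R j t = (1 / (2 * pi)) *\<^sub>R (LINT \<omega>|lborel. F \<omega> t)"
          by (simp add: j_def scaleR_conv_of_real)
      qed
      also have "\<dots> = (1 / (2 * pi)) *\<^sub>R (LINT t|lborel. (LINT \<omega>|lborel. F \<omega> t))"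
        by (rule integral_scaleR_right)
      also have "(LINT t|lborel. (LINT \<omega>|lborel. F \<omega> t)) = (LINT \<omega>|lborel. (LINT t|lborel. F \<omega> t))"
        by (rule lborel_pair.Fubini_integral[OF FF])
      also have "\<dots> = (LINT \<omega>|lborel. H (Complex \<epsilon> \<omega>) / (s - Complex \<epsilon> \<omega>))"
        by (simp only: FI k_def)
      also have "\<dots> = 2 * pi * H s"
      proof (rule Cauchy_integral_formula_half_plane[OF hol a(1) _ \<epsilon>(1) s\<epsilon>])
        show "norm (H z) \<le> B * norm z powr (- 1 - a)" if "0 < Re z" for z
          using bd[OF that] B by (meson min.cobounded2 mult_left_mono order_trans)
        show "integrable lborel (\<lambda>\<omega>. H (Complex \<epsilon> \<omega>) / (s - Complex \<epsilon> \<omega>))"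
          using lborel_pair.integrable_fst'[OF FF] by (simp add: FI k_def)
      qed
      finally show ?thesis by (simp add: scaleR_conv_of_real)
    qed
    \<comment> \<open>The weight \<open>exp (- s1 * t)\<close> makes the difference bounded and
      integrable, and its moments against \<open>exp (- t) ^ n\<close> are differences of transforms
      at \<open>n + s1\<close>, which lies in the admissible range above c.\<close>
    define s1 where "s1 = c + 1"
    define d where "d = (\<lambda>t. exp (- s1 * t) *\<^sub>R (f t - j t))"
    have fj: "norm (f t - j t) \<le> (K + B * W) * exp (c * t)" if "t \<ge> 0" for t
    proof -
      have "exp (\<epsilon> * t) \<le> exp (c * t)" using that \<epsilon> by (simp add: mult_right_mono)
      then have "exp (\<epsilon> * t) * (B * W) \<le> exp (c * t) * (B * W)" by (rule mult_right_mono) (use B W in simp)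
      then show ?thesis using norm_triangle_ineq4[of "f t" "j t"] growth[OF that] jb[of t] by (simp add: algebra_simps)
    qed
    have dc: "continuous_on {0..} d" unfolding d_def by (intro continuous_intros cont jc)
    have db: "norm (d t) \<le> (K + B * W) * exp (- 1 * t)" if "t \<ge> 0" for t
    proof -
      have "norm (d t) \<le> exp (- s1 * t) * ((K + B * W) * exp (c * t))"
        unfolding d_def norm_scaleR using fj[OF that] by (simp add: mult_left_mono)
      also have "\<dots> = (K + B * W) * (exp (- s1 * t) * exp (c * t))" by simp
      also have "exp (- s1 * t) * exp (c * t) = exp (- 1 * t)" by (simp add: s1_def exp_add[symmetric] algebra_simps)
      finally show ?thesis .
    qed
    have jb': "norm (j t) \<le> (B * W) * exp (c * t)" if "t \<ge> 0" for t
    proof -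
      have "exp (\<epsilon> * t) \<le> exp (c * t)" using that \<epsilon> by (simp add: mult_right_mono)
      then have "exp (\<epsilon> * t) * (B * W) \<le> exp (c * t) * (B * W)" by (rule mult_right_mono) (use B W in simp)
      then show ?thesis using jb[of t] by (simp add: mult.commute)
    qed
    have dn: "exp (- t) ^ n *\<^sub>R d t = exp (- (n + s1) * t) *\<^sub>R f t - exp (- (n + s1) * t) *\<^sub>R j t" for n :: nat and t
      by (simp add: d_def exp_of_nat_mult[symmetric] exp_add[symmetric] scaleR_diff_right algebra_simps)
    have dint: "set_integrable lborel {0..} (\<lambda>t. exp (- t) ^ n *\<^sub>R d t)" for n :: nat
      unfolding dn by (intro set_integral_diff set_integrable_exp_growth[OF cont growth] set_integrable_exp_growth[OF jc jb']) (auto simp: s1_def)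
    have dzero: "(LINT t:{0..}|lborel. exp (- t) ^ n *\<^sub>R d t) = 0" for n :: nat
    proof -
      have sn: "n + s1 > c" by (simp add: s1_def)
      have "(LINT t:{0..}|lborel. exp (- t) ^ n *\<^sub>R d t) = H (n + s1) - H (n + s1)"
        unfolding dn using set_integral_diff(2)[OF set_integrable_exp_growth[OF cont growth sn] set_integrable_exp_growth[OF jc jb' sn]] lap[OF sn] lapj[OF sn]
        by simp
      then show ?thesis by simp
    qed
    \<comment> \<open>The injectivity lemma concerns real functions; it is applied to the real and
      the imaginary part through this common form.\<close>
    have bl0: "L (d t) = 0" if L: "bounded_linear L" "\<And>z. \<bar>L z\<bar> \<le> norm z" for L :: "complex \<Rightarrow> real"
    proof (rule laplace_injective_weighted[where g="\<lambda>t. L (d t)" and K="K + B * W"])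
      interpret bounded_linear L by fact
      show "continuous_on {0..} (\<lambda>t. L (d t))" by (rule continuous_on[OF dc])
      show "\<bar>L (d t)\<bar> \<le> K + B * W" if "t \<ge> 0" for t
      proof -
        have "(K + B * W) * exp (- 1 * t) \<le> (K + B * W) * 1"
          by (rule mult_left_mono) (use that K B W in auto)
        then show ?thesis using order_trans[OF order_trans[OF L(2) db[OF that]]] by simp
      qed
      have Ld: "indicator {0..} t *\<^sub>R (exp (- t) ^ n * L (d t)) = L (indicator {0..} t *\<^sub>R (exp (- t) ^ n *\<^sub>R d t))" for n t
        by (simp only: scaleR real_scaleR_def)
      have "set_integrable lborel {0..} (\<lambda>t. exp (- t) ^ 0 * L (d t))"
        unfolding set_integrable_def Ld
        by (rule integrable_bounded_linear[OF L(1) dint[unfolded set_integrable_def]])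
      then show "set_integrable lborel {0..} (\<lambda>t. L (d t))" by simp
      show "(LINT t:{0..}|lborel. exp (- t) ^ n * L (d t)) = 0" for n
        unfolding set_lebesgue_integral_def Ld
        using integral_bounded_linear[OF L(1) dint[unfolded set_integrable_def]] dzero[unfolded set_lebesgue_integral_def, of n]
        by (simp only: zero)
    qed (use t in auto)
    have "Re (d t) = 0" by (rule bl0[OF bounded_linear_Re abs_Re_le_cmod])
    moreover have "Im (d t) = 0" by (rule bl0[OF bounded_linear_Im abs_Im_le_cmod])
    ultimately have "d t = 0" by (simp add: complex_eq_iff)
    then have "f t = j t" by (simp add: d_def)
    then show ?thesis using jb[of t] by simp
  qed
  \<comment> \<open>The sequence \<epsilon> = c/(n + 2) tends to 0 and stays strictly below c
    already at n = 0.\<close>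
  have "(\<lambda>n::nat. exp (c / (n + 2) * t) * (B * W)) \<longlonglongrightarrow> exp 0 * (B * W)"
  proof (intro tendsto_intros)
    have "(\<lambda>n::nat. 1 / (real n + 2)) \<longlonglongrightarrow> 0" by real_asymp
    from tendsto_mult_left[OF this, of "c * t"] show "(\<lambda>n. c / (real n + 2) * t) \<longlonglongrightarrow> 0" by simp
  qed
  then have "norm (f t) \<le> exp 0 * (B * W)"
  proof (rule LIMSEQ_le_const, intro exI[of _ 0] allI impI)
    fix n :: nat
    have "c * 1 < c * (real n + 2)" using c by (intro mult_strict_left_mono) auto
    then have "c / (real n + 2) < c" by (simp add: pos_divide_less_eq)
    then show "norm (f t) \<le> exp (c / (real n + 2) * t) * (B * W)"
      using c by (intro main) auto
  qed
  then show ?thesis by (simp add: W_def)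
qed

section \<open>Mittag-Leffler series on the imaginary axis\<close>

text \<open>The twice differentiated geometric series has coefficients (k + 1)(k + 2), which
  dominate the squares.\<close>

lemma summable_square_power:
  fixes q :: real
  assumes "0 \<le> q" "q < 1"
  shows "summable (\<lambda>k. (real k + 1)\<^sup>2 * q ^ k)"
proof -
  have 1: "summable (\<lambda>k. diffs (diffs (\<lambda>_. 1)) k * q ^ k)" if q: "0 \<le> q" "q < 1" for q :: real
  proof -
    \<comment> \<open>Each termwise differentiation asks for convergence on a larger disc; two
      intermediate radii leave room for two of them.\<close>
    obtain r where r: "q < r" "r < 1" using dense[OF q(2)] by auto
    obtain r' where r': "r < r'" "r' < 1" using dense[OF r(2)] by auto
    have D: "summable (\<lambda>k. diffs (\<lambda>_. 1) k * x ^ k)" if "norm x < r'" for x :: real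
    proof (rule termdiff_converges[OF that])
      fix x :: real assume "norm x < r'"
      then have "norm x < 1" using r' by linarith
      then show "summable (\<lambda>k. 1 * x ^ k)" by (simp add: summable_geometric)
    qed
    show ?thesis
    proof (rule termdiff_converges[of q r])
      show "norm q < r" using q r by simp
      fix x :: real assume "norm x < r"
      then show "summable (\<lambda>k. diffs (\<lambda>_. 1) k * x ^ k)" using r' by (intro D) linarith
    qed
  qed
  show ?thesis
  proof (rule summable_comparison_test'[OF 1[OF assms]])
    fix n :: nat
    have "(real n + 1)\<^sup>2 \<le> (real n + 1) * (real n + 2)" by (simp add: power2_eq_square)
    then have "(real n + 1)\<^sup>2 * q ^ n \<le> (real n + 1) * (real n + 2) * q ^ n"
      by (rule mult_right_mono) (use assms in simp)
    then show "norm ((real n + 1)\<^sup>2 * q ^ n) \<le> diffs (diffs (\<lambda>_. 1)) n * q ^ n"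
      using assms by (simp add: diffs_def abs_mult add.commute mult.assoc)
  qed
qed

text \<open>Shifting the index by one turns each sum into a linear equation for itself, with the
  lower-order sums on the right. The weights k and k^2 correspond to z d/dz applied once and twice
  to the geometric series, so z = 1 remains the only pole.\<close>

lemma suminf_of_nat_mult_power:
  fixes z :: complex
  assumes z: "norm z < 1"
  shows "summable (\<lambda>k. of_nat k * z ^ k)" "(\<Sum>k. of_nat k * z ^ k) = z / (1 - z)\<^sup>2"
    and "summable (\<lambda>k. (of_nat k)\<^sup>2 * z ^ k)" "(\<Sum>k. (of_nat k)\<^sup>2 * z ^ k) = z * (1 + z) / (1 - z) ^ 3"
proof -
  have z1: "z \<noteq> 1" using z by auto
  have S2: "summable (\<lambda>k. (real k + 1)\<^sup>2 * norm z ^ k)"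
    by (rule summable_square_power) (use z in auto)
  have s0: "(\<lambda>k. z ^ k) sums (1 / (1 - z))" using geometric_sums[OF z] .
  have le: "real k ^ j \<le> (real k + 1)\<^sup>2" if "j \<le> 2" for k j :: nat
  proof -
    have "real k ^ j \<le> (real k + 1) ^ j" by (rule power_mono) auto
    also have "\<dots> \<le> (real k + 1)\<^sup>2" by (rule power_increasing) (use that in auto)
    finally show ?thesis .
  qed
  have sm: "summable (\<lambda>k. (of_nat k) ^ j * z ^ k)" if "j \<le> 2" for j
    by (rule summable_comparison_test'[OF S2])
       (use le[OF that] in \<open>auto simp: norm_mult norm_power intro!: mult_right_mono\<close>)
  show s1: "summable (\<lambda>k. of_nat k * z ^ k)" using sm[of 1] by simp
  show s2: "summable (\<lambda>k. (of_nat k)\<^sup>2 * z ^ k)" using sm[of 2] by simp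
  let ?S1 = "\<Sum>k. of_nat k * z ^ k" and ?S2 = "\<Sum>k. (of_nat k)\<^sup>2 * z ^ k"
  have "?S1 = (\<Sum>k. of_nat (Suc k) * z ^ Suc k)" using suminf_split_head[OF s1] by simp
  also have "\<dots> = (\<Sum>k. z * (of_nat k * z ^ k + z ^ k))" by (simp add: algebra_simps)
  also have "\<dots> = z * (?S1 + 1 / (1 - z))"
    using s1 s0 by (subst suminf_mult) (auto simp: suminf_add[symmetric] sums_iff intro!: summable_add)
  finally have "?S1 * (1 - z) = z / (1 - z)" by (simp add: algebra_simps)
  then have "?S1 = z / (1 - z) / (1 - z)" using z1 by (subst nonzero_eq_divide_eq) auto
  then show S1: "?S1 = z / (1 - z)\<^sup>2" by (simp add: power2_eq_square)
  have "?S2 = (\<Sum>k. (of_nat (Suc k))\<^sup>2 * z ^ Suc k)" using suminf_split_head[OF s2] by simp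
  also have "\<dots> = (\<Sum>k. z * ((of_nat k)\<^sup>2 * z ^ k + 2 * (of_nat k * z ^ k) + z ^ k))"
    by (simp add: algebra_simps power2_eq_square)
  also have "\<dots> = z * (?S2 + 2 * ?S1 + 1 / (1 - z))"
  proof -
    have "(\<lambda>k. z * ((of_nat k)\<^sup>2 * z ^ k + 2 * (of_nat k * z ^ k) + z ^ k)) sums (z * (?S2 + 2 * ?S1 + 1 / (1 - z)))"
      by (intro sums_mult sums_add s0 summable_sums s1 s2)
    then show ?thesis by (simp add: sums_iff)
  qed
  finally have "?S2 = z * (?S2 + 2 * (z / (1 - z)\<^sup>2) + 1 / (1 - z))" by (simp only: S1)
  then have "?S2 * (1 - z) = z * (2 * (z / (1 - z)\<^sup>2) + 1 / (1 - z))" by (simp add: algebra_simps)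
  also have "2 * (z / (1 - z)\<^sup>2) + 1 / (1 - z) = (1 + z) / (1 - z)\<^sup>2"
  proof -
    have "1 / (1 - z) = (1 - z) / (1 - z)\<^sup>2" using z1 by (simp add: power2_eq_square)
    then have "2 * (z / (1 - z)\<^sup>2) + 1 / (1 - z) = (2 * z + (1 - z)) / (1 - z)\<^sup>2"
      by (simp only: add_divide_distrib times_divide_eq_right)
    then show ?thesis by simp
  qed
  finally have "?S2 = z * ((1 + z) / (1 - z)\<^sup>2) / (1 - z)" using z1 by (subst nonzero_eq_divide_eq) auto
  then show "?S2 = z * (1 + z) / (1 - z) ^ 3"
    by (simp add: power3_eq_cube power2_eq_square mult.assoc)
qed

lemma summable_mittag_leffler_weighted:
  fixes a x :: real
  assumes a: "a > 0" and x: "x \<ge> 0"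
  shows "summable (\<lambda>k. (real k + 1)\<^sup>2 * x ^ k / Gamma (a * k + 1))"
proof -
  \<comment> \<open>Chosen so that \<open>s powr a = 2 * (x + 1)\<close>: the Gamma bound at
    \<open>s\<close> then gives a geometric majorant with ratio x / (2 (x + 1)) < 1.\<close>
  define s where "s = (2 * (x + 1)) powr (1 / a)"
  have s: "s > 0" "s powr a = 2 * (x + 1)" using a x by (auto simp: s_def powr_powr)
  define q where "q = x / (2 * (x + 1))"
  have q: "0 \<le> q" "q < 1" using x by (auto simp: q_def)
  have G: "1 / Gamma (a * k + 1) \<le> exp s / (2 * (x + 1)) ^ k" for k :: nat
  proof -
    have "(s * 1) powr (a * k) * exp (- (s * 1)) \<le> Gamma (a * k + 1)"
      by (rule powr_exp_le_Gamma) (use s a in auto)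
    moreover have "s powr (a * k) = (2 * (x + 1)) ^ k"
      using x by (simp add: s(2) powr_powr[symmetric] powr_realpow)
    ultimately have "(2 * (x + 1)) ^ k / exp s \<le> Gamma (a * k + 1)"
      by (simp add: exp_minus divide_inverse)
    then have "1 / Gamma (a * k + 1) \<le> 1 / ((2 * (x + 1)) ^ k / exp s)"
      by (rule divide_left_mono) (use a x in \<open>auto intro!: mult_pos_pos divide_pos_pos Gamma_real_pos add_nonneg_pos\<close>)
    then show ?thesis by simp
  qed
  have "summable (\<lambda>k. exp s * ((real k + 1)\<^sup>2 * q ^ k))"
    by (rule summable_mult[OF summable_square_power[OF q]])
  then show ?thesis
  proof (rule summable_comparison_test')
    fix k :: nat
    have Gp: "Gamma (a * k + 1) > 0" using a by (intro Gamma_real_pos add_nonneg_pos) auto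
    have "(real k + 1)\<^sup>2 * x ^ k * (1 / Gamma (a * k + 1)) \<le> (real k + 1)\<^sup>2 * x ^ k * (exp s / (2 * (x + 1)) ^ k)"
      by (rule mult_left_mono[OF G]) (use x in auto)
    then show "norm ((real k + 1)\<^sup>2 * x ^ k / Gamma (a * k + 1)) \<le> exp s * ((real k + 1)\<^sup>2 * q ^ k)"
      using Gp x by (simp add: q_def power_divide abs_mult mult_ac)
  qed
qed

text \<open>The weights \<open>\<i> ^ k\<close>, \<open>k * \<i> ^ k\<close> and
  \<open>k^2 * \<i> ^ k\<close> give e, y e' and y (y e')' at a real argument y. The bound
  \<open>(real k + 1)\<^sup>2\<close> on the weights covers all three, so growth and transform are
  treated once.\<close>

definition ml_series :: "real \<Rightarrow> (nat \<Rightarrow> complex) \<Rightarrow> complex \<Rightarrow> complex" where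
  "ml_series a d z = (\<Sum>k. d k / complex_of_real (Gamma (a * k + 1)) * z ^ k)"

lemma Gamma_arg_pos: "a > 0 \<Longrightarrow> Gamma (a * real k + 1) > (0::real)"
  by (intro Gamma_real_pos add_nonneg_pos) auto

lemma norm_ml_series_term:
  assumes a: "a > 0" and d: "norm (d k) \<le> (real k + 1)\<^sup>2"
  shows "norm (d k / complex_of_real (Gamma (a * k + 1)) * z ^ k) \<le> (real k + 1)\<^sup>2 * norm z ^ k / Gamma (a * k + 1)"
  using Gamma_arg_pos[OF a, of k] d
  by (auto simp: norm_mult norm_divide norm_power divide_simps intro!: mult_right_mono)

context
  fixes a :: real and d :: "nat \<Rightarrow> complex"
  assumes a: "a > 0" and d: "\<And>k. norm (d k) \<le> (real k + 1)\<^sup>2"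
begin

lemma summable_norm_ml_series: "summable (\<lambda>k. norm (d k / complex_of_real (Gamma (a * k + 1)) * z ^ k))"
  by (rule summable_comparison_test'[OF summable_mittag_leffler_weighted[OF a norm_ge_zero[of z]]])
     (unfold real_norm_def abs_norm_cancel, rule norm_ml_series_term[where d=d, OF a d])

lemma summable_ml_series: "summable (\<lambda>k. d k / complex_of_real (Gamma (a * k + 1)) * z ^ k)"
  by (rule summable_norm_cancel[OF summable_norm_ml_series])

lemma continuous_ml_series: "continuous_on S (ml_series a d)"
proof (intro continuous_at_imp_continuous_on ballI)
  fix z :: complex
  show "isCont (ml_series a d) z"
    unfolding ml_series_def[abs_def]
    by (rule isCont_powser[where K="of_real (norm z + 1)"])
       (use summable_ml_series in \<open>auto simp del: of_real_add\<close>)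
qed

text \<open>Applying the Gamma bound at 2 t instead of t gains the factor
  \<open>(2 powr (- a)) ^ k\<close>, which makes the majorant summable uniformly in t. The price is
  the growth rate 2.\<close>

lemma ml_series_growth:
  assumes t: "t \<ge> 0"
  shows "norm (ml_series a d (of_real (t powr a))) \<le> (\<Sum>k. (real k + 1)\<^sup>2 * (2 powr (- a)) ^ k) * exp (2 * t)"
proof -
  have q: "0 \<le> (2::real) powr (- a)" "(2::real) powr (- a) < 1" using a by (auto simp: powr_minus_divide)
  let ?x = "\<lambda>k. d k / complex_of_real (Gamma (a * k + 1)) * (of_real (t powr a)) ^ k"
  have tm: "norm (?x k) \<le> exp (2 * t) * ((real k + 1)\<^sup>2 * (2 powr (- a)) ^ k)" for k
  proof -
    have "(t powr a) ^ k \<le> Gamma (a * k + 1) * exp (2 * t) * (2 powr (- a)) ^ k"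
    proof (cases "t = 0")
      \<comment> \<open>Separate because \<open>0 powr 0 = 0\<close>: at t = 0 the splitting of
        \<open>(2 * t) powr (a * k)\<close> into k-th powers fails for k = 0.\<close>
      case True
      then show ?thesis using Gamma_arg_pos[OF a, of k] by (cases "k = 0") (auto simp: power_0_left)
    next
      case False
      then have tp: "t > 0" using t by simp
      have "(2 * t) powr (a * k) * exp (- (2 * t)) \<le> Gamma (a * k + 1)"
        by (rule powr_exp_le_Gamma) (use t a in auto)
      moreover have "(2 * t) powr (a * k) = (2 powr a) ^ k * (t powr a) ^ k"
        using tp by (simp add: powr_mult powr_powr[symmetric] powr_realpow)
      ultimately have "(2 powr a) ^ k * (t powr a) ^ k / exp (2 * t) \<le> Gamma (a * k + 1)"
        by (simp add: exp_minus divide_inverse)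
      then show ?thesis by (simp add: powr_minus power_inverse field_simps)
    qed
    then have "(t powr a) ^ k / Gamma (a * k + 1) \<le> exp (2 * t) * (2 powr (- a)) ^ k"
      using Gamma_arg_pos[OF a, of k] by (simp add: divide_le_eq mult_ac)
    then have "(real k + 1)\<^sup>2 * ((t powr a) ^ k / Gamma (a * k + 1)) \<le> (real k + 1)\<^sup>2 * (exp (2 * t) * (2 powr (- a)) ^ k)"
      by (rule mult_left_mono) simp
    with norm_ml_series_term[where d=d and k=k, OF a d[of k], of "of_real (t powr a)"] show ?thesis by (simp add: mult_ac)
  qed
  have S: "summable (\<lambda>k. exp (2 * t) * ((real k + 1)\<^sup>2 * (2 powr (- a)) ^ k))"
    by (rule summable_mult[OF summable_square_power[OF q]])
  have "norm (suminf ?x) \<le> (\<Sum>k. norm (?x k))" by (rule summable_norm[OF summable_norm_ml_series])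
  also have "\<dots> \<le> (\<Sum>k. exp (2 * t) * ((real k + 1)\<^sup>2 * (2 powr (- a)) ^ k))"
    by (rule suminf_le[OF tm summable_norm_ml_series S])
  also have "\<dots> = exp (2 * t) * (\<Sum>k. (real k + 1)\<^sup>2 * (2 powr (- a)) ^ k)"
    by (rule suminf_mult[OF summable_square_power[OF q]])
  finally show ?thesis by (simp add: ml_series_def mult.commute)
qed

text \<open>Transforming t^(a k) yields Gamma(a k + 1) / s^(a k + 1), so the Gamma factors cancel
  and a power series in s^(-a) remains. Sum and integral may be exchanged because the norms of the
  terms integrate to at most (k + 1)^2 s^(-a k), summable for \<open>s > 1\<close>.\<close>

lemma laplace_ml_series:
  assumes s: "s > 1"
  shows "(LINT t:{0..}|lborel. exp (- s * t) *\<^sub>R ml_series a d (of_real (t powr a)))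
    = of_real (1 / s) * (\<Sum>k. d k * (of_real (s powr (- a))) ^ k)"
proof -
  have s0: "s > 0" using s by simp
  define G where "G k = Gamma (a * real k + 1)" for k
  have Gp: "G k > 0" for k unfolding G_def by (rule Gamma_arg_pos[OF a])
  define h where "h k t = indicator {0..} t * (exp (- s * t) * (t powr a) ^ k)" for k t
  define f where "f k t = (d k / complex_of_real (G k)) * complex_of_real (h k t)" for k t
  have h0: "h k t \<ge> 0" for k t by (simp add: h_def indicator_def)
  have hm[measurable]: "h k \<in> borel_measurable borel" for k unfolding h_def by measurable
  \<comment> \<open>only almost everywhere: \<open>0 powr 0 = 0\<close>, whereas \<open>(0 powr a) ^ 0 = 1\<close>\<close>
  have hae: "AE t in lborel. indicator {0..} t *\<^sub>R (exp (- s * t) * t powr (a * k)) = h k t" for k :: nat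
  proof -
    have "AE t in lborel. t \<noteq> (0::real)" by (rule AE_lborel_singleton)
    then show ?thesis
      by eventually_elim (auto simp: h_def indicator_def powr_powr[symmetric] powr_realpow)
  qed
  have pk: "s powr (a * k + 1) = s * (s powr a) ^ k" for k :: nat
    using s0 by (simp add: powr_add powr_powr[symmetric] powr_realpow)
  have hi: "integrable lborel (h k)" and hI: "integral\<^sup>L lborel (h k) = G k / s * (s powr (- a)) ^ k" for k
  proof -
    have ak: "a * k > -1" using a by (meson less_le_trans mult_nonneg_nonneg neg_less_0_iff_less of_nat_0_le_iff order_less_imp_le zero_less_one)
    note L = laplace_powr[OF s0 ak]
    show "integrable lborel (h k)"
      using L(1) unfolding set_integrable_def
      by (rule integrable_cong_AE_imp) (use hae[of k] in \<open>auto elim: eventually_mono\<close>)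
    have "integral\<^sup>L lborel (h k) = (LINT t:{0..}|lborel. exp (- s * t) * t powr (a * k))"
      unfolding set_lebesgue_integral_def
      by (rule integral_cong_AE) (use hae[of k] in \<open>auto elim: eventually_mono\<close>)
    also have "\<dots> = G k / s * (s powr (- a)) ^ k"
      unfolding L(2) pk G_def using s0 by (simp add: powr_minus power_inverse field_simps)
    finally show "integral\<^sup>L lborel (h k) = G k / s * (s powr (- a)) ^ k" .
  qed
  have q: "0 \<le> s powr (- a)" "s powr (- a) < 1"
    using a s by (auto simp: powr_minus_divide gr_one_powr)
  have fi: "integrable lborel (f k)" for k
    unfolding f_def by (intro integrable_mult_right integrable_of_real hi)
  have fI: "integral\<^sup>L lborel (f k) = of_real (1 / s) * (d k * (of_real (s powr (- a))) ^ k)" for k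
  proof -
    have "integral\<^sup>L lborel (f k) = (d k / complex_of_real (G k)) * complex_of_real (integral\<^sup>L lborel (h k))"
      unfolding f_def by (simp only: Bochner_Integration.integral_mult_right_zero integral_complex_of_real)
    then show ?thesis using Gp[of k] s0 by (simp add: hI field_simps)
  qed
  have fn: "norm (f k t) = norm (d k) / G k * h k t" for k t
    using Gp[of k] h0[of k t] by (simp add: f_def norm_mult norm_divide)
  have fnI: "(LINT t|lborel. norm (f k t)) = norm (d k) * (1 / s * (s powr (- a)) ^ k)" for k
    unfolding fn Bochner_Integration.integral_mult_right_zero hI using Gp[of k] by simp
  have "indicator {0..} t *\<^sub>R (exp (- s * t) *\<^sub>R ml_series a d (of_real (t powr a))) = (\<Sum>k. f k t)" for t
  proof -
    have "f k t = complex_of_real (indicator {0..} t * exp (- s * t)) * (d k / complex_of_real (Gamma (a * k + 1)) * (of_real (t powr a)) ^ k)" for k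
      by (simp add: f_def h_def G_def)
    then have "(\<Sum>k. f k t) = complex_of_real (indicator {0..} t * exp (- s * t)) * ml_series a d (of_real (t powr a))"
      unfolding ml_series_def using suminf_mult[OF summable_ml_series] by simp
    then show ?thesis by (simp add: scaleR_conv_of_real mult.assoc)
  qed
  then have "(LINT t:{0..}|lborel. exp (- s * t) *\<^sub>R ml_series a d (of_real (t powr a))) = (LINT t|lborel. (\<Sum>k. f k t))"
    by (simp only: set_lebesgue_integral_def)
  also have "\<dots> = (\<Sum>k. integral\<^sup>L lborel (f k))"
  proof (rule integral_suminf[OF fi])
    show "AE t in lborel. summable (\<lambda>k. norm (f k t))"
    proof (intro AE_I2)
      fix t :: real
      have "norm (f k t) = indicator {0..} t * exp (- s * t) * norm (d k / complex_of_real (Gamma (a * k + 1)) * (of_real (t powr a)) ^ k)" for k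
        by (simp add: f_def h_def G_def norm_mult norm_divide norm_power)
      then show "summable (\<lambda>k. norm (f k t))" using summable_mult[OF summable_norm_ml_series] by simp
    qed
    show "summable (\<lambda>k. LINT t|lborel. norm (f k t))"
    proof (rule summable_comparison_test'[OF summable_square_power[OF q]])
      fix k :: nat
      have "norm (d k) * (1 / s * (s powr (- a)) ^ k) \<le> (real k + 1)\<^sup>2 * (1 * (s powr (- a)) ^ k)"
        by (intro mult_mono d) (use s in auto)
      then show "norm (LINT t|lborel. norm (f k t)) \<le> (real k + 1)\<^sup>2 * (s powr (- a)) ^ k"
        unfolding fnI using s0 by (simp add: abs_mult)
    qed
  qed
  also have "\<dots> = of_real (1 / s) * (\<Sum>k. d k * (of_real (s powr (- a))) ^ k)"
    unfolding fI
  proof (rule suminf_mult)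
    show "summable (\<lambda>k. d k * (complex_of_real (s powr (- a))) ^ k)"
    proof (rule summable_comparison_test'[OF summable_square_power[OF q]])
      show "norm (d k * (complex_of_real (s powr (- a))) ^ k) \<le> (real k + 1)\<^sup>2 * (s powr (- a)) ^ k" for k
        using d[of k] by (simp add: norm_mult norm_power mult_right_mono)
    qed
  qed
  finally show ?thesis .
qed

end

text \<open>The first bound reads off the imaginary part of 1 - \<zeta>, the second that of (1 -
  \<zeta>) times the conjugate of \<zeta>; both equal -Im \<zeta>. They serve large and small
  \<zeta> respectively.\<close>

lemma norm_one_minus_ge:
  fixes \<zeta> :: complex
  assumes "\<kappa> * norm \<zeta> \<le> Im \<zeta>" and nz: "\<zeta> \<noteq> 0" and "\<kappa> > 0"
  shows "\<kappa> * norm \<zeta> \<le> norm (1 - \<zeta>)" "\<kappa> \<le> norm (1 - \<zeta>)"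
proof -
  show "\<kappa> * norm \<zeta> \<le> norm (1 - \<zeta>)"
    using abs_Im_le_cmod[of "1 - \<zeta>"] assms by simp
  have "(1 - \<zeta>) * cnj \<zeta> = cnj \<zeta> - of_real ((norm \<zeta>)\<^sup>2)"
    by (simp add: algebra_simps complex_norm_square[symmetric])
  then have "Im ((1 - \<zeta>) * cnj \<zeta>) = - Im \<zeta>" by simp
  then have "Im \<zeta> \<le> norm (1 - \<zeta>) * norm \<zeta>"
    using abs_Im_le_cmod[of "(1 - \<zeta>) * cnj \<zeta>"] by (simp add: norm_mult)
  then have "\<kappa> * norm \<zeta> \<le> norm (1 - \<zeta>) * norm \<zeta>" using assms(1) by linarith
  then show "\<kappa> \<le> norm (1 - \<zeta>)" by (rule mult_right_le_imp_le) (use nz in simp)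
qed

section \<open>The symbol \<zeta> = i s^(-a) in its sector, and the three scalar bounds\<close>

context
  fixes a :: real
  assumes a: "0 < a" "a < 1"
begin

definition laplace_arg :: "complex \<Rightarrow> complex" where
  "laplace_arg s = \<i> * exp (- of_real a * Ln s)"

lemma holomorphic_laplace_arg: "laplace_arg holomorphic_on {s. 0 < Re s}"
  unfolding laplace_arg_def[abs_def] by (intro holomorphic_intros) (auto simp: complex_nonpos_Reals_iff)

lemma norm_laplace_arg: "s \<noteq> 0 \<Longrightarrow> norm (laplace_arg s) = norm s powr (- a)"
  by (simp add: laplace_arg_def norm_mult norm_exp_eq_Re powr_def)

lemma laplace_arg_of_real: "s > 0 \<Longrightarrow> laplace_arg (of_real s) = \<i> * of_real (s powr (- a))"
  by (simp add: laplace_arg_def powr_def Ln_of_real exp_of_real[symmetric])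

definition sector_const :: real where "sector_const = cos (a * (pi / 2))"

lemma sector_const_pos: "0 < sector_const" 
  unfolding sector_const_def using a by (intro cos_gt_zero_pi) (auto intro: less_trans[of _ 0])

lemma sector_const_le_1: "sector_const \<le> 1" unfolding sector_const_def by simp

text \<open>The argument of \<zeta> is pi/2 - a arg s, whose sine is cos(a arg s). Since |arg s| <
  pi/2, it is at least cos(a pi/2), and \<open>a < 1\<close> keeps this constant positive.\<close>

lemma Im_laplace_arg_ge:
  assumes s: "Re s > 0"
  shows "sector_const * norm (laplace_arg s) \<le> Im (laplace_arg s)"
proof -
  have s0: "s \<noteq> 0" using s by auto
  have I: "\<bar>Im (Ln s)\<bar> < pi / 2" using Re_Ln_pos_lt_imp[OF s] .
  have "Im (laplace_arg s) = norm (laplace_arg s) * cos (a * \<bar>Im (Ln s)\<bar>)"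
    by (simp add: laplace_arg_def norm_mult norm_exp_eq_Re Re_exp abs_if)
  moreover have "cos (a * (pi / 2)) \<le> cos (a * \<bar>Im (Ln s)\<bar>)"
  proof (rule cos_monotone_0_pi_le)
    show "a * \<bar>Im (Ln s)\<bar> \<le> a * (pi / 2)" using a I by (intro mult_left_mono) auto
    show "a * (pi / 2) \<le> pi" using a mult_mono[of a 1 "pi/2" pi] by simp
  qed (use a in auto)
  ultimately show ?thesis unfolding sector_const_def by (simp add: mult.commute mult_left_mono)
qed

lemma laplace_arg_denom:
  assumes s: "Re s > 0"
  shows "laplace_arg s \<noteq> 0" "laplace_arg s \<noteq> 1" "sector_const * norm (laplace_arg s) \<le> norm (1 - laplace_arg s)" "sector_const \<le> norm (1 - laplace_arg s)"
proof -
  show nz: "laplace_arg s \<noteq> 0" by (simp add: laplace_arg_def)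
  show "sector_const * norm (laplace_arg s) \<le> norm (1 - laplace_arg s)" and 2: "sector_const \<le> norm (1 - laplace_arg s)"
    by (rule norm_one_minus_ge[OF Im_laplace_arg_ge[OF s] nz sector_const_pos])+
  show "laplace_arg s \<noteq> 1" using 2 sector_const_pos by auto
qed

text \<open>Since \<open>|\<zeta>| = |s| powr (- a)\<close>, the two decay regimes in s are the
  regimes \<open>1 / |\<zeta>|\<close> and \<open>|\<zeta>|\<close>, the form in which bounds on
  rational functions of \<zeta> arise.\<close>

lemma min_powr_eq:
  assumes s: "s \<noteq> (0::complex)"
  shows "min (norm s powr (a - 1)) (norm s powr (- 1 - a)) = 1 / norm s * min (1 / norm (laplace_arg s)) (norm (laplace_arg s))"
proof -
  have "norm s powr (a - 1) = 1 / norm s * (1 / norm (laplace_arg s))"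
    using s by (simp add: norm_laplace_arg powr_diff powr_minus field_simps)
  moreover have "norm s powr (- 1 - a) = 1 / norm s * norm (laplace_arg s)"
    using s powr_add[of "norm s" "-1" "-a"] by (simp add: norm_laplace_arg powr_minus field_simps)
  ultimately show ?thesis using s by (simp add: min_mult_distrib_left)
qed

text \<open>Bounding the squared denominator below by the square of
  \<open>sector_const * |\<zeta>|\<close> gives the branch \<open>1 / |\<zeta>|\<close>, bounding it
  by the square of \<open>sector_const\<close> the branch \<open>|\<zeta>|\<close>.\<close>

lemma laplace_arg_quotient_bound:
  assumes s: "Re s > 0"
  shows "norm (laplace_arg s / (1 - laplace_arg s)\<^sup>2) \<le> 1 / sector_const\<^sup>2 * min (1 / norm (laplace_arg s)) (norm (laplace_arg s))"
proof -
  let ?r = "norm (laplace_arg s)" and ?n = "norm (1 - laplace_arg s)"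
  note d = laplace_arg_denom[OF s]
  have r: "?r > 0" using d by simp
  have n: "?n > 0" using d(4) sector_const_pos by linarith
  have "(sector_const * ?r)\<^sup>2 \<le> ?n\<^sup>2" by (rule power_mono[OF d(3)]) (use sector_const_pos r in simp)
  then have "?r / ?n\<^sup>2 \<le> ?r / (sector_const * ?r)\<^sup>2" using sector_const_pos r n by (intro divide_left_mono) auto
  then have 1: "?r / ?n\<^sup>2 \<le> 1 / sector_const\<^sup>2 * (1 / ?r)" using r by (simp add: power2_eq_square field_simps)
  have "sector_const\<^sup>2 \<le> ?n\<^sup>2" by (rule power_mono[OF d(4)]) (use sector_const_pos in simp)
  then have "?r / ?n\<^sup>2 \<le> ?r / sector_const\<^sup>2" using sector_const_pos r n by (intro divide_left_mono) auto
  then have 2: "?r / ?n\<^sup>2 \<le> 1 / sector_const\<^sup>2 * ?r" by simp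
  from 1 2 show ?thesis unfolding norm_divide norm_power min_def by (cases "1 / ?r \<le> ?r") (simp_all only: if_True if_False)
qed

text \<open>The general transform bound with t = y^(1/a). The restriction \<open>s > 2\<close>
  matches the growth rate 2 of the series.\<close>

lemma ml_series_bound:
  fixes d :: "nat \<Rightarrow> complex" and H g :: "complex \<Rightarrow> complex"
  assumes d: "\<And>k. norm (d k) \<le> (real k + 1)\<^sup>2"
    and lap: "\<And>s. s > 2 \<Longrightarrow> of_real (1 / s) * (\<Sum>k. d k * (of_real (s powr (- a))) ^ k) = H (of_real s)"
    and hol: "H holomorphic_on {z. 0 < Re z}"
    and bd: "\<And>z. 0 < Re z \<Longrightarrow> norm (H z) \<le> B * (1 / norm z * min (1 / norm (laplace_arg z)) (norm (laplace_arg z)))"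
    and y: "y \<ge> 0"
  shows "norm (ml_series a d (of_real y)) \<le> B * integral\<^sup>L lborel (decay_kernel a)"
proof -
  have "norm (ml_series a d (of_real ((y powr (1 / a)) powr a))) \<le> B * integral\<^sup>L lborel (decay_kernel a)"
  proof (rule laplace_transform_bound[where f="\<lambda>t. ml_series a d (of_real (t powr a))" and c=2, OF a])
    show "continuous_on {0..} (\<lambda>t. ml_series a d (complex_of_real (t powr a)))"
    proof (rule continuous_on_compose2[OF continuous_ml_series[OF a(1) d, of UNIV]])
      show "continuous_on {0..} (\<lambda>t. complex_of_real (t powr a))"
        by (intro continuous_on_of_real continuous_on_powr' continuous_on_id continuous_on_const) (use a in auto)
    qed simp
    show "norm (ml_series a d (complex_of_real (t powr a))) \<le> (\<Sum>k. (real k + 1)\<^sup>2 * (2 powr (- a)) ^ k) * exp (2 * t)" if "t \<ge> 0" for t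
      by (rule ml_series_growth[OF a(1) d that])
    show "(LINT t:{0..}|lborel. exp (- s * t) *\<^sub>R ml_series a d (complex_of_real (t powr a))) = H (of_real s)" if "s > 2" for s
      using laplace_ml_series[OF a(1) d, of s] lap[OF that] that by simp
    show "norm (H z) \<le> B * min (norm z powr (a - 1)) (norm z powr (- 1 - a))" if "0 < Re z" for z
      using bd[OF that] that by (subst min_powr_eq) auto
  qed (use hol in auto)
  moreover have "(y powr (1 / a)) powr a = y" using a y by (cases "y = 0") (auto simp: powr_powr)
  ultimately show ?thesis by simp
qed

lemma laplace_arg_real_lt_1:
  assumes "s > 2"
  shows "norm (\<i> * complex_of_real (s powr (- a))) < 1"
proof -
  have "s powr a > 1" using assms a by (intro gr_one_powr) auto
  then have "s powr (- a) < 1" by (simp add: powr_minus_divide divide_less_eq)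
  then show ?thesis by (simp add: norm_mult)
qed

text \<open>The closed form \<zeta> / (1 - \<zeta>)^2 vanishes to first order both at \<zeta> = 0
  and at infinity, exactly the decay required, so nothing has to be subtracted.\<close>

lemma ml_series_bound_1: "\<exists>C. \<forall>y\<ge>0. norm (ml_series a (\<lambda>k. of_nat k * \<i> ^ k) (of_real y)) \<le> C"
proof (intro exI allI impI, rule ml_series_bound[where H="\<lambda>s. 1 / s * (laplace_arg s / (1 - laplace_arg s)\<^sup>2)" and B="1 / sector_const\<^sup>2"])
  show "norm (complex_of_nat k * \<i> ^ k) \<le> (real k + 1)\<^sup>2" for k
    by (simp add: norm_mult norm_power power2_eq_square algebra_simps)
  show "complex_of_real (1 / s) * (\<Sum>k. complex_of_nat k * \<i> ^ k * complex_of_real (s powr - a) ^ k)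
      = 1 / of_real s * (laplace_arg (of_real s) / (1 - laplace_arg (of_real s))\<^sup>2)" if "s > 2" for s
    using suminf_of_nat_mult_power(2)[OF laplace_arg_real_lt_1[OF that]] that
    by (simp add: laplace_arg_of_real power_mult_distrib mult.assoc)
  show "(\<lambda>s. 1 / s * (laplace_arg s / (1 - laplace_arg s)\<^sup>2)) holomorphic_on {z. 0 < Re z}"
    using laplace_arg_denom(2) by (intro holomorphic_intros holomorphic_laplace_arg) auto
  show "norm (1 / z * (laplace_arg z / (1 - laplace_arg z)\<^sup>2)) \<le> 1 / sector_const\<^sup>2 * (1 / norm z * min (1 / norm (laplace_arg z)) (norm (laplace_arg z)))" if "0 < Re z" for z
    using mult_left_mono[OF laplace_arg_quotient_bound[OF that], of "1 / norm z"] by (simp add: norm_mult norm_divide mult_ac)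
qed

text \<open>Compared with weight k there is one more factor (1 + \<zeta>) / (1 - \<zeta>). Adding
  the two lower bounds for |1 - \<zeta>| gives
  \<open>sector_const * |1 + \<zeta>| \<le> 2 * |1 - \<zeta>|\<close>, whence the factor
  \<open>2 / sector_const\<close>.\<close>

lemma ml_series_bound_2: "\<exists>C. \<forall>y\<ge>0. norm (ml_series a (\<lambda>k. (of_nat k)\<^sup>2 * \<i> ^ k) (of_real y)) \<le> C"
proof (intro exI allI impI, rule ml_series_bound[where H="\<lambda>s. 1 / s * (laplace_arg s * (1 + laplace_arg s) / (1 - laplace_arg s) ^ 3)" and B="2 / sector_const * (1 / sector_const\<^sup>2)"])
  show "norm ((complex_of_nat k)\<^sup>2 * \<i> ^ k) \<le> (real k + 1)\<^sup>2" for k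
    by (simp add: norm_mult norm_power power_mono)
  show "complex_of_real (1 / s) * (\<Sum>k. (complex_of_nat k)\<^sup>2 * \<i> ^ k * complex_of_real (s powr - a) ^ k)
      = 1 / of_real s * (laplace_arg (of_real s) * (1 + laplace_arg (of_real s)) / (1 - laplace_arg (of_real s)) ^ 3)" if "s > 2" for s
    using suminf_of_nat_mult_power(4)[OF laplace_arg_real_lt_1[OF that]] that
    by (simp add: laplace_arg_of_real power_mult_distrib mult.assoc)
  show "(\<lambda>s. 1 / s * (laplace_arg s * (1 + laplace_arg s) / (1 - laplace_arg s) ^ 3)) holomorphic_on {z. 0 < Re z}"
    using laplace_arg_denom(2) by (intro holomorphic_intros holomorphic_laplace_arg) auto
  show "norm (1 / z * (laplace_arg z * (1 + laplace_arg z) / (1 - laplace_arg z) ^ 3)) \<le> 2 / sector_const * (1 / sector_const\<^sup>2) * (1 / norm z * min (1 / norm (laplace_arg z)) (norm (laplace_arg z)))" if z: "0 < Re z" for z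
  proof -
    note d = laplace_arg_denom[OF z]
    have n: "norm (1 - laplace_arg z) > 0" using d(2) by simp
    have "norm (1 + laplace_arg z) \<le> 1 + norm (laplace_arg z)" using norm_triangle_ineq[of 1 "laplace_arg z"] by simp
    then have "sector_const * norm (1 + laplace_arg z) \<le> sector_const + sector_const * norm (laplace_arg z)"
      using mult_left_mono[of _ _ sector_const] sector_const_pos by (fastforce simp: distrib_left)
    also have "\<dots> \<le> 2 * norm (1 - laplace_arg z)" using d by simp
    finally have "norm (1 + laplace_arg z) / norm (1 - laplace_arg z) \<le> 2 / sector_const" using n sector_const_pos by (simp add: field_simps)
    then have "norm (1 + laplace_arg z) / norm (1 - laplace_arg z) * norm (laplace_arg z / (1 - laplace_arg z)\<^sup>2)
        \<le> 2 / sector_const * (1 / sector_const\<^sup>2 * min (1 / norm (laplace_arg z)) (norm (laplace_arg z)))"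
      by (rule mult_mono[OF _ laplace_arg_quotient_bound[OF z]]) (use sector_const_pos in auto)
    from mult_left_mono[OF this, of "1 / norm z"] show ?thesis
      by (simp add: norm_mult norm_divide norm_power power3_eq_cube power2_eq_square mult_ac)
  qed
qed

lemma mittag_leffler_1_eq: "mittag_leffler a 1 (\<i> * of_real y) = ml_series a (\<lambda>k. \<i> ^ k) (of_real y)"
  by (simp add: mittag_leffler_def ml_series_def power_mult_distrib)

text \<open>The transform behaves like 1/s at infinity and is not integrable along a line. The bound
  is therefore proved for the difference with \<open>exp (- t)\<close>, and the final
  \<open>+ 1\<close> pays for adding that function back.\<close>

lemma ml_series_bound_0: "\<exists>C. \<forall>y\<ge>0. norm (ml_series a (\<lambda>k. \<i> ^ k) (of_real y)) \<le> C"
proof (intro exI allI impI)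
  \<comment> \<open>The difference over a common denominator: the terms of order s cancel in (s + 1)
    - s (1 - \<zeta>) = 1 + s \<zeta>.\<close>
  define H where "H s = (1 + s * laplace_arg s) / (s * (s + 1) * (1 - laplace_arg s))" for s
  have H_eq: "H s = 1 / s * (1 / (1 - laplace_arg s)) - 1 / (s + 1)" if "Re s > 0" for s
  proof -
    have s: "s \<noteq> 0" "s + 1 \<noteq> 0" using that by (auto simp: complex_eq_iff)
    have "1 - laplace_arg s \<noteq> 0" using laplace_arg_denom(2)[OF that] by simp
    with s have "1 / s * (1 / (1 - laplace_arg s)) - 1 / (s + 1) = ((s + 1) - s * (1 - laplace_arg s)) / (s * (1 - laplace_arg s) * (s + 1))"
      by (simp add: diff_frac_eq mult.commute)
    then show ?thesis unfolding H_def by (simp add: algebra_simps)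
  qed
  fix y :: real assume y: "y \<ge> 0"
  define f where "f t = ml_series a (\<lambda>k. \<i> ^ k) (of_real (t powr a)) - of_real (exp (- t))" for t
  have d: "norm (\<i> ^ k) \<le> (real k + 1)\<^sup>2" for k by (simp add: norm_power)
  define K where "K = (\<Sum>k. (real k + 1)\<^sup>2 * (2 powr (- a)) ^ k)"
  have cml: "continuous_on {0..} (\<lambda>t. ml_series a (\<lambda>k. \<i> ^ k) (complex_of_real (t powr a)))"
  proof (rule continuous_on_compose2[OF continuous_ml_series[OF a(1) d, of UNIV]])
    show "continuous_on {0..} (\<lambda>t. complex_of_real (t powr a))"
      by (intro continuous_on_of_real continuous_on_powr' continuous_on_id continuous_on_const) (use a in auto)
  qed simp
  note g = ml_series_growth[OF a(1) d, folded K_def]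
  have "norm (f (y powr (1 / a))) \<le> 2 / sector_const * integral\<^sup>L lborel (decay_kernel a)"
  proof (rule laplace_transform_bound[where f=f and c=2 and H=H and K="K + 1", OF a])
    show "continuous_on {0..} f" unfolding f_def by (intro continuous_intros cml)
    show "norm (f t) \<le> (K + 1) * exp (2 * t)" if "t \<ge> 0" for t
    proof -
      have "exp (- t) \<le> exp (2 * t)" using that by simp
      from add_mono[OF g[OF that] this] show ?thesis unfolding f_def distrib_right
        by (intro order_trans[OF norm_triangle_ineq4]) simp
    qed
    show "H holomorphic_on {z. 0 < Re z}"
    proof -
      have "s + 1 \<noteq> 0" if "Re s > 0" for s :: complex using that by (auto simp: complex_eq_iff)
      then show ?thesis unfolding H_def[abs_def]
        using laplace_arg_denom(2) by (intro holomorphic_intros holomorphic_laplace_arg) auto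
    qed
    show "norm (H z) \<le> 2 / sector_const * min (norm z powr (a - 1)) (norm z powr (- 1 - a))" if z: "0 < Re z" for z
    proof -
      note dn = laplace_arg_denom[OF z]
      let ?r = "norm (laplace_arg z)" and ?n = "norm (1 - laplace_arg z)"
      have z0: "z \<noteq> 0" using z by auto
      have n: "?n > 0" using dn(2) by simp
      have r: "?r > 0" using dn(1) by simp
      have re: "?r = norm z powr (- a)" by (rule norm_laplace_arg[OF z0])
      have zp: "norm z > 0" using z0 by simp
      have p1: "norm (z + 1) \<ge> 1" using abs_Re_le_cmod[of "z + 1"] z by simp
      have p2: "norm (z + 1) \<ge> norm z" using z by (simp add: cmod_def power2_eq_square algebra_simps)
      have t: "norm (1 + z * laplace_arg z) \<le> 1 + norm z * ?r" using norm_triangle_ineq[of 1 "z * laplace_arg z"] by (simp add: norm_mult)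
      have zr: "norm z * ?r = norm z powr (1 - a)" using zp by (simp add: re powr_diff powr_minus field_simps)
      have "norm (1 + z * laplace_arg z) / (norm (z + 1) * ?n) \<le> 2 / sector_const * min (1 / ?r) ?r"
      \<comment> \<open>Since |z \<zeta>| = |z|^(1 - a) with \<open>a < 1\<close>, the term z
        \<zeta> dominates the numerator for |z| at least 1 and the term 1 otherwise. The denominator
        is bounded below by |z| times \<open>sector_const\<close> in the first case and by
        \<open>sector_const * |\<zeta>|\<close> in the second.\<close>
      proof (cases "norm z \<ge> 1")
        case True
        have r1: "?r \<le> 1" unfolding re using True a z0 powr_mono[of "-a" 0 "norm z"] by simp
        have "1 \<le> norm z * ?r" unfolding zr using True a by (simp add: ge_one_powr_ge_zero)
        then have "norm (1 + z * laplace_arg z) \<le> 2 * norm z * ?r" using t by linarith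
        moreover have "norm z * sector_const \<le> norm (z + 1) * ?n" by (rule mult_mono[OF p2 dn(4)]) (use sector_const_pos in auto)
        ultimately have "norm (1 + z * laplace_arg z) / (norm (z + 1) * ?n) \<le> 2 * norm z * ?r / (norm z * sector_const)"
          using zp sector_const_pos r by (intro frac_le) auto
        also have "\<dots> = 2 / sector_const * ?r" using zp by simp
        also have "?r = min (1 / ?r) ?r"
        proof -
          have "1 \<le> 1 / ?r" using r1 r by simp
          then show ?thesis using r1 by simp
        qed
        finally show ?thesis .
      next
        case False
        have r1: "1 \<le> ?r" unfolding re using False a z0 powr_mono'[of "-a" 0 "norm z"] by simp
        have "norm z * ?r \<le> 1" unfolding zr using False a z0 powr_mono'[of 0 "1 - a" "norm z"] by simp
        then have "norm (1 + z * laplace_arg z) \<le> 2" using t by linarith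
        moreover have "1 * (sector_const * ?r) \<le> norm (z + 1) * ?n" by (rule mult_mono[OF p1 dn(3)]) (use sector_const_pos in auto)
        ultimately have "norm (1 + z * laplace_arg z) / (norm (z + 1) * ?n) \<le> 2 / (1 * (sector_const * ?r))"
          using sector_const_pos r by (intro frac_le) auto
        also have "\<dots> = 2 / sector_const * (1 / ?r)" by simp
        also have "1 / ?r = min (1 / ?r) ?r"
        proof -
          have "1 / ?r \<le> 1" using r1 r by simp
          then show ?thesis using r1 by simp
        qed
        finally show ?thesis .
      qed
      from mult_left_mono[OF this, of "1 / norm z"] show ?thesis
        unfolding min_powr_eq[OF z0] H_def by (simp add: norm_mult norm_divide mult_ac)
    qed
    show "(LINT t:{0..}|lborel. exp (- s * t) *\<^sub>R f t) = H (of_real s)" if s: "s > 2" for s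
    proof -
      have q: "norm (\<i> * complex_of_real (s powr (- a))) < 1" by (rule laplace_arg_real_lt_1[OF s])
      have e1: "exp (- s * t) *\<^sub>R complex_of_real (exp (- t)) = exp (of_real (- s - 1) * of_real t)" for t
      proof -
        have "exp (- s * t) * exp (- t) = exp ((- s - 1) * t)" by (simp add: exp_add[symmetric] left_diff_distrib)
        then show ?thesis by (simp only: scaleR_conv_of_real of_real_mult[symmetric] exp_of_real)
      qed
      have I2: "set_integrable lborel {0..} (\<lambda>t. exp (- s * t) *\<^sub>R complex_of_real (exp (- t)))"
        "(LINT t:{0..}|lborel. exp (- s * t) *\<^sub>R complex_of_real (exp (- t))) = - 1 / of_real (- s - 1)"
        unfolding e1 using integral_exp_atLeast_0[of "of_real (- s - 1)"] s by auto
      have I1: "set_integrable lborel {0..} (\<lambda>t. exp (- s * t) *\<^sub>R ml_series a (\<lambda>k. \<i> ^ k) (of_real (t powr a)))"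
        by (rule set_integrable_exp_growth[OF cml g s])
      have "(LINT t:{0..}|lborel. exp (- s * t) *\<^sub>R f t) = of_real (1 / s) * (\<Sum>k. \<i> ^ k * (of_real (s powr (- a))) ^ k)
          - (- 1 / of_real (- s - 1))"
        unfolding f_def scaleR_diff_right
        using set_integral_diff(2)[OF I1 I2(1)] I2(2) laplace_ml_series[OF a(1) d, of s] s by simp
      also have "(\<Sum>k. \<i> ^ k * (of_real (s powr (- a))) ^ k) = 1 / (1 - laplace_arg (of_real s))"
        using geometric_sums[OF q] s by (simp add: laplace_arg_of_real sums_iff power_mult_distrib)
      also have "- 1 / of_real (- s - 1) = 1 / (complex_of_real s + 1)"
      proof -
        have "complex_of_real (- s - 1) = - (complex_of_real s + 1)" by simp
        then show ?thesis by (simp only: minus_divide_divide)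
      qed
      finally show ?thesis using H_eq[of "of_real s"] s by simp
    qed
  qed auto
  moreover have "(y powr (1 / a)) powr a = y" using a y by (cases "y = 0") (auto simp: powr_powr)
  ultimately have "norm (ml_series a (\<lambda>k. \<i> ^ k) (of_real y) - complex_of_real (exp (- (y powr (1 / a)))))
      \<le> 2 / sector_const * integral\<^sup>L lborel (decay_kernel a)"
    by (simp add: f_def)
  moreover have "norm (complex_of_real (exp (- (y powr (1 / a))))) \<le> 1" by simp
  ultimately show "norm (ml_series a (\<lambda>k. \<i> ^ k) (of_real y)) \<le> 2 / sector_const * integral\<^sup>L lborel (decay_kernel a) + 1"
    using norm_triangle_sub[of "ml_series a (\<lambda>k. \<i> ^ k) (of_real y)" "complex_of_real (exp (- (y powr (1 / a))))"]
    by linarith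
qed

end


text \<open>Real coefficients make the sum commute with conjugation, which maps i y to -i y. The
  Laplace argument reaches only y = t^a at least 0, whereas the spectrum of a selfadjoint operator
  may be negative.\<close>

lemma norm_real_powser_cnj:
  fixes c :: "nat \<Rightarrow> complex"
  assumes c: "\<And>k. cnj (c k) = c k" and sm: "\<And>z. summable (\<lambda>k. c k * z ^ k)"
  shows "norm (\<Sum>k. c k * (\<i> * of_real y) ^ k) = norm (\<Sum>k. c k * (\<i> * of_real \<bar>y\<bar>) ^ k)"
proof (cases "y \<ge> 0")
  case False
  have "(\<lambda>k. cnj (c k * (\<i> * of_real \<bar>y\<bar>) ^ k)) sums cnj (\<Sum>k. c k * (\<i> * of_real \<bar>y\<bar>) ^ k)"
    unfolding sums_cnj using sm by (rule summable_sums)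
  moreover have "cnj (c k * (\<i> * of_real \<bar>y\<bar>) ^ k) = c k * (\<i> * of_real y) ^ k" for k
    using False by (simp add: c)
  ultimately have "(\<Sum>k. c k * (\<i> * of_real y) ^ k) = cnj (\<Sum>k. c k * (\<i> * of_real \<bar>y\<bar>) ^ k)"
    by (simp add: sums_iff)
  then show ?thesis by simp
qed simp

text \<open>The series bounds control y E1 and y (E1 + i y E2) at i y. For y above 1 this yields the
  unweighted bound on E1 and the bound on y E2; on [0,1] compactness suffices, and conjugation
  covers negative y.\<close>

theorem mittag_leffler_imaginary_bounds:
  fixes a :: real
  assumes a: "0 < a" "a < 1"
  obtains E1 E2 :: "complex \<Rightarrow> complex" and C :: real where
    "\<And>z. (mittag_leffler a 1 has_field_derivative E1 z) (at z)"
    "\<And>z. (E1 has_field_derivative E2 z) (at z)"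
    "\<And>z. mittag_leffler a a z = of_real a * E1 z"
    "\<And>y::real. norm (mittag_leffler a 1 (\<i> * of_real y)) \<le> C"
    "\<And>y::real. norm (E1 (\<i> * of_real y)) \<le> C"
    "\<And>y::real. \<bar>y\<bar> * norm (E1 (\<i> * of_real y)) \<le> C"
    "\<And>y::real. \<bar>y\<bar> * norm (E2 (\<i> * of_real y)) \<le> C"
proof -
  define c where "c k = 1 / complex_of_real (Gamma (a * k + 1))" for k :: nat
  define E1 where "E1 z = (\<Sum>k. diffs c k * z ^ k)" for z
  define E2 where "E2 z = (\<Sum>k. diffs (diffs c) k * z ^ k)" for z
  have E0: "mittag_leffler a 1 = (\<lambda>z. \<Sum>k. c k * z ^ k)"
    by (simp add: fun_eq_iff mittag_leffler_def c_def)
  have sm: "summable (\<lambda>k. c k * z ^ k)" for z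
    using summable_ml_series[OF a(1), of "\<lambda>_. 1" z] by (simp add: c_def power2_eq_square algebra_simps)
  have sm1: "summable (\<lambda>k. diffs c k * z ^ k)" for z by (rule termdiff_converges_all[OF sm])
  have sm2: "summable (\<lambda>k. diffs (diffs c) k * z ^ k)" for z by (rule termdiff_converges_all[OF sm1])
  have D0: "(mittag_leffler a 1 has_field_derivative E1 z) (at z)" for z
    unfolding E0 E1_def by (rule termdiffs_strong_converges_everywhere[OF sm])
  have D1: "(E1 has_field_derivative E2 z) (at z)" for z
    unfolding E1_def[abs_def] E2_def by (rule termdiffs_strong_converges_everywhere[OF sm1])
  have D2: "(E2 has_field_derivative (\<Sum>k. diffs (diffs (diffs c)) k * z ^ k)) (at z)" for z
    unfolding E2_def[abs_def] by (rule termdiffs_strong_converges_everywhere[OF sm2])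
  \<comment> \<open>The recursion Gamma(a (k + 1) + 1) = a (k + 1) Gamma(a (k + 1)) absorbs the
    factor k + 1 of the differentiated series.\<close>
  have EE: "mittag_leffler a a z = of_real a * E1 z" for z
  proof -
    have "z ^ k / complex_of_real (Gamma (a * k + a)) = of_real a * (diffs c k * z ^ k)" for k :: nat
    proof -
      have p: "a * k + a > 0" using a by (intro add_nonneg_pos) auto
      then have ni: "a * k + a \<notin> \<int>\<^sub>\<le>\<^sub>0" by (auto elim!: nonpos_Ints_cases)
      have "Gamma (a * Suc k + 1) = (a * k + a) * Gamma (a * k + a)"
        using Gamma_plus1[OF ni] by (simp add: algebra_simps)
      also have "a * k + a = a * Suc k" by (simp add: algebra_simps)
      finally have G: "Gamma (a * Suc k + 1) = a * Suc k * Gamma (a * Suc k)" .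
      have "Gamma (a * Suc k) > 0" using a by (intro Gamma_real_pos) simp
      moreover have "a * k + a = a * Suc k" by (simp add: algebra_simps)
      ultimately show ?thesis using a
        by (simp only: diffs_def c_def G) (simp add: divide_simps del: of_nat_Suc)
    qed
    then have "mittag_leffler a a z = (\<Sum>k. of_real a * (diffs c k * z ^ k))" by (simp add: mittag_leffler_def)
    also have "\<dots> = of_real a * E1 z" unfolding E1_def by (rule suminf_mult[OF sm1])
    finally show ?thesis .
  qed
  have shift: "(\<lambda>k. of_nat k * b k * z ^ k) sums (z * (\<Sum>k. diffs b k * z ^ k))"
    if b: "\<And>z. summable (\<lambda>k. b k * z ^ k)" for b and z :: complex
  proof -
    have "(\<lambda>k. z * (of_nat k * b k * z ^ (k - Suc 0))) sums (z * (\<Sum>k. diffs b k * z ^ k))"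
      by (intro sums_mult diffs_equiv termdiff_converges_all b)
    moreover have "z * (of_nat k * b k * z ^ (k - Suc 0)) = of_nat k * b k * z ^ k" for k by (cases k) auto
    ultimately show ?thesis by simp
  qed
  define c' where "c' k = of_nat k * c k" for k
  have s1: "(\<lambda>k. c' k * z ^ k) sums (z * E1 z)" for z unfolding E1_def c'_def by (rule shift[OF sm])
  have c'sm: "summable (\<lambda>k. c' k * z ^ k)" for z using s1 by (rule sums_summable)
  \<comment> \<open>The coefficients \<open>c'\<close> are those of z E1(z), so the product rule
    evaluates their differentiated series; a further shift then identifies the series with weight
    k^2.\<close>
  have "(\<Sum>k. diffs c' k * z ^ k) = E1 z + z * E2 z" for z
  proof (rule DERIV_unique)
    show "((\<lambda>z. \<Sum>k. c' k * z ^ k) has_field_derivative (\<Sum>k. diffs c' k * z ^ k)) (at z)"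
      by (rule termdiffs_strong_converges_everywhere[OF c'sm])
    have "(\<lambda>z. \<Sum>k. c' k * z ^ k) = (\<lambda>z. z * E1 z)" using s1 by (simp add: sums_iff fun_eq_iff)
    then show "((\<lambda>z. \<Sum>k. c' k * z ^ k) has_field_derivative E1 z + z * E2 z) (at z)"
      by (auto intro!: derivative_eq_intros D1)
  qed
  then have s2: "(\<lambda>k. of_nat k * c' k * z ^ k) sums (z * (E1 z + z * E2 z))" for z
    using shift[OF c'sm] by simp
  have e1: "ml_series a (\<lambda>k. of_nat k * \<i> ^ k) (of_real y) = (\<i> * of_real y) * E1 (\<i> * of_real y)" for y
    using s1[of "\<i> * of_real y"] by (simp add: ml_series_def c'_def c_def sums_iff power_mult_distrib mult_ac)
  have e2: "ml_series a (\<lambda>k. (of_nat k)\<^sup>2 * \<i> ^ k) (of_real y) = (\<i> * of_real y) * (E1 (\<i> * of_real y) + \<i> * of_real y * E2 (\<i> * of_real y))" for y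
    using s2[of "\<i> * of_real y"] by (simp add: ml_series_def c'_def c_def sums_iff power_mult_distrib power2_eq_square mult_ac)
  obtain C0 where C0: "\<And>y. y \<ge> 0 \<Longrightarrow> norm (mittag_leffler a 1 (\<i> * of_real y)) \<le> C0"
    using ml_series_bound_0[OF a] unfolding mittag_leffler_1_eq[OF a] by auto
  obtain C1 where C1: "\<And>y. y \<ge> 0 \<Longrightarrow> y * norm (E1 (\<i> * of_real y)) \<le> C1"
    using ml_series_bound_1[OF a] unfolding e1 by (auto simp: norm_mult)
  obtain C2 where C2: "\<And>y. y \<ge> 0 \<Longrightarrow> y * norm (E1 (\<i> * of_real y) + \<i> * of_real y * E2 (\<i> * of_real y)) \<le> C2"
    using ml_series_bound_2[OF a] unfolding e2 by (auto simp: norm_mult)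
  have E1c: "continuous_on UNIV E1"
    by (intro continuous_at_imp_continuous_on ballI DERIV_isCont[OF D1])
  have E2c: "continuous_on UNIV E2"
    by (intro continuous_at_imp_continuous_on ballI DERIV_isCont[OF D2])
  have "\<exists>C. \<forall>y\<in>{0..1::real}. norm (E (\<i> * of_real y)) \<le> C" if E: "continuous_on UNIV E" for E :: "complex \<Rightarrow> complex"
  proof -
    have "continuous_on {0..1} (\<lambda>y::real. E (\<i> * of_real y))"
      by (rule continuous_on_compose2[OF E]) (auto intro!: continuous_intros)
    then have "compact ((\<lambda>y::real. E (\<i> * of_real y)) ` {0..1})" by (rule compact_continuous_image) simp
    then have "bounded ((\<lambda>y::real. E (\<i> * of_real y)) ` {0..1})" by (rule compact_imp_bounded)
    then show ?thesis by (simp add: bounded_iff)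
  qed
  from this[OF E1c] this[OF E2c] obtain C3 C4 where
    C3: "\<And>y. y \<in> {0..1} \<Longrightarrow> norm (E1 (\<i> * complex_of_real y)) \<le> C3" and
    C4: "\<And>y. y \<in> {0..1} \<Longrightarrow> norm (E2 (\<i> * complex_of_real y)) \<le> C4" by blast
  define C where "C = \<bar>C0\<bar> + \<bar>C1\<bar> + \<bar>C2\<bar> + \<bar>C3\<bar> + \<bar>C4\<bar>"
  have b1: "norm (E1 (\<i> * of_real y)) \<le> C" if y: "y \<ge> 0" for y :: real
  proof (cases "y \<le> 1")
    case True
    then show ?thesis using C3[of y] y by (simp add: C_def)
  next
    case False
    then have "1 * norm (E1 (\<i> * of_real y)) \<le> y * norm (E1 (\<i> * of_real y))" by (intro mult_right_mono) auto
    then show ?thesis using C1[OF y] by (simp add: C_def)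
  qed
  have b2: "y * norm (E2 (\<i> * of_real y)) \<le> C" if y: "y \<ge> 0" for y :: real
  proof (cases "y \<le> 1")
    case True
    then have "y * norm (E2 (\<i> * of_real y)) \<le> 1 * norm (E2 (\<i> * of_real y))" by (intro mult_right_mono) auto
    then show ?thesis using C4[of y] y True by (simp add: C_def)
  next
    case False
    let ?A = "E1 (\<i> * of_real y)" and ?B = "\<i> * of_real y * E2 (\<i> * of_real y)"
    have "norm ?B \<le> norm (?A + ?B) + norm ?A" using norm_triangle_ineq4[of "?A + ?B" ?A] by simp
    then have "y * norm ?B \<le> y * norm (?A + ?B) + y * norm ?A"
      using mult_left_mono[OF _ y] by (fastforce simp: distrib_left)
    then have "y * norm ?B \<le> C2 + C1" using C1[OF y] C2[OF y] by linarith
    moreover have "norm ?B = y * norm (E2 (\<i> * of_real y))" using y by (simp add: norm_mult)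
    moreover have "1 * (y * norm (E2 (\<i> * of_real y))) \<le> y * (y * norm (E2 (\<i> * of_real y)))"
      using False y by (intro mult_right_mono) auto
    ultimately show ?thesis by (simp add: C_def)
  qed
  have real_c: "cnj (c k) = c k" for k by (simp add: c_def)
  have real_c1: "cnj (diffs c k) = diffs c k" for k by (simp add: diffs_def real_c)
  have real_c2: "cnj (diffs (diffs c) k) = diffs (diffs c) k" for k by (simp add: diffs_def[of "diffs c"] real_c1)
  show ?thesis
  proof (rule that[OF D0 D1 EE])
    fix y :: real
    show "norm (mittag_leffler a 1 (\<i> * of_real y)) \<le> C"
      using C0[of "\<bar>y\<bar>"] norm_real_powser_cnj[OF real_c sm, of y] unfolding E0 C_def by simp
    have n1: "norm (E1 (\<i> * of_real y)) = norm (E1 (\<i> * of_real \<bar>y\<bar>))"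
      unfolding E1_def by (rule norm_real_powser_cnj[OF real_c1 sm1])
    have n2: "norm (E2 (\<i> * of_real y)) = norm (E2 (\<i> * of_real \<bar>y\<bar>))"
      unfolding E2_def by (rule norm_real_powser_cnj[OF real_c2 sm2])
    show "norm (E1 (\<i> * of_real y)) \<le> C" unfolding n1 by (rule b1) simp
    show "\<bar>y\<bar> * norm (E1 (\<i> * of_real y)) \<le> C" unfolding n1 using C1[of "\<bar>y\<bar>"] by (simp add: C_def)
    show "\<bar>y\<bar> * norm (E2 (\<i> * of_real y)) \<le> C" unfolding n2 by (rule b2) simp
  qed
qed

section \<open>The weakly singular kernel\<close>

lemma Holder_inequality_integral:
  fixes f g :: "'a \<Rightarrow> real" and p q :: real
  assumes p: "p > 1" and q: "q > 1" and pq: "1 / p + 1 / q = 1"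
    and f: "f \<in> borel_measurable M" "\<And>x. f x \<ge> 0" "integrable M (\<lambda>x. f x powr p)"
    and g: "g \<in> borel_measurable M" "\<And>x. g x \<ge> 0" "integrable M (\<lambda>x. g x powr q)"
  shows "integrable M (\<lambda>x. f x * g x)"
    and "(\<integral>x. f x * g x \<partial>M) \<le> (\<integral>x. f x powr p \<partial>M) powr (1 / p) * (\<integral>x. g x powr q \<partial>M) powr (1 / q)"
proof -
  have Y: "u * v \<le> u powr p / p + v powr q / q" if "u \<ge> 0" "v \<ge> 0" for u v
    by (rule Youngs_inequality[OF p q pq that])
  have iY: "integrable M (\<lambda>x. f x powr p / p + g x powr q / q)"
    by (intro Bochner_Integration.integrable_add integrable_divide_zero f g) 
  show int: "integrable M (\<lambda>x. f x * g x)"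
  proof (rule Bochner_Integration.integrable_bound[OF iY])
    show "(\<lambda>x. f x * g x) \<in> borel_measurable M" by (intro borel_measurable_times f g)
    have "norm (f x * g x) \<le> norm (f x powr p / p + g x powr q / q)" for x
      using Y[OF f(2)[of x] g(2)[of x]] f(2)[of x] g(2)[of x] by (simp add: abs_mult)
    then show "AE x in M. norm (f x * g x) \<le> norm (f x powr p / p + g x powr q / q)" by simp
  qed
  define A where "A = (\<integral>x. f x powr p \<partial>M)"
  define B where "B = (\<integral>x. g x powr q \<partial>M)"
  have A0: "A \<ge> 0" and B0: "B \<ge> 0" by (auto simp: A_def B_def intro!: integral_nonneg_AE)
  have "(\<integral>x. f x * g x \<partial>M) \<le> A powr (1 / p) * B powr (1 / q)"
  proof (cases "A = 0 \<or> B = 0")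
    case True
    have "AE x in M. f x * g x = 0"
    proof (cases "A = 0")
      case True
      then have "AE x in M. f x powr p = 0"
        using f(3) by (subst (asm) A_def, subst (asm) integral_nonneg_eq_0_iff_AE) auto
      then show ?thesis by eventually_elim simp
    next
      case False
      with \<open>A = 0 \<or> B = 0\<close> have "B = 0" by simp
      then have "AE x in M. g x powr q = 0"
        using g(3) by (subst (asm) B_def, subst (asm) integral_nonneg_eq_0_iff_AE) auto
      then show ?thesis by eventually_elim simp
    qed
    then have "(\<integral>x. f x * g x \<partial>M) = 0" by (rule integral_eq_zero_AE)
    then show ?thesis by simp
  next
    case False
    then have pos: "A > 0" "B > 0" using A0 B0 by auto
    define a b where "a = A powr (1 / p)" and "b = B powr (1 / q)"
    have ab: "a > 0" "b > 0" "a powr p = A" "b powr q = B"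
      using pos p q by (auto simp: a_def b_def powr_powr)
    have le: "f x * g x / (a * b) \<le> f x powr p / A / p + g x powr q / B / q" for x
      using Y[of "f x / a" "g x / b"] f(2)[of x] g(2)[of x] ab by (simp add: powr_divide)
    have "(\<integral>x. f x * g x / (a * b) \<partial>M) \<le> (\<integral>x. f x powr p / A / p + g x powr q / B / q \<partial>M)"
      by (rule integral_mono[OF _ _ le]) (intro Bochner_Integration.integrable_add integrable_divide_zero f g int)+
    also have "\<dots> = A / A / p + B / B / q"
      using f(3) g(3) by (simp add: A_def B_def)
    also have "\<dots> = 1" using pos pq by simp
    finally have "(\<integral>x. f x * g x \<partial>M) \<le> a * b" using ab by (simp add: divide_le_eq)
    then show ?thesis by (simp add: a_def b_def)
  qed
  then show "(\<integral>x. f x * g x \<partial>M) \<le> (\<integral>x. f x powr p \<partial>M) powr (1 / p) * (\<integral>x. g x powr q \<partial>M) powr (1 / q)"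
    by (simp add: A_def B_def)
qed

text \<open>After division by x, the numbers (x - y)/x and y/x lie in [0,1] and sum to 1, and there
  u^p is at most u.\<close>

lemma powr_diff_le_diff_powr:
  fixes x y p :: real
  assumes "0 \<le> y" "y \<le> x" "1 \<le> p"
  shows "(x - y) powr p \<le> x powr p - y powr p"
proof (cases "x = 0")
  case False
  then have x: "x > 0" using assms by simp
  have le: "(u / x) powr p \<le> u / x" if "0 \<le> u" "u \<le> x" for u
  proof -
    have "u / x \<le> 1" using that x by simp
    then show ?thesis using powr_mono'[of 1 p "u / x"] that x assms by (cases "u = 0") auto
  qed
  have "(x - y) powr p + y powr p = x powr p * (((x - y) / x) powr p + (y / x) powr p)"
    using x assms by (simp add: powr_divide distrib_left)
  also have "\<dots> \<le> x powr p * ((x - y) / x + y / x)"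
    by (intro mult_left_mono add_mono le) (use assms in auto)
  also have "(x - y) / x + y / x = 1" using x by (simp add: add_divide_distrib[symmetric])
  finally show ?thesis by simp
qed (use assms in auto)

text \<open>The same scaling with the reversed inequality u \<le> u^p. It turns Lipschitz continuity
  of e in y into \<alpha>-Hoelder continuity in time on the domain.\<close>

lemma powr_diff_le_powr_of_diff:
  fixes x y p :: real
  assumes "0 \<le> y" "y \<le> x" "0 < p" "p \<le> 1"
  shows "x powr p - y powr p \<le> (x - y) powr p"
proof (cases "x = 0")
  case False
  then have x: "x > 0" using assms by simp
  have le: "u / x \<le> (u / x) powr p" if "0 \<le> u" "u \<le> x" for u
  proof -
    have "u / x \<le> 1" using that x by simp
    then show ?thesis using powr_mono'[of p 1 "u / x"] that x assms by (cases "u = 0") auto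
  qed
  have "x powr p = x powr p * ((x - y) / x + y / x)" using x by (simp add: add_divide_distrib[symmetric])
  also have "\<dots> \<le> x powr p * (((x - y) / x) powr p + (y / x) powr p)"
    by (intro mult_left_mono add_mono le) (use assms in auto)
  also have "\<dots> = (x - y) powr p + y powr p"
    using x assms by (simp add: powr_divide distrib_left)
  finally show ?thesis by simp
qed (use assms in auto)

lemma set_integral_reflected_powr:
  fixes l c \<gamma> :: real
  assumes g: "\<gamma> < 1" and l: "l \<le> c"
  shows "integrable lborel (\<lambda>\<tau>. indicator {l..<c} \<tau> * (c - \<tau>) powr (- \<gamma>))"
    and "(LINT \<tau>|lborel. indicator {l..<c} \<tau> * (c - \<tau>) powr (- \<gamma>)) = (c - l) powr (1 - \<gamma>) / (1 - \<gamma>)"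
proof -
  have H: "((\<lambda>x. x powr (- \<gamma>)) has_integral ((c - l) powr (- \<gamma> + 1) / (- \<gamma> + 1))) {0..c - l}"
    by (rule has_integral_powr_from_0) (use g l in auto)
  have "set_integrable lborel {0..c - l} (\<lambda>x. x powr (- \<gamma>))" "(LINT x:{0..c - l}|lborel. x powr (- \<gamma>)) = (c - l) powr (- \<gamma> + 1) / (- \<gamma> + 1)"
    by (rule nonneg_has_integral_imp_set_integral_lborel[OF _ _ _ H]; simp)+
  then have "has_bochner_integral lborel (\<lambda>x. indicator {0..c - l} x *\<^sub>R x powr (- \<gamma>)) ((c - l) powr (1 - \<gamma>) / (1 - \<gamma>))"
    by (auto simp: set_integrable_def set_lebesgue_integral_def has_bochner_integral_iff)
  from lborel_has_bochner_integral_real_affine_iff[of "-1" _ _ c, THEN iffD1, OF _ this]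
  have "has_bochner_integral lborel (\<lambda>x. indicator {0..c - l} (c + - 1 * x) *\<^sub>R (c + - 1 * x) powr (- \<gamma>)) ((c - l) powr (1 - \<gamma>) / (1 - \<gamma>))"
    by simp
  \<comment> \<open>Closed and half-open interval agree because
    \<open>0 powr (- \<gamma>) = 0\<close> at the endpoint c.\<close>
  also have "(\<lambda>x. indicator {0..c - l} (c + - 1 * x) *\<^sub>R (c + - 1 * x) powr (- \<gamma>)) = (\<lambda>\<tau>. indicator {l..<c} \<tau> * (c - \<tau>) powr (- \<gamma>))"
    by (auto simp: fun_eq_iff indicator_def)
  finally show "integrable lborel (\<lambda>\<tau>. indicator {l..<c} \<tau> * (c - \<tau>) powr (- \<gamma>))"
    and "(LINT \<tau>|lborel. indicator {l..<c} \<tau> * (c - \<tau>) powr (- \<gamma>)) = (c - l) powr (1 - \<gamma>) / (1 - \<gamma>)"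
    by (auto simp: has_bochner_integral_iff)
qed

text \<open>Up to a constant, the norm of the difference of the convolution kernels for times t and
  s: before s both are present and partly cancel, between s and t only the later one acts.\<close>

definition diff_kernel :: "real \<Rightarrow> real \<Rightarrow> real \<Rightarrow> real \<Rightarrow> real" where
  "diff_kernel \<alpha> s t \<tau> = indicator {0..<s} \<tau> * ((s - \<tau>) powr (\<alpha> - 1) - (t - \<tau>) powr (\<alpha> - 1))
     + indicator {s..<t} \<tau> * (t - \<tau>) powr (\<alpha> - 1)"

lemma diff_kernel_nonneg:
  assumes "\<alpha> < 1" "s \<le> t"
  shows "diff_kernel \<alpha> s t \<tau> \<ge> 0"
proof -
  have "(t - \<tau>) powr (\<alpha> - 1) \<le> (s - \<tau>) powr (\<alpha> - 1)" if "\<tau> < s"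
    by (rule powr_mono2') (use assms that in auto)
  then show ?thesis by (auto simp: diff_kernel_def indicator_def)
qed

text \<open>The bound comes from \<open>(x - y)\<^sup>p \<le> x\<^sup>p - y\<^sup>p\<close>, after which the integral telescopes.\<close>

lemma diff_kernel_Lp:
  fixes \<alpha> p s t :: real
  assumes \<alpha>: "\<alpha> < 1" and p: "p \<ge> 1" "(1 - \<alpha>) * p < 1" and st: "0 \<le> s" "s \<le> t"
  shows "integrable lborel (\<lambda>\<tau>. diff_kernel \<alpha> s t \<tau> powr p)"
    and "(LINT \<tau>|lborel. diff_kernel \<alpha> s t \<tau> powr p) \<le> 2 / (1 - (1 - \<alpha>) * p) * (t - s) powr (1 - (1 - \<alpha>) * p)"
proof -
  define \<gamma> where "\<gamma> = (1 - \<alpha>) * p"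
  have g: "\<gamma> < 1" "\<gamma> \<ge> 0" using p \<alpha> by (auto simp: \<gamma>_def)
  let ?w = "\<lambda>l c \<tau>. indicator {l..<c} \<tau> * (c - \<tau>) powr (- \<gamma>)"
  define D where "D \<tau> = ?w 0 s \<tau> - ?w 0 t \<tau> + 2 * ?w s t \<tau>" for \<tau>
  have pw: "(x powr (\<alpha> - 1)) powr p = x powr (- \<gamma>)" for x
    by (simp add: powr_powr \<gamma>_def algebra_simps)
  have le: "diff_kernel \<alpha> s t \<tau> powr p \<le> D \<tau>" for \<tau>
  proof -
    consider "\<tau> < 0" | "0 \<le> \<tau>" "\<tau> < s" | "s \<le> \<tau>" "\<tau> < t" | "t \<le> \<tau>" by linarith
    then show ?thesis
    proof cases
      case 2
      have "(t - \<tau>) powr (\<alpha> - 1) \<le> (s - \<tau>) powr (\<alpha> - 1)"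
        by (rule powr_mono2') (use \<alpha> 2 st in auto)
      from powr_diff_le_diff_powr[OF _ this p(1)]
      have "((s - \<tau>) powr (\<alpha> - 1) - (t - \<tau>) powr (\<alpha> - 1)) powr p \<le> (s - \<tau>) powr (- \<gamma>) - (t - \<tau>) powr (- \<gamma>)"
        by (simp add: pw)
      then show ?thesis using 2 st by (simp add: diff_kernel_def D_def)
    next
      case 3
      then show ?thesis using st by (simp add: diff_kernel_def D_def pw)
    qed (use st in \<open>auto simp: diff_kernel_def D_def\<close>)
  qed
  have iD: "integrable lborel D" unfolding D_def[abs_def]
    by (intro Bochner_Integration.integrable_add Bochner_Integration.integrable_diff integrable_mult_right set_integral_reflected_powr g) (use st in auto)
  show int: "integrable lborel (\<lambda>\<tau>. diff_kernel \<alpha> s t \<tau> powr p)"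
  proof (rule Bochner_Integration.integrable_bound[OF iD])
    show "(\<lambda>\<tau>. diff_kernel \<alpha> s t \<tau> powr p) \<in> borel_measurable lborel"
      unfolding diff_kernel_def by measurable
    show "AE \<tau> in lborel. norm (diff_kernel \<alpha> s t \<tau> powr p) \<le> norm (D \<tau>)"
      using le by (intro AE_I2) (simp add: order_trans[OF le abs_ge_self])
  qed
  have st': "0 \<le> t" using st by simp
  note i1 = set_integral_reflected_powr[OF g(1) st(1)] and i2 = set_integral_reflected_powr[OF g(1) st'] and i3 = set_integral_reflected_powr[OF g(1) st(2)]
  have "(LINT \<tau>|lborel. diff_kernel \<alpha> s t \<tau> powr p) \<le> (LINT \<tau>|lborel. D \<tau>)"
    by (rule integral_mono[OF int iD le])
  also have "\<dots> = s powr (1 - \<gamma>) / (1 - \<gamma>) - t powr (1 - \<gamma>) / (1 - \<gamma>) + 2 * ((t - s) powr (1 - \<gamma>) / (1 - \<gamma>))"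
    unfolding D_def using i1 i2 i3 by simp
  also have "\<dots> \<le> 2 * ((t - s) powr (1 - \<gamma>) / (1 - \<gamma>))"
  proof -
    have "s powr (1 - \<gamma>) \<le> t powr (1 - \<gamma>)" by (rule powr_mono2) (use g st in auto)
    then have "s powr (1 - \<gamma>) / (1 - \<gamma>) \<le> t powr (1 - \<gamma>) / (1 - \<gamma>)" using g by (simp add: divide_right_mono)
    then show ?thesis by simp
  qed
  finally show "(LINT \<tau>|lborel. diff_kernel \<alpha> s t \<tau> powr p) \<le> 2 / (1 - (1 - \<alpha>) * p) * (t - s) powr (1 - (1 - \<alpha>) * p)"
    by (simp add: \<gamma>_def)
qed

section \<open>Multiplication operators\<close>

lemma lp_space_2_iff: "f \<in> lp_space 2 M \<longleftrightarrow> f \<in> borel_measurable M \<and> integrable M (\<lambda>w. (norm (f w))\<^sup>2)"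
  by (simp add: lp_space_def)

lemma lp_space_2_dominated:
  fixes f g :: "'w \<Rightarrow> complex"
  assumes f: "f \<in> lp_space 2 M" and g: "g \<in> borel_measurable M" and le: "\<And>w. norm (g w) \<le> C * norm (f w)"
  shows "g \<in> lp_space 2 M"
proof -
  have "integrable M (\<lambda>w. C\<^sup>2 * (norm (f w))\<^sup>2)" using f by (simp add: lp_space_2_iff)
  then have "integrable M (\<lambda>w. (norm (g w))\<^sup>2)"
  proof (rule Bochner_Integration.integrable_bound)
    show "(\<lambda>w. (norm (g w))\<^sup>2) \<in> borel_measurable M" using g by measurable
    have "(norm (g w))\<^sup>2 \<le> C\<^sup>2 * (norm (f w))\<^sup>2" for w
      using power_mono[OF le norm_ge_zero, of w 2] by (simp add: power_mult_distrib)
    then show "AE w in M. norm ((norm (g w))\<^sup>2) \<le> norm (C\<^sup>2 * (norm (f w))\<^sup>2)"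
      by (intro AE_I2) (simp add: order_trans[OF _ abs_ge_self])
  qed
  with g show ?thesis by (simp add: lp_space_2_iff)
qed

lemma lp_space_2_add:
  fixes f g :: "'w \<Rightarrow> complex"
  assumes "f \<in> lp_space 2 M" "g \<in> lp_space 2 M"
  shows "(\<lambda>w. f w + g w) \<in> lp_space 2 M"
proof -
  have i: "integrable M (\<lambda>w. 2 * (norm (f w))\<^sup>2 + 2 * (norm (g w))\<^sup>2)"
    using assms by (auto simp: lp_space_2_iff)
  have m: "f \<in> borel_measurable M" "g \<in> borel_measurable M" using assms by (auto simp: lp_space_2_iff)
  have "integrable M (\<lambda>w. (norm (f w + g w))\<^sup>2)"
  proof (rule Bochner_Integration.integrable_bound[OF i])
    show "(\<lambda>w. (norm (f w + g w))\<^sup>2) \<in> borel_measurable M" using m by measurable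
    have "(norm (f w + g w))\<^sup>2 \<le> 2 * (norm (f w))\<^sup>2 + 2 * (norm (g w))\<^sup>2" for w
    proof -
      have "(norm (f w + g w))\<^sup>2 \<le> (norm (f w) + norm (g w))\<^sup>2" by (rule power_mono[OF norm_triangle_ineq]) simp
      also have "\<dots> \<le> 2 * (norm (f w))\<^sup>2 + 2 * (norm (g w))\<^sup>2"
        using sum_squares_bound[of "norm (f w)" "norm (g w)"] by (simp add: power2_sum)
      finally show ?thesis .
    qed
    then show "AE w in M. norm ((norm (f w + g w))\<^sup>2) \<le> norm (2 * (norm (f w))\<^sup>2 + 2 * (norm (g w))\<^sup>2)"
      by (intro AE_I2) (simp add: order_trans[OF _ abs_ge_self])
  qed
  with m show ?thesis by (simp add: lp_space_2_iff)
qed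

lemma lp_space_2_cmult:
  fixes f :: "'w \<Rightarrow> complex"
  assumes f: "f \<in> lp_space 2 M" shows "(\<lambda>w. c * f w) \<in> lp_space 2 M"
  using f by (intro lp_space_2_dominated[OF f, of _ "norm c"]) (auto simp: lp_space_2_iff norm_mult)

lemma norm_scaleC: "norm (c *\<^sub>C x) = norm c * norm (x :: 'h::complex_inner)"
proof -
  have "cinner (c *\<^sub>C x) (c *\<^sub>C x) = c * cnj (cinner (c *\<^sub>C x) x)"
    by (simp add: cinner_scaleC_left cinner_commute[of x "c *\<^sub>C x"])
  also have "\<dots> = (c * cnj c) * cnj (cinner x x)" by (simp add: cinner_scaleC_left)
  also have "\<dots> = of_real ((norm c)\<^sup>2) * cnj (cinner x x)" by (simp only: complex_norm_square)
  finally have "Re (cinner (c *\<^sub>C x) (c *\<^sub>C x)) = (norm c)\<^sup>2 * Re (cinner x x)" by simp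
  then show ?thesis by (simp add: norm_eq_sqrt_cinner[of "c *\<^sub>C x"] norm_eq_sqrt_cinner[of x] real_sqrt_mult)
qed

lemma scaleC_diff: "c *\<^sub>C (x - y) = c *\<^sub>C x - c *\<^sub>C (y :: 'h::complex_inner)"
proof -
  have "c *\<^sub>C x = c *\<^sub>C (x - y) + c *\<^sub>C y" by (simp add: scaleC_add_right[symmetric])
  then show ?thesis by simp
qed

text \<open>Common form of \<open>S_op\<close> and \<open>P_op\<close> at a fixed time, and of their
  time differences, whose multiplier is the difference of the multipliers.\<close>

definition mult_op :: "'w measure \<Rightarrow> (('w \<Rightarrow> complex) \<Rightarrow> 'h) \<Rightarrow> ('w \<Rightarrow> complex) \<Rightarrow> 'h \<Rightarrow> 'h" where
  "mult_op M U m \<phi> = U (\<lambda>w. m w * L2_inv M U \<phi> w)"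

context
  fixes M :: "'w measure" and U :: "('w \<Rightarrow> complex) \<Rightarrow> 'h::{complex_inner,banach,second_countable_topology}"
  assumes U: "unitary_from_L2 M U"
begin

lemma U_add: "f \<in> lp_space 2 M \<Longrightarrow> g \<in> lp_space 2 M \<Longrightarrow> U (\<lambda>w. f w + g w) = U f + U g"
  and U_scale: "f \<in> lp_space 2 M \<Longrightarrow> U (\<lambda>w. c * f w) = c *\<^sub>C U f"
  and U_cinner: "f \<in> lp_space 2 M \<Longrightarrow> g \<in> lp_space 2 M \<Longrightarrow> cinner (U f) (U g) = (\<integral>w. f w * cnj (g w) \<partial>M)"
  and U_surj: "U ` lp_space 2 M = UNIV"
  using U by (auto simp: unitary_from_L2_def)

lemma L2_inv_mem: "L2_inv M U \<phi> \<in> lp_space 2 M" and U_L2_inv: "U (L2_inv M U \<phi>) = \<phi>"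
proof -
  have "\<phi> \<in> U ` lp_space 2 M" using U_surj by simp
  then show "L2_inv M U \<phi> \<in> lp_space 2 M" "U (L2_inv M U \<phi>) = \<phi>"
    unfolding L2_inv_def by (rule inv_into_into, rule f_inv_into_f)
qed

lemma norm_U_square: 
  assumes f: "f \<in> lp_space 2 M" shows "(norm (U f))\<^sup>2 = (\<integral>w. (norm (f w))\<^sup>2 \<partial>M)"
proof -
  have "cinner (U f) (U f) = (\<integral>w. complex_of_real ((norm (f w))\<^sup>2) \<partial>M)"
    unfolding U_cinner[OF f f] by (simp only: complex_norm_square)
  also have "\<dots> = complex_of_real (\<integral>w. (norm (f w))\<^sup>2 \<partial>M)" by (rule integral_complex_of_real)
  finally have "Re (cinner (U f) (U f)) = (\<integral>w. (norm (f w))\<^sup>2 \<partial>M)" by simp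
  moreover have "(\<integral>w. (norm (f w))\<^sup>2 \<partial>M) \<ge> 0" by (rule integral_nonneg_AE) auto
  ultimately show ?thesis by (simp add: norm_eq_sqrt_cinner[of "U f"])
qed

lemma norm_U_mono:
  assumes f: "f \<in> lp_space 2 M" and g: "g \<in> borel_measurable M" and le: "\<And>w. norm (g w) \<le> C * norm (f w)"
    and C: "C \<ge> 0"
  shows "norm (U g) \<le> C * norm (U f)"
proof -
  have g2: "g \<in> lp_space 2 M" by (rule lp_space_2_dominated[OF f g le])
  have "(norm (U g))\<^sup>2 \<le> (\<integral>w. C\<^sup>2 * (norm (f w))\<^sup>2 \<partial>M)"
    unfolding norm_U_square[OF g2]
  proof (rule integral_mono)
    show "(norm (g w))\<^sup>2 \<le> C\<^sup>2 * (norm (f w))\<^sup>2" for w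
      using power_mono[OF le norm_ge_zero, of w 2] by (simp add: power_mult_distrib)
  qed (use f g2 in \<open>auto simp: lp_space_2_iff\<close>)
  also have "\<dots> = (C * norm (U f))\<^sup>2" using norm_U_square[OF f] by (simp add: power_mult_distrib)
  finally show ?thesis by (rule power2_le_imp_le) (use C in simp)
qed

lemma U_diff:
  assumes "f \<in> lp_space 2 M" "g \<in> lp_space 2 M"
  shows "U (\<lambda>w. f w - g w) = U f - U g"
proof -
  have "U (\<lambda>w. f w + (- 1) * g w) = U f + (- 1) *\<^sub>C U g"
    by (subst U_add[OF assms(1) lp_space_2_cmult[OF assms(2)]], subst U_scale[OF assms(2)]) (rule refl)
  moreover have "(- 1) *\<^sub>C U g = - U g" using scaleR_eq_scaleC[of "-1" "U g"] by simp
  ultimately show ?thesis by simp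
qed

lemma mult_mem:
  assumes "m \<in> borel_measurable M" "\<And>w. norm (m w) \<le> C"
  shows "(\<lambda>w. m w * L2_inv M U \<phi> w) \<in> lp_space 2 M"
  using assms L2_inv_mem[of \<phi>]
  by (intro lp_space_2_dominated[OF L2_inv_mem[of \<phi>], of _ C]) (auto simp: lp_space_2_iff norm_mult mult_right_mono)

lemma norm_mult_op_le:
  assumes m: "m \<in> borel_measurable M" "\<And>w. norm (m w) \<le> C"
  shows "norm (mult_op M U m \<phi>) \<le> C * norm \<phi>"
proof -
  have C: "C \<ge> 0" using m(2) norm_ge_zero order_trans by metis
  have "norm (U (\<lambda>w. m w * L2_inv M U \<phi> w)) \<le> C * norm (U (L2_inv M U \<phi>))"
    by (rule norm_U_mono[OF L2_inv_mem]) (use m L2_inv_mem[of \<phi>] C in \<open>auto simp: lp_space_2_iff norm_mult mult_right_mono\<close>)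
  then show ?thesis by (simp add: mult_op_def U_L2_inv)
qed

lemma mult_op_diff_multiplier:
  assumes "m \<in> borel_measurable M" "\<And>w. norm (m w) \<le> C" "n \<in> borel_measurable M" "\<And>w. norm (n w) \<le> C'"
  shows "mult_op M U m \<phi> - mult_op M U n \<phi> = mult_op M U (\<lambda>w. m w - n w) \<phi>"
  using U_diff[OF mult_mem[OF assms(1,2)] mult_mem[OF assms(3,4)], of \<phi> \<phi>]
  by (simp add: mult_op_def left_diff_distrib)

text \<open>\<open>L2_inv\<close> picks representatives, so it is additive only up to null
  functions. The defect \<open>?r\<close> is sent to 0 by \<open>U\<close>; as the multiplier is
  bounded, its product with the defect is sent to 0 as well.\<close>

lemma mult_op_diff:
  assumes m: "m \<in> borel_measurable M" "\<And>w. norm (m w) \<le> C"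
  shows "mult_op M U m \<phi> - mult_op M U m \<psi> = mult_op M U m (\<phi> - \<psi>)"
proof -
  let ?J = "L2_inv M U"
  have C: "C \<ge> 0" using m(2) norm_ge_zero order_trans by metis
  let ?r = "\<lambda>w. ?J \<phi> w - ?J \<psi> w - ?J (\<phi> - \<psi>) w"
  have sub: "(\<lambda>w. f w - g w) \<in> lp_space 2 M" if "f \<in> lp_space 2 M" "g \<in> lp_space 2 M" for f g :: "'w \<Rightarrow> complex"
    using lp_space_2_add[OF that(1) lp_space_2_cmult[OF that(2), of "-1"]] by simp
  have r: "?r \<in> lp_space 2 M" by (intro sub L2_inv_mem)
  have "U ?r = 0" using U_diff[OF sub[OF L2_inv_mem L2_inv_mem] L2_inv_mem, of \<phi> \<psi> "\<phi> - \<psi>"] U_diff[OF L2_inv_mem L2_inv_mem, of \<phi> \<psi>]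
    by (simp add: U_L2_inv)
  moreover have "norm (U (\<lambda>w. m w * ?r w)) \<le> C * norm (U ?r)"
    by (rule norm_U_mono[OF r _ _ C]) (use m r in \<open>auto simp: lp_space_2_iff norm_mult mult_right_mono\<close>)
  ultimately have 0: "U (\<lambda>w. m w * ?r w) = 0" by simp
  have "U (\<lambda>w. m w * ?J \<phi> w - m w * ?J \<psi> w - m w * ?J (\<phi> - \<psi>) w) = U (\<lambda>w. m w * ?J \<phi> w) - U (\<lambda>w. m w * ?J \<psi> w) - U (\<lambda>w. m w * ?J (\<phi> - \<psi>) w)"
    using U_diff[OF sub[OF mult_mem[OF m] mult_mem[OF m]] mult_mem[OF m]] U_diff[OF mult_mem[OF m] mult_mem[OF m]] by simp
  also have "(\<lambda>w. m w * ?J \<phi> w - m w * ?J \<psi> w - m w * ?J (\<phi> - \<psi>) w) = (\<lambda>w. m w * ?r w)"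
    by (simp add: right_diff_distrib)
  finally show ?thesis using 0 by (simp add: mult_op_def)
qed

end

text \<open>The multiplier b may be unbounded as long as it keeps the vector square integrable. With
  b the spectral function, the right-hand norm is that of the operator applied to a vector of its
  domain.\<close>

lemma mult_op_L2_norm_bound:
  fixes U :: "('w \<Rightarrow> complex) \<Rightarrow> 'h::{complex_inner,banach,second_countable_topology}"
  assumes U: "unitary_from_L2 M U" and m: "m \<in> borel_measurable M"
    and b: "(\<lambda>w. b w * L2_inv M U \<phi> w) \<in> lp_space 2 M" and le: "\<And>w. norm (m w) \<le> C * norm (b w)" and C: "C \<ge> 0"
  shows "norm (mult_op M U m \<phi>) \<le> C * norm (U (\<lambda>w. b w * L2_inv M U \<phi> w))"
  unfolding mult_op_def
proof (rule norm_U_mono[OF U b _ _ C])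
  show "(\<lambda>w. m w * L2_inv M U \<phi> w) \<in> borel_measurable M"
    using m L2_inv_mem[OF U, of \<phi>] by (auto simp: lp_space_2_iff)
  show "norm (m w * L2_inv M U \<phi> w) \<le> C * norm (b w * L2_inv M U \<phi> w)" for w
    using mult_right_mono[OF le, of "norm (L2_inv M U \<phi> w)" w] by (simp add: norm_mult mult.assoc)
qed

text \<open>Put y = b t^\<alpha>. The time derivative of E_{\<alpha>,1}(i y) is 1/t times a multiple
  of y E1, and that of t^(\<alpha>-1) E_{\<alpha>,\<alpha>}(i y) is t^(\<alpha>-2) times a
  combination of E1 and y E2. The weighted bounds make both uniform in b, and the mean value
  inequality integrates them.\<close>

lemma mittag_leffler_multiplier_bounds:
  fixes \<alpha> :: real
  assumes \<alpha>: "0 < \<alpha>" "\<alpha> < 1"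
  obtains C :: real where "C > 0"
    "continuous_on UNIV (mittag_leffler \<alpha> 1)" "continuous_on UNIV (mittag_leffler \<alpha> \<alpha>)"
    "\<And>y::real. norm (mittag_leffler \<alpha> 1 (\<i> * of_real y)) \<le> C"
    "\<And>b s t :: real. 0 < s \<Longrightarrow> s \<le> t \<Longrightarrow> norm (mittag_leffler \<alpha> 1 (\<i> * of_real (b * t powr \<alpha>)) - mittag_leffler \<alpha> 1 (\<i> * of_real (b * s powr \<alpha>))) \<le> C / s * (t - s)"
    "\<And>x y::real. norm (mittag_leffler \<alpha> 1 (\<i> * of_real y) - mittag_leffler \<alpha> 1 (\<i> * of_real x)) \<le> C * \<bar>y - x\<bar>"
    "\<And>b r :: real. 0 < r \<Longrightarrow> norm (of_real (r powr (\<alpha> - 1)) * mittag_leffler \<alpha> \<alpha> (\<i> * of_real (b * r powr \<alpha>))) \<le> C * r powr (\<alpha> - 1)"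
    "\<And>b r s :: real. 0 < r \<Longrightarrow> r \<le> s \<Longrightarrow> norm (of_real (s powr (\<alpha> - 1)) * mittag_leffler \<alpha> \<alpha> (\<i> * of_real (b * s powr \<alpha>))
         - of_real (r powr (\<alpha> - 1)) * mittag_leffler \<alpha> \<alpha> (\<i> * of_real (b * r powr \<alpha>))) \<le> C * (r powr (\<alpha> - 1) - s powr (\<alpha> - 1))"
proof -
  obtain E1 E2 :: "complex \<Rightarrow> complex" and C :: real where
    D0: "\<And>z. (mittag_leffler \<alpha> 1 has_field_derivative E1 z) (at z)" and
    D1: "\<And>z. (E1 has_field_derivative E2 z) (at z)" and
    EE: "\<And>z. mittag_leffler \<alpha> \<alpha> z = of_real \<alpha> * E1 z" and
    b0: "\<And>y::real. norm (mittag_leffler \<alpha> 1 (\<i> * of_real y)) \<le> C" and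
    b1: "\<And>y::real. norm (E1 (\<i> * of_real y)) \<le> C" and
    b1': "\<And>y::real. \<bar>y\<bar> * norm (E1 (\<i> * of_real y)) \<le> C" and
    b2: "\<And>y::real. \<bar>y\<bar> * norm (E2 (\<i> * of_real y)) \<le> C"
    using mittag_leffler_imaginary_bounds[OF \<alpha>] by metis
  have C0: "C \<ge> 0" using b0[of 0] norm_ge_zero order_trans by metis
  \<comment> \<open>The part \<open>C / (1 - \<alpha>)\<close> comes from integrating
    t^(\<alpha>-2), and the 1 secures positivity.\<close>
  define K where "K = C / (1 - \<alpha>) + C + 1"
  have K: "K > 0" "C \<le> K" "C / (1 - \<alpha>) \<le> K" using C0 \<alpha> by (auto simp: K_def add_nonneg_pos)
  have dpow: "((\<lambda>t. b * t powr \<beta>) has_real_derivative b * \<beta> * t powr (\<beta> - 1)) (at t)" if "t > 0" for b \<beta> t :: real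
    using that by (auto intro!: derivative_eq_intros)
  have chain: "((\<lambda>t. f (\<i> * of_real (b * t powr \<alpha>))) has_vector_derivative (\<i> * of_real (b * \<alpha> * t powr (\<alpha> - 1)) * f' (\<i> * of_real (b * t powr \<alpha>)))) (at t)"
    if f: "\<And>z. (f has_field_derivative f' z) (at z)" and t: "t > 0" for f f' :: "complex \<Rightarrow> complex" and b t :: real
  proof -
    have "((\<lambda>t. \<i> * of_real (b * t powr \<alpha>)) has_vector_derivative (\<i> * of_real (b * \<alpha> * t powr (\<alpha> - 1)))) (at t)"
      using dpow[OF t, of b \<alpha>] by (intro has_vector_derivative_mult_right has_vector_derivative_of_real) (simp add: has_real_derivative_iff_has_vector_derivative)
    from field_vector_diff_chain_at[OF this f] show ?thesis by (simp add: o_def)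
  qed
  \<comment> \<open>Trades the unbounded spectral value b for y / t; the y is absorbed by the weight
    in the bound on E1.\<close>
  have ap: "\<bar>b\<bar> * t powr (\<alpha> - 1) = \<bar>b * t powr \<alpha>\<bar> / t" if "t > 0" for b t :: real
    using that by (simp add: powr_diff abs_mult)
  have S1: "norm (mittag_leffler \<alpha> 1 (\<i> * of_real (b * t powr \<alpha>)) - mittag_leffler \<alpha> 1 (\<i> * of_real (b * s powr \<alpha>))) \<le> C / s * (t - s)"
    if s: "0 < s" "s \<le> t" for b s t :: real
  proof (cases "s = t")
    case False
    with s have st: "s < t" by simp
    have "norm (mittag_leffler \<alpha> 1 (\<i> * of_real (b * t powr \<alpha>)) - mittag_leffler \<alpha> 1 (\<i> * of_real (b * s powr \<alpha>))) \<le> C / s * t - C / s * s"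
    proof (rule differentiable_bound_general[OF st, where f="\<lambda>t. mittag_leffler \<alpha> 1 (\<i> * of_real (b * t powr \<alpha>))" and \<phi>="\<lambda>t. C / s * t" and \<phi>'="\<lambda>_. C / s"])
      show "continuous_on {s..t} (\<lambda>t. mittag_leffler \<alpha> 1 (\<i> * of_real (b * t powr \<alpha>)))"
        by (intro continuous_at_imp_continuous_on ballI has_vector_derivative_continuous[OF chain[OF D0]]) (use s in auto)
      show "continuous_on {s..t} (\<lambda>t. C / s * t)" by (intro continuous_intros)
      fix x assume x: "s < x" "x < t"
      with s have x0: "x > 0" by simp
      show "((\<lambda>t. mittag_leffler \<alpha> 1 (\<i> * of_real (b * t powr \<alpha>))) has_vector_derivative (\<i> * of_real (b * \<alpha> * x powr (\<alpha> - 1)) * E1 (\<i> * of_real (b * x powr \<alpha>)))) (at x)"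
        by (rule chain[OF D0 x0])
      show "((\<lambda>t. C / s * t) has_vector_derivative C / s) (at x)"
        using has_vector_derivative_mult_right[OF has_vector_derivative_id, of "C / s" "at x"] by simp
      have "norm (\<i> * of_real (b * \<alpha> * x powr (\<alpha> - 1)) * E1 (\<i> * of_real (b * x powr \<alpha>))) = \<alpha> * ((\<bar>b\<bar> * x powr (\<alpha> - 1)) * norm (E1 (\<i> * of_real (b * x powr \<alpha>))))"
        using \<alpha> by (simp add: norm_mult abs_mult)
      also have "\<dots> = \<alpha> * ((\<bar>b * x powr \<alpha>\<bar> * norm (E1 (\<i> * of_real (b * x powr \<alpha>)))) / x)"
        unfolding ap[OF x0] by simp
      also have "\<dots> \<le> 1 * (C / s)"
        by (intro mult_mono frac_le b1' divide_nonneg_nonneg mult_nonneg_nonneg) (use \<alpha> C0 s x in auto)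
      finally show "norm (\<i> * of_real (b * \<alpha> * x powr (\<alpha> - 1)) * E1 (\<i> * of_real (b * x powr \<alpha>))) \<le> C / s" by simp
    qed
    then show ?thesis by (simp add: right_diff_distrib)
  qed simp
  have S2: "norm (mittag_leffler \<alpha> 1 (\<i> * of_real y) - mittag_leffler \<alpha> 1 (\<i> * of_real x)) \<le> C * \<bar>y - x\<bar>" for x y :: real
  proof -
    have ck: "norm (mittag_leffler \<alpha> 1 (\<i> * of_real y) - mittag_leffler \<alpha> 1 (\<i> * of_real x)) \<le> C * y - C * x" if xy: "x < y" for x y :: real
    proof (rule differentiable_bound_general[OF xy, where f="\<lambda>t. mittag_leffler \<alpha> 1 (\<i> * of_real t)" and \<phi>="\<lambda>t. C * t" and \<phi>'="\<lambda>_. C"])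
      have d: "((\<lambda>t. mittag_leffler \<alpha> 1 (\<i> * of_real t)) has_vector_derivative (\<i> * E1 (\<i> * of_real t))) (at t)" for t :: real
      proof -
        have "((\<lambda>t::real. \<i> * of_real t) has_vector_derivative (\<i> * of_real 1)) (at t)"
          by (intro has_vector_derivative_mult_right has_vector_derivative_of_real) simp
        from field_vector_diff_chain_at[OF this D0] show ?thesis by (simp add: o_def)
      qed
      show "continuous_on {x..y} (\<lambda>t. mittag_leffler \<alpha> 1 (\<i> * of_real t))"
        by (intro continuous_at_imp_continuous_on ballI has_vector_derivative_continuous[OF d])
      show "continuous_on {x..y} (\<lambda>t. C * t)" by (intro continuous_intros)
      fix t
      show "((\<lambda>t. mittag_leffler \<alpha> 1 (\<i> * of_real t)) has_vector_derivative (\<i> * E1 (\<i> * of_real t))) (at t)" by (rule d)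
      show "((\<lambda>t. C * t) has_vector_derivative C) (at t)"
        by (auto intro!: derivative_eq_intros simp: has_real_derivative_iff_has_vector_derivative[symmetric])
      show "norm (\<i> * E1 (\<i> * of_real t)) \<le> C" using b1 by (simp add: norm_mult)
    qed
    consider "x < y" | "y < x" | "x = y" by linarith
    then show ?thesis
    proof cases
      case 2
      then show ?thesis using ck[OF 2] by (simp add: norm_minus_commute right_diff_distrib)
    qed (use ck in \<open>auto simp: right_diff_distrib\<close>)
  qed
  have R1: "norm (of_real (r powr (\<alpha> - 1)) * mittag_leffler \<alpha> \<alpha> (\<i> * of_real (b * r powr \<alpha>))) \<le> C * r powr (\<alpha> - 1)" if "0 < r" for b r :: real
  proof -
    have "norm (of_real (r powr (\<alpha> - 1)) * mittag_leffler \<alpha> \<alpha> (\<i> * of_real (b * r powr \<alpha>))) = \<alpha> * norm (E1 (\<i> * of_real (b * r powr \<alpha>))) * r powr (\<alpha> - 1)"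
      using \<alpha> by (simp add: EE norm_mult)
    also have "\<dots> \<le> 1 * C * r powr (\<alpha> - 1)"
      by (intro mult_mono b1) (use \<alpha> C0 in auto)
    finally show ?thesis by simp
  qed
  have R2: "norm (of_real (s powr (\<alpha> - 1)) * mittag_leffler \<alpha> \<alpha> (\<i> * of_real (b * s powr \<alpha>))
         - of_real (r powr (\<alpha> - 1)) * mittag_leffler \<alpha> \<alpha> (\<i> * of_real (b * r powr \<alpha>))) \<le> C / (1 - \<alpha>) * (r powr (\<alpha> - 1) - s powr (\<alpha> - 1))"
    if rs: "0 < r" "r \<le> s" for b r s :: real
  proof (cases "r = s")
    case False
    with rs have rs': "r < s" by simp
    let ?p = "\<lambda>t. complex_of_real (t powr (\<alpha> - 1)) * mittag_leffler \<alpha> \<alpha> (\<i> * of_real (b * t powr \<alpha>))"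
    let ?z = "\<lambda>t. \<i> * complex_of_real (b * t powr \<alpha>)"
    let ?d = "\<lambda>t. of_real \<alpha> * (of_real (t powr (\<alpha> - 1)) * (\<i> * of_real (b * \<alpha> * t powr (\<alpha> - 1)) * E2 (?z t)) + of_real ((\<alpha> - 1) * t powr (\<alpha> - 1 - 1)) * E1 (?z t))"
    have pd: "(?p has_vector_derivative ?d t) (at t)" if t: "t > 0" for t
    proof -
      have 1: "((\<lambda>t. complex_of_real (t powr (\<alpha> - 1))) has_vector_derivative of_real ((\<alpha> - 1) * t powr (\<alpha> - 1 - 1))) (at t)"
        using dpow[OF t, of 1 "\<alpha> - 1"] by (intro has_vector_derivative_of_real) (simp add: has_real_derivative_iff_has_vector_derivative)
      have "((\<lambda>t. of_real \<alpha> * (complex_of_real (t powr (\<alpha> - 1)) * E1 (?z t))) has_vector_derivative ?d t) (at t)"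
        by (rule has_vector_derivative_mult_right[OF has_vector_derivative_mult[OF 1 chain[OF D1 t]]])
      then show ?thesis by (simp add: EE mult.left_commute)
    qed
    \<comment> \<open>With this constant the comparison function
      \<open>- c * t powr (\<alpha> - 1)\<close> has derivative C t^(\<alpha>-2), the bound for the
      derivative of \<open>?p\<close>.\<close>
    define c where "c = C / (1 - \<alpha>)"
    have "norm (?p s - ?p r) \<le> - c * s powr (\<alpha> - 1) - (- c * r powr (\<alpha> - 1))"
    proof (rule differentiable_bound_general[OF rs', where f="?p" and \<phi>="\<lambda>t. - c * t powr (\<alpha> - 1)" and \<phi>'="\<lambda>t. - c * (\<alpha> - 1) * t powr (\<alpha> - 1 - 1)"])
      show "continuous_on {r..s} ?p"
        by (intro continuous_at_imp_continuous_on ballI has_vector_derivative_continuous[OF pd]) (use rs in auto)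
      show "continuous_on {r..s} (\<lambda>t. - c * t powr (\<alpha> - 1))" using rs by (intro continuous_intros) auto
      fix x assume x: "r < x" "x < s"
      with rs have x0: "x > 0" by simp
      show "(?p has_vector_derivative ?d x) (at x)" by (rule pd[OF x0])
      show "((\<lambda>t. - c * t powr (\<alpha> - 1)) has_vector_derivative - c * (\<alpha> - 1) * x powr (\<alpha> - 1 - 1)) (at x)"
        using dpow[OF x0, of "- c" "\<alpha> - 1"] by (simp add: has_real_derivative_iff_has_vector_derivative)
      let ?q = "x powr (\<alpha> - 1 - 1)"
      have na: "norm (complex_of_real \<alpha> - 1) = 1 - \<alpha>"
        using norm_of_real[of "\<alpha> - 1", where 'a=complex] \<alpha> by simp
      have pq: "x powr (\<alpha> - 1) * (\<bar>b\<bar> * x powr (\<alpha> - 1)) = ?q * \<bar>b * x powr \<alpha>\<bar>"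
        using x0 by (simp add: powr_diff abs_mult power2_eq_square)
      have "norm (?d x) \<le> \<alpha> * (x powr (\<alpha> - 1) * (\<alpha> * (\<bar>b\<bar> * x powr (\<alpha> - 1)) * norm (E2 (?z x))) + (1 - \<alpha>) * ?q * norm (E1 (?z x)))"
        unfolding norm_mult norm_of_real using \<alpha>
        by (auto intro!: mult_left_mono order_trans[OF norm_triangle_ineq] simp: norm_mult abs_mult na)
      also have "\<dots> = \<alpha> * ?q * (\<alpha> * (\<bar>b * x powr \<alpha>\<bar> * norm (E2 (?z x))) + (1 - \<alpha>) * norm (E1 (?z x)))"
        using pq by (simp add: algebra_simps)
      also have "\<dots> \<le> 1 * ?q * (\<alpha> * C + (1 - \<alpha>) * C)"
        by (intro mult_mono add_mono mult_left_mono b1 b2) (use \<alpha> C0 in auto)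
      also have "\<dots> = - c * (\<alpha> - 1) * ?q" using \<alpha> by (simp add: c_def field_simps)
      finally show "norm (?d x) \<le> - c * (\<alpha> - 1) * ?q" .
    qed
    then show ?thesis by (simp add: c_def algebra_simps)
  qed simp
  show ?thesis
  proof (rule that[of K])
    have cml: "continuous_on UNIV (mittag_leffler \<alpha> 1)"
      by (intro continuous_at_imp_continuous_on ballI DERIV_isCont[OF D0])
    have cE1: "continuous_on UNIV E1"
      by (intro continuous_at_imp_continuous_on ballI DERIV_isCont[OF D1])
    show "continuous_on UNIV (mittag_leffler \<alpha> 1)" by (rule cml)
    show "continuous_on UNIV (mittag_leffler \<alpha> \<alpha>)"
      using EE continuous_on_mult_left[OF cE1, of "of_real \<alpha>"] by (simp add: fun_eq_iff[symmetric] cong: continuous_on_cong)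
    show "norm (mittag_leffler \<alpha> 1 (\<i> * of_real y)) \<le> K" for y :: real
      using b0[of y] K by linarith
    show "norm (mittag_leffler \<alpha> 1 (\<i> * of_real (b * t powr \<alpha>)) - mittag_leffler \<alpha> 1 (\<i> * of_real (b * s powr \<alpha>))) \<le> K / s * (t - s)"
      if "0 < s" "s \<le> t" for b s t :: real
      by (rule order_trans[OF S1[OF that] mult_right_mono[OF divide_right_mono[OF K(2)]]]) (use that in auto)
    show "norm (mittag_leffler \<alpha> 1 (\<i> * of_real y) - mittag_leffler \<alpha> 1 (\<i> * of_real x)) \<le> K * \<bar>y - x\<bar>" for x y :: real
      by (rule order_trans[OF S2 mult_right_mono[OF K(2)]]) simp
    show "norm (of_real (r powr (\<alpha> - 1)) * mittag_leffler \<alpha> \<alpha> (\<i> * of_real (b * r powr \<alpha>))) \<le> K * r powr (\<alpha> - 1)" if "0 < r" for b r :: real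
      by (rule order_trans[OF R1[OF that] mult_right_mono[OF K(2)]]) simp
    show "norm (of_real (s powr (\<alpha> - 1)) * mittag_leffler \<alpha> \<alpha> (\<i> * of_real (b * s powr \<alpha>))
         - of_real (r powr (\<alpha> - 1)) * mittag_leffler \<alpha> \<alpha> (\<i> * of_real (b * r powr \<alpha>))) \<le> K * (r powr (\<alpha> - 1) - s powr (\<alpha> - 1))"
      if "0 < r" "r \<le> s" for b r s :: real
    proof (rule order_trans[OF R2[OF that] mult_right_mono[OF K(3)]])
      have "s powr (\<alpha> - 1) \<le> r powr (\<alpha> - 1)" by (rule powr_mono2') (use \<alpha> that in auto)
      then show "0 \<le> r powr (\<alpha> - 1) - s powr (\<alpha> - 1)" by simp
    qed
  qed (rule K(1))
qed

lemma spectral_operator_bounds: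
  fixes \<alpha> :: real and D :: "'h::{complex_inner,banach,second_countable_topology} set"
    and M :: "'w measure" and U :: "('w \<Rightarrow> complex) \<Rightarrow> 'h"
  assumes \<alpha>: "0 < \<alpha>" "\<alpha> < 1" and spec: "spectral_representation D A M U a"
  obtains C :: real where "C > 0"
    "\<And>s t x. 0 < s \<Longrightarrow> s \<le> t \<Longrightarrow> norm (S_op \<alpha> M U a t x - S_op \<alpha> M U a s x) \<le> C / s * (t - s) * norm x"
    "\<And>s t x. x \<in> D \<Longrightarrow> 0 \<le> s \<Longrightarrow> s \<le> t \<Longrightarrow> norm (S_op \<alpha> M U a t x - S_op \<alpha> M U a s x) \<le> C * (t - s) powr \<alpha> * norm (A x)"
    "\<And>r \<phi>. 0 < r \<Longrightarrow> norm (P_op \<alpha> M U a r \<phi>) \<le> C * r powr (\<alpha> - 1) * norm \<phi>"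
    "\<And>r s \<phi>. 0 < r \<Longrightarrow> r \<le> s \<Longrightarrow> norm (P_op \<alpha> M U a s \<phi> - P_op \<alpha> M U a r \<phi>) \<le> C * (r powr (\<alpha> - 1) - s powr (\<alpha> - 1)) * norm \<phi>"
    "\<And>r \<phi> \<psi>. 0 < r \<Longrightarrow> P_op \<alpha> M U a r \<phi> - P_op \<alpha> M U a r \<psi> = P_op \<alpha> M U a r (\<phi> - \<psi>)"
proof -
  have U: "unitary_from_L2 M U" and am[measurable]: "a \<in> borel_measurable M"
    and D: "\<And>\<psi>. \<psi> \<in> D \<Longrightarrow> (\<lambda>w. complex_of_real (a w) * L2_inv M U \<psi> w) \<in> lp_space 2 M"
    and A: "\<And>\<psi>. \<psi> \<in> D \<Longrightarrow> A \<psi> = U (\<lambda>w. complex_of_real (a w) * L2_inv M U \<psi> w)"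
    using spec by (auto simp: spectral_representation_def)
  obtain C :: real where C: "C > 0"
    and c1: "continuous_on UNIV (mittag_leffler \<alpha> 1)" and c2: "continuous_on UNIV (mittag_leffler \<alpha> \<alpha>)"
    and b0: "\<And>y::real. norm (mittag_leffler \<alpha> 1 (\<i> * of_real y)) \<le> C"
    and bt: "\<And>b s t :: real. 0 < s \<Longrightarrow> s \<le> t \<Longrightarrow> norm (mittag_leffler \<alpha> 1 (\<i> * of_real (b * t powr \<alpha>)) - mittag_leffler \<alpha> 1 (\<i> * of_real (b * s powr \<alpha>))) \<le> C / s * (t - s)"
    and bl: "\<And>x y::real. norm (mittag_leffler \<alpha> 1 (\<i> * of_real y) - mittag_leffler \<alpha> 1 (\<i> * of_real x)) \<le> C * \<bar>y - x\<bar>"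
    and bp: "\<And>b r :: real. 0 < r \<Longrightarrow> norm (of_real (r powr (\<alpha> - 1)) * mittag_leffler \<alpha> \<alpha> (\<i> * of_real (b * r powr \<alpha>))) \<le> C * r powr (\<alpha> - 1)"
    and bd: "\<And>b r s :: real. 0 < r \<Longrightarrow> r \<le> s \<Longrightarrow> norm (of_real (s powr (\<alpha> - 1)) * mittag_leffler \<alpha> \<alpha> (\<i> * of_real (b * s powr \<alpha>))
         - of_real (r powr (\<alpha> - 1)) * mittag_leffler \<alpha> \<alpha> (\<i> * of_real (b * r powr \<alpha>))) \<le> C * (r powr (\<alpha> - 1) - s powr (\<alpha> - 1))"
    using mittag_leffler_multiplier_bounds[OF \<alpha>] by blast
  note [measurable] = borel_measurable_continuous_onI[OF c1] borel_measurable_continuous_onI[OF c2]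
  define m where "m t w = mittag_leffler \<alpha> 1 (\<i> * of_real (a w * t powr \<alpha>))" for t w
  define p where "p t w = of_real (t powr (\<alpha> - 1)) * mittag_leffler \<alpha> \<alpha> (\<i> * of_real (a w * t powr \<alpha>))" for t w
  have mm: "m t \<in> borel_measurable M" for t unfolding m_def by measurable
  have pm: "p t \<in> borel_measurable M" for t unfolding p_def by measurable
  have S: "S_op \<alpha> M U a t = mult_op M U (m t)" for t by (simp add: fun_eq_iff S_op_def mult_op_def m_def)
  have P: "P_op \<alpha> M U a t = mult_op M U (p t)" for t by (simp add: fun_eq_iff P_op_def mult_op_def p_def)
  have mb: "norm (m t w) \<le> C" for t w unfolding m_def by (rule b0)
  have pb: "norm (p r w) \<le> C * r powr (\<alpha> - 1)" if "r > 0" for r w unfolding p_def by (rule bp[OF that])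
  have Sd: "S_op \<alpha> M U a t x - S_op \<alpha> M U a s x = mult_op M U (\<lambda>w. m t w - m s w) x" for s t x
    unfolding S by (rule mult_op_diff_multiplier[OF U mm mb mm mb])
  show ?thesis
  proof (rule that[OF C])
    show "norm (S_op \<alpha> M U a t x - S_op \<alpha> M U a s x) \<le> C / s * (t - s) * norm x" if "0 < s" "s \<le> t" for s t x
      unfolding Sd
    proof (rule norm_mult_op_le[OF U])
      show "(\<lambda>w. m t w - m s w) \<in> borel_measurable M" using mm by measurable
      show "norm (m t w - m s w) \<le> C / s * (t - s)" for w unfolding m_def by (rule bt[OF that])
    qed
    show "norm (S_op \<alpha> M U a t x - S_op \<alpha> M U a s x) \<le> C * (t - s) powr \<alpha> * norm (A x)"
      if x: "x \<in> D" and st: "0 \<le> s" "s \<le> t" for s t x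
      unfolding Sd A[OF x]
    proof (rule mult_op_L2_norm_bound[OF U _ D[OF x]])
      show "(\<lambda>w. m t w - m s w) \<in> borel_measurable M" using mm by measurable
      fix w
      \<comment> \<open>The Lipschitz bound leaves one factor |a w|, and it is this factor that
        becomes \<open>A x\<close>; the rest is a power of the time increment.\<close>
      have "t powr \<alpha> - s powr \<alpha> \<le> (t - s) powr \<alpha>" by (rule powr_diff_le_powr_of_diff) (use \<alpha> st in auto)
      moreover have "s powr \<alpha> \<le> t powr \<alpha>" by (rule powr_mono2) (use \<alpha> st in auto)
      ultimately have "\<bar>a w * t powr \<alpha> - a w * s powr \<alpha>\<bar> \<le> \<bar>a w\<bar> * (t - s) powr \<alpha>"
        unfolding right_diff_distrib[symmetric] abs_mult by (intro mult_left_mono) auto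
      then have "C * \<bar>a w * t powr \<alpha> - a w * s powr \<alpha>\<bar> \<le> C * (\<bar>a w\<bar> * (t - s) powr \<alpha>)"
        by (rule mult_left_mono) (use C in simp)
      from order_trans[OF bl this]
      show "norm (m t w - m s w) \<le> C * (t - s) powr \<alpha> * norm (complex_of_real (a w))"
        by (simp add: m_def mult_ac)
    qed (use C in simp)
    show "norm (P_op \<alpha> M U a r \<phi>) \<le> C * r powr (\<alpha> - 1) * norm \<phi>" if "0 < r" for r \<phi>
      unfolding P by (rule norm_mult_op_le[OF U pm pb[OF that]])
    show "norm (P_op \<alpha> M U a s \<phi> - P_op \<alpha> M U a r \<phi>) \<le> C * (r powr (\<alpha> - 1) - s powr (\<alpha> - 1)) * norm \<phi>"
      if rs: "0 < r" "r \<le> s" for r s \<phi>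
    proof -
      have s: "0 < s" using rs by simp
      have "P_op \<alpha> M U a s \<phi> - P_op \<alpha> M U a r \<phi> = mult_op M U (\<lambda>w. p s w - p r w) \<phi>"
        unfolding P by (rule mult_op_diff_multiplier[OF U pm pb[OF s] pm pb[OF rs(1)]])
      also have "norm \<dots> \<le> C * (r powr (\<alpha> - 1) - s powr (\<alpha> - 1)) * norm \<phi>"
      proof (rule norm_mult_op_le[OF U])
        show "(\<lambda>w. p s w - p r w) \<in> borel_measurable M" using pm by measurable
        show "norm (p s w - p r w) \<le> C * (r powr (\<alpha> - 1) - s powr (\<alpha> - 1))" for w unfolding p_def by (rule bd[OF rs])
      qed
      finally show ?thesis .
    qed
    show "P_op \<alpha> M U a r \<phi> - P_op \<alpha> M U a r \<psi> = P_op \<alpha> M U a r (\<phi> - \<psi>)" if "0 < r" for r \<phi> \<psi>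
      unfolding P by (rule mult_op_diff[OF U pm pb[OF that]])
  qed
qed

text \<open>The integrands at times t and s differ by at most
  \<open>C * diff_kernel * norm F\<close> pointwise, and Hoelder's inequality pairs the kernel in
  L^q' with \<open>F\<close> in L^q. The condition \<open>(1 - \<alpha>) * q' < 1\<close> is
  integrability of the q'-th power of the singularity, and (1 - (1 - \<alpha>) q') / q' = \<alpha> -
  1 + 1/q'.\<close>

lemma weakly_singular_convolution_holder:
  fixes P :: "real \<Rightarrow> 'h::{banach,second_countable_topology} \<Rightarrow> 'h" and F :: "real \<Rightarrow> 'h"
  assumes \<alpha>: "\<alpha> < 1" and q: "q > 1" "1 / q + 1 / q' = 1" "(1 - \<alpha>) * q' < 1" and C: "C > 0"
    and P_bd: "\<And>r \<phi>. 0 < r \<Longrightarrow> norm (P r \<phi>) \<le> C * r powr (\<alpha> - 1) * norm \<phi>"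
    and P_diff: "\<And>r s \<phi>. 0 < r \<Longrightarrow> r \<le> s \<Longrightarrow> norm (P s \<phi> - P r \<phi>) \<le> C * (r powr (\<alpha> - 1) - s powr (\<alpha> - 1)) * norm \<phi>"
    and P_lin: "\<And>r \<phi> \<psi>. 0 < r \<Longrightarrow> P r \<phi> - P r \<psi> = P r (\<phi> - \<psi>)"
    and F: "F \<in> lp_space q (lebesgue_on {0<..<T})"
    and st: "0 \<le> s" "s \<le> t" "t \<le> T"
  shows "norm ((LINT \<tau>:{0<..<t}|lebesgue. P (t - \<tau>) (F \<tau>)) - (LINT \<tau>:{0<..<s}|lebesgue. P (s - \<tau>) (F \<tau>)))
    \<le> C * (2 / (1 - (1 - \<alpha>) * q')) powr (1 / q') * (t - s) powr (\<alpha> - 1 + 1 / q') * lp_norm q (lebesgue_on {0<..<T}) F"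
proof -
  have q': "q' > 1"
  proof -
    have "1 / q < 1" "1 / q > 0" using q(1) by auto
    then have "0 < 1 / q'" "1 / q' < 1" using q(2) by linarith+
    then show ?thesis by (simp add: divide_less_eq split: if_splits)
  qed
  let ?S = "{0<..<T}"
  \<comment> \<open>Extension by zero places the integrands of all times on one measure space; for
    times up to \<open>T\<close> the convolution is unchanged.\<close>
  define G where "G \<tau> = indicator ?S \<tau> *\<^sub>R F \<tau>" for \<tau>
  have S: "?S \<inter> space lebesgue \<in> sets lebesgue" by simp
  have Gm[measurable]: "G \<in> borel_measurable lebesgue"
    using F borel_measurable_restrict_space_iff[OF S, of F] by (simp add: lp_space_def G_def[abs_def])
  have nG: "norm (G \<tau>) powr q = indicator ?S \<tau> *\<^sub>R (norm (F \<tau>) powr q)" for \<tau>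
    using q by (simp add: G_def indicator_def)
  have Gq: "integrable lebesgue (\<lambda>\<tau>. norm (G \<tau>) powr q)"
    unfolding nG using F integrable_restrict_space[OF S, of "\<lambda>\<tau>. norm (F \<tau>) powr q"] by (simp add: lp_space_def)
  have GN: "(LINT \<tau>|lebesgue. norm (G \<tau>) powr q) powr (1 / q) = lp_norm q (lebesgue_on ?S) F"
    unfolding nG lp_norm_def using integral_restrict_space[OF S, of "\<lambda>\<tau>. norm (F \<tau>) powr q"] by simp
  define k where "k t \<tau> = indicator {0<..<t} \<tau> *\<^sub>R P (t - \<tau>) (G \<tau>)" for t \<tau>
  have km: "k t \<in> borel_measurable lebesgue" for t
  proof -
    let ?X = "{0::real<..} \<times> (UNIV :: 'h set)"
    \<comment> \<open>\<open>F\<close> is only measurable, so measurability of the integrand is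
      obtained by composition with a jointly continuous map: \<open>P_diff\<close> gives continuity
      in r, and \<open>P_lin\<close> with \<open>P_bd\<close> a Lipschitz bound in the vector,
      locally uniform in \<open>r > 0\<close>.\<close>
    have cont: "continuous_on ?X (\<lambda>x. P (fst x) (snd x))"
      unfolding continuous_on_def
    proof
      fix x0 :: "real \<times> 'h" assume x0: "x0 \<in> ?X"
      define r0 \<psi> where "r0 = fst x0" and "\<psi> = snd x0"
      have r0: "r0 > 0" using x0 by (auto simp: r0_def)
      let ?b = "\<lambda>x. C * fst x powr (\<alpha> - 1) * norm (snd x - \<psi>) + C * \<bar>fst x powr (\<alpha> - 1) - r0 powr (\<alpha> - 1)\<bar> * norm \<psi>"
      have le: "norm (P (fst x) (snd x) - P r0 \<psi>) \<le> ?b x" if x: "x \<in> ?X" for x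
      proof -
        have r: "fst x > 0" using x by auto
        have "norm (P (fst x) (snd x) - P (fst x) \<psi>) \<le> C * fst x powr (\<alpha> - 1) * norm (snd x - \<psi>)"
          unfolding P_lin[OF r] by (rule P_bd[OF r])
        moreover have "norm (P (fst x) \<psi> - P r0 \<psi>) \<le> C * \<bar>fst x powr (\<alpha> - 1) - r0 powr (\<alpha> - 1)\<bar> * norm \<psi>"
        proof (cases "r0 \<le> fst x")
          case True
          show ?thesis
            by (rule order_trans[OF P_diff[OF r0 True]]) (use C in \<open>auto intro!: mult_right_mono mult_left_mono\<close>)
        next
          case False
          then have "fst x \<le> r0" by simp
          then show ?thesis unfolding norm_minus_commute[of "P (fst x) \<psi>"]
            by (intro order_trans[OF P_diff[OF r]]) (use C in \<open>auto intro!: mult_right_mono mult_left_mono\<close>)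
        qed
        moreover have "norm (P (fst x) (snd x) - P r0 \<psi>) \<le> norm (P (fst x) (snd x) - P (fst x) \<psi>) + norm (P (fst x) \<psi> - P r0 \<psi>)"
          using norm_triangle_ineq[of "P (fst x) (snd x) - P (fst x) \<psi>" "P (fst x) \<psi> - P r0 \<psi>"] by simp
        ultimately show ?thesis by linarith
      qed
      have "((\<lambda>x. ?b x) \<longlongrightarrow> C * r0 powr (\<alpha> - 1) * norm (\<psi> - \<psi>) + C * \<bar>r0 powr (\<alpha> - 1) - r0 powr (\<alpha> - 1)\<bar> * norm \<psi>) (at x0 within ?X)"
        using r0 unfolding r0_def \<psi>_def by (intro tendsto_intros) auto
      then have b0: "((\<lambda>x. ?b x) \<longlongrightarrow> 0) (at x0 within ?X)" by simp
      have "((\<lambda>x. P (fst x) (snd x) - P r0 \<psi>) \<longlongrightarrow> 0) (at x0 within ?X)"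
        by (rule Lim_null_comparison[OF _ b0]) (use le in \<open>auto simp: eventually_at_filter\<close>)
      then show "((\<lambda>x. P (fst x) (snd x)) \<longlongrightarrow> P (fst x0) (snd x0)) (at x0 within ?X)"
        by (simp add: LIM_zero_iff r0_def \<psi>_def)
    qed
    have X: "?X \<in> sets borel" by (intro borel_open open_Times open_greaterThan open_UNIV)
    have hm: "(\<lambda>x. indicator ?X x *\<^sub>R P (fst x) (snd x)) \<in> borel_measurable borel"
      by (rule borel_measurable_continuous_on_indicator[OF X cont])
    have pm: "(\<lambda>\<tau>. (t - \<tau>, G \<tau>)) \<in> borel_measurable lebesgue"
      by (intro borel_measurable_Pair borel_measurable_diff borel_measurable_const) (auto intro: measurable_completion)
    have "(\<lambda>\<tau>. indicator {0<..<t} \<tau> *\<^sub>R (indicator ?X (t - \<tau>, G \<tau>) *\<^sub>R P (t - \<tau>) (G \<tau>))) \<in> borel_measurable lebesgue"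
    proof (rule borel_measurable_scaleR)
      show "(\<lambda>\<tau>. indicator ?X (t - \<tau>, G \<tau>) *\<^sub>R P (t - \<tau>) (G \<tau>)) \<in> borel_measurable lebesgue"
        using measurable_compose[OF pm hm] by simp
    qed (rule borel_measurable_indicator, simp)
    also have "(\<lambda>\<tau>. indicator {0<..<t} \<tau> *\<^sub>R (indicator ?X (t - \<tau>, G \<tau>) *\<^sub>R P (t - \<tau>) (G \<tau>))) = k t"
      by (auto simp: k_def fun_eq_iff indicator_def)
    finally show ?thesis .
  qed
  have int_k: "(LINT \<tau>:{0<..<t}|lebesgue. P (t - \<tau>) (F \<tau>)) = (LINT \<tau>|lebesgue. k t \<tau>)" if "t \<le> T" for t
    unfolding set_lebesgue_integral_def k_def
    by (rule Bochner_Integration.integral_cong) (use that in \<open>auto simp: G_def indicator_def\<close>)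
  have ker: "integrable lebesgue (\<lambda>\<tau>. diff_kernel \<alpha> s t \<tau> * norm (G \<tau>))"
    "(LINT \<tau>|lebesgue. diff_kernel \<alpha> s t \<tau> * norm (G \<tau>)) \<le> (2 / (1 - (1 - \<alpha>) * q') * (t - s) powr (1 - (1 - \<alpha>) * q')) powr (1 / q') * lp_norm q (lebesgue_on ?S) F"
    if st: "0 \<le> s" "s \<le> t" for s t
  proof -
    have dm: "diff_kernel \<alpha> s t \<in> borel_measurable lborel" unfolding diff_kernel_def[abs_def] by measurable
    have dm': "diff_kernel \<alpha> s t \<in> borel_measurable lebesgue" using dm by (rule measurable_completion)
    note L = diff_kernel_Lp[OF \<alpha> less_imp_le[OF q'] q(3) st]
    have dp: "(\<lambda>\<tau>. diff_kernel \<alpha> s t \<tau> powr q') \<in> borel_measurable lborel" using dm by measurable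
    have i: "integrable lebesgue (\<lambda>\<tau>. diff_kernel \<alpha> s t \<tau> powr q')"
      using L(1) integrable_completion[OF dp] by simp
    have iv: "(LINT \<tau>|lebesgue. diff_kernel \<alpha> s t \<tau> powr q') = (LINT \<tau>|lborel. diff_kernel \<alpha> s t \<tau> powr q')"
      by (rule integral_completion[OF dp])
    have qq: "1 / q' + 1 / q = 1" using q(2) by simp
    have nGm: "(\<lambda>\<tau>. norm (G \<tau>)) \<in> borel_measurable lebesgue" by measurable
    note H = Holder_inequality_integral[OF q' q(1) qq dm' diff_kernel_nonneg[OF \<alpha> st(2)] i nGm norm_ge_zero Gq]
    show "integrable lebesgue (\<lambda>\<tau>. diff_kernel \<alpha> s t \<tau> * norm (G \<tau>))" by (rule H(1))
    have "(LINT \<tau>|lebesgue. diff_kernel \<alpha> s t \<tau> * norm (G \<tau>)) \<le> (LINT \<tau>|lborel. diff_kernel \<alpha> s t \<tau> powr q') powr (1 / q') * lp_norm q (lebesgue_on ?S) F"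
      using H(2) unfolding GN iv .
    also have "\<dots> \<le> (2 / (1 - (1 - \<alpha>) * q') * (t - s) powr (1 - (1 - \<alpha>) * q')) powr (1 / q') * lp_norm q (lebesgue_on ?S) F"
      by (intro mult_right_mono powr_mono2 L(2)) (use q' in \<open>auto simp: lp_norm_def intro!: integral_nonneg_AE\<close>)
    finally show "(LINT \<tau>|lebesgue. diff_kernel \<alpha> s t \<tau> * norm (G \<tau>)) \<le> (2 / (1 - (1 - \<alpha>) * q') * (t - s) powr (1 - (1 - \<alpha>) * q')) powr (1 / q') * lp_norm q (lebesgue_on ?S) F" .
  qed
  have kd: "norm (k t \<tau> - k s \<tau>) \<le> C * (diff_kernel \<alpha> s t \<tau> * norm (G \<tau>))" if st: "0 \<le> s" "s \<le> t" for s t \<tau>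
  proof -
    have nn: "C * (diff_kernel \<alpha> s t \<tau> * norm (G \<tau>)) \<ge> 0"
      using C diff_kernel_nonneg[OF \<alpha> st(2)] by simp
    consider "\<tau> \<le> 0" | "0 < \<tau>" "\<tau> < s" | "0 < \<tau>" "s \<le> \<tau>" "\<tau> < t" | "t \<le> \<tau>" by linarith
    then show ?thesis
    proof cases
      case 2
      then have "k t \<tau> - k s \<tau> = P (t - \<tau>) (G \<tau>) - P (s - \<tau>) (G \<tau>)" using st by (simp add: k_def)
      also have "norm \<dots> \<le> C * ((s - \<tau>) powr (\<alpha> - 1) - (t - \<tau>) powr (\<alpha> - 1)) * norm (G \<tau>)"
        by (rule P_diff) (use 2 st in auto)
      also have "\<dots> = C * (diff_kernel \<alpha> s t \<tau> * norm (G \<tau>))" using 2 st by (simp add: diff_kernel_def)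
      finally show ?thesis .
    next
      case 3
      then have "k t \<tau> - k s \<tau> = P (t - \<tau>) (G \<tau>)" using st by (simp add: k_def)
      also have "norm \<dots> \<le> C * (t - \<tau>) powr (\<alpha> - 1) * norm (G \<tau>)"
        by (rule P_bd) (use 3 in auto)
      also have "\<dots> = C * (diff_kernel \<alpha> s t \<tau> * norm (G \<tau>))" using 3 st by (simp add: diff_kernel_def)
      finally show ?thesis .
    qed (use nn st in \<open>simp_all add: k_def\<close>)
  qed
  \<comment> \<open>Hence integrability of \<open>k t\<close> is the case s = 0 of the difference
    estimate.\<close>
  have k0: "k 0 = (\<lambda>_. 0)" by (simp add: k_def fun_eq_iff)
  have ik: "integrable lebesgue (k t)" if "0 \<le> t" for t
  proof (rule Bochner_Integration.integrable_bound[OF _ km])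
    show "integrable lebesgue (\<lambda>\<tau>. C * (diff_kernel \<alpha> 0 t \<tau> * norm (G \<tau>)))"
      by (rule integrable_mult_right[OF ker(1)]) (use that in auto)
    show "AE \<tau> in lebesgue. norm (k t \<tau>) \<le> norm (C * (diff_kernel \<alpha> 0 t \<tau> * norm (G \<tau>)))"
      using kd[of 0 t] that by (intro AE_I2) (simp add: k0 order_trans[OF _ abs_ge_self])
  qed
  have t0: "0 \<le> t" and sT: "s \<le> T" using st by auto
  have "(LINT \<tau>:{0<..<t}|lebesgue. P (t - \<tau>) (F \<tau>)) - (LINT \<tau>:{0<..<s}|lebesgue. P (s - \<tau>) (F \<tau>)) = (LINT \<tau>|lebesgue. k t \<tau> - k s \<tau>)"
    unfolding int_k[OF st(3)] int_k[OF sT] by (rule Bochner_Integration.integral_diff[symmetric]) (intro ik st t0)+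
  also have "norm \<dots> \<le> (LINT \<tau>|lebesgue. norm (k t \<tau> - k s \<tau>))" by (rule integral_norm_bound)
  also have "\<dots> \<le> (LINT \<tau>|lebesgue. C * (diff_kernel \<alpha> s t \<tau> * norm (G \<tau>)))"
    by (rule integral_mono[OF integrable_norm[OF Bochner_Integration.integrable_diff[OF ik ik]] integrable_mult_right[OF ker(1)] kd])
       (use st in auto)
  also have "\<dots> = C * (LINT \<tau>|lebesgue. diff_kernel \<alpha> s t \<tau> * norm (G \<tau>))" by simp
  also have "\<dots> \<le> C * ((2 / (1 - (1 - \<alpha>) * q') * (t - s) powr (1 - (1 - \<alpha>) * q')) powr (1 / q') * lp_norm q (lebesgue_on ?S) F)"
    by (rule mult_left_mono[OF ker(2)]) (use C st in auto)
  also have "(2 / (1 - (1 - \<alpha>) * q') * (t - s) powr (1 - (1 - \<alpha>) * q')) powr (1 / q') = (2 / (1 - (1 - \<alpha>) * q')) powr (1 / q') * (t - s) powr (\<alpha> - 1 + 1 / q')"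
  proof -
    have "(1 - (1 - \<alpha>) * q') * (1 / q') = \<alpha> - 1 + 1 / q'" using q' by (simp add: field_simps)
    then show ?thesis using q(3) by (subst powr_mult) (simp_all only: powr_powr)
  qed
  finally show ?thesis by (simp add: mult.assoc)
qed


section \<open>From increments to Hoelder seminorms, and the mild solution\<close>

lemma holder_space_seminormI:
  fixes u :: "real \<Rightarrow> 'b::real_normed_vector"
  assumes \<gamma>: "\<gamma> > 0"
    and bd: "\<And>s t. s \<in> J \<Longrightarrow> t \<in> J \<Longrightarrow> s < t \<Longrightarrow> norm (u t - u s) \<le> B * (t - s) powr \<gamma>"
    and J: "s0 \<in> J" "t0 \<in> J" "s0 < t0"
  shows "u \<in> holder_space \<gamma> J" and "holder_seminorm \<gamma> J u \<le> B"
proof -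
  have bd': "norm (u t - u s) \<le> B * \<bar>t - s\<bar> powr \<gamma>" if "s \<in> J" "t \<in> J" for s t
  proof -
    consider "s < t" | "t < s" | "s = t" by linarith
    then show ?thesis
    proof cases
      case 2
      then show ?thesis using bd[OF that(2,1) 2] by (simp add: norm_minus_commute)
    qed (use bd[OF that] in auto)
  qed
  have le: "z \<le> B" if "z \<in> holder_quotients \<gamma> J u" for z
    using that bd' by (auto simp: holder_quotients_def divide_le_eq)
  have ne: "holder_quotients \<gamma> J u \<noteq> {}" using J by (auto simp: holder_quotients_def)
  show "holder_seminorm \<gamma> J u \<le> B"
    unfolding holder_seminorm_def by (rule cSup_least[OF ne le])
  have "continuous_on J u"
    unfolding continuous_on_def
  proof
    fix s assume s: "s \<in> J"
    have "((\<lambda>t. B * \<bar>t - s\<bar> powr \<gamma>) \<longlongrightarrow> B * \<bar>s - s\<bar> powr \<gamma>) (at s within J)"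
      by (intro tendsto_intros tendsto_powr') (use \<gamma> in auto)
    then have "((\<lambda>t. B * \<bar>t - s\<bar> powr \<gamma>) \<longlongrightarrow> 0) (at s within J)" by simp
    then have "((\<lambda>t. u t - u s) \<longlongrightarrow> 0) (at s within J)"
      by (rule Lim_null_comparison[rotated]) (use bd'[OF s] in \<open>auto simp: eventually_at_filter\<close>)
    then show "(u \<longlongrightarrow> u s) (at s within J)" by (simp add: LIM_zero_iff)
  qed
  moreover have "bdd_above (holder_quotients \<gamma> J u)" using le by (rule bdd_aboveI)
  ultimately show "u \<in> holder_space \<gamma> J" by (simp add: holder_space_def)
qed


theorem theoremD2:
  fixes \<alpha> q q' :: real
    and D :: "'h::{complex_inner,banach,second_countable_topology} set"
    and A :: "'h \<Rightarrow> 'h"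
    and M :: "'w measure"
    and U :: "('w \<Rightarrow> complex) \<Rightarrow> 'h"
    and a :: "'w \<Rightarrow> real"
  assumes "1 / 2 < \<alpha>" and "\<alpha> < 1"
    and "1 / (2 * \<alpha> - 1) < q" and "1 / q + 1 / q' = 1"
    and "selfadjoint_operator D A"
    and "spectral_representation D A M U a"
  shows "\<exists>C>0. \<forall>T>0. \<forall>x. \<forall>F\<in>lp_space q (lebesgue_on {0<..<T}).
    (\<forall>\<delta>. 0 < \<delta> \<and> \<delta> < T \<longrightarrow>
       mild_solution \<alpha> M U a x F \<in> holder_space (1 - \<alpha>) {\<delta>..T} \<and>
       holder_seminorm (1 - \<alpha>) {\<delta>..T} (mild_solution \<alpha> M U a x F)
         \<le> C * ((1 + 1 / \<delta>) * T powr \<alpha> * norm x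
                + (T powr (1 / q' + 4 * \<alpha> - 3) + T powr (1 / q' + 2 * \<alpha> - 1)
                   + T powr (1 / q' - 2 * (1 - \<alpha>)))
                  * lp_norm q (lebesgue_on {0<..<T}) F)) \<and>
    (x \<in> D \<longrightarrow>
       mild_solution \<alpha> M U a x F \<in> holder_space (1 - \<alpha>) {0..T} \<and>
       holder_seminorm (1 - \<alpha>) {0..T} (mild_solution \<alpha> M U a x F)
         \<le> C * ((T powr (2 * \<alpha> - 1) + T powr (2 * \<alpha>)) * graph_norm A x
                + (T powr (1 / q' + 4 * \<alpha> - 3) + T powr (1 / q' + 2 * \<alpha> - 1)
                   + T powr (1 / q' - 2 * (1 - \<alpha>)))
                  * lp_norm q (lebesgue_on {0<..<T}) F))"
proof -
  have \<alpha>: "0 < \<alpha>" "\<alpha> < 1" using assms(1,2) by auto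
  have q: "q > 1"
  proof -
    have "1 \<le> 1 / (2 * \<alpha> - 1)" using assms(1,2) by simp
    then show ?thesis using assms(3) by linarith
  qed
  \<comment> \<open>The surplus of the convolution exponent: \<alpha> - 1 + 1/q' = (1 - \<alpha>) +
    e. The factor \<open>(t - s) powr e\<close> is bounded by \<open>T powr e\<close>, the last
    summand of \<open>?W\<close>, which uses that e is positive.\<close>
  define e where "e = 1 / q' - 2 * (1 - \<alpha>)"
  have q_inv: "1 / q < 2 * \<alpha> - 1" using assms(1,3) q by (simp add: field_simps)
  have e: "e > 0" using q_inv assms(4) by (simp add: e_def)
  have q': "q' > 0" "(1 - \<alpha>) * q' < 1"
  proof -
    have 1: "1 - \<alpha> < 1 / q'" using e \<alpha> by (simp add: e_def)
    then have "0 < 1 / q'" using \<alpha> by linarith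
    then show "q' > 0" by simp
    with 1 show "(1 - \<alpha>) * q' < 1" by (simp add: pos_less_divide_eq)
  qed
  obtain C :: real where C: "C > 0"
    and S1: "\<And>s t x. 0 < s \<Longrightarrow> s \<le> t \<Longrightarrow> norm (S_op \<alpha> M U a t x - S_op \<alpha> M U a s x) \<le> C / s * (t - s) * norm x"
    and S2: "\<And>s t x. x \<in> D \<Longrightarrow> 0 \<le> s \<Longrightarrow> s \<le> t \<Longrightarrow> norm (S_op \<alpha> M U a t x - S_op \<alpha> M U a s x) \<le> C * (t - s) powr \<alpha> * norm (A x)"
    and P_bounds: "\<And>r \<phi>. 0 < r \<Longrightarrow> norm (P_op \<alpha> M U a r \<phi>) \<le> C * r powr (\<alpha> - 1) * norm \<phi>"
      "\<And>r s \<phi>. 0 < r \<Longrightarrow> r \<le> s \<Longrightarrow> norm (P_op \<alpha> M U a s \<phi> - P_op \<alpha> M U a r \<phi>) \<le> C * (r powr (\<alpha> - 1) - s powr (\<alpha> - 1)) * norm \<phi>"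
      "\<And>r \<phi> \<psi>. 0 < r \<Longrightarrow> P_op \<alpha> M U a r \<phi> - P_op \<alpha> M U a r \<psi> = P_op \<alpha> M U a r (\<phi> - \<psi>)"
    using spectral_operator_bounds[OF \<alpha> assms(6)] by blast
  define K where "K = C * (2 / (1 - (1 - \<alpha>) * q')) powr (1 / q')"
  have K: "K \<ge> 0" using C by (simp add: K_def)
  let ?u = "\<lambda>x F. mild_solution \<alpha> M U a x F"
  let ?N = "\<lambda>T F. lp_norm q (lebesgue_on {0<..<T}) F"
  let ?W = "\<lambda>T. T powr (1 / q' + 4 * \<alpha> - 3) + T powr (1 / q' + 2 * \<alpha> - 1) + T powr (1 / q' - 2 * (1 - \<alpha>))"
  \<comment> \<open>\<open>X\<close> stands for the coefficient contributed by the initial value, so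
    that both claims share the estimate of the forcing term. The constants C and K are fixed before
    T, \<delta>, x and F.\<close>
  have step: "norm (?u x F t - ?u x F s) \<le> (C + K + 1) * (X + ?W T * ?N T F) * (t - s) powr (1 - \<alpha>)"
    if F: "F \<in> lp_space q (lebesgue_on {0<..<T})" and st: "0 \<le> s" "s < t" "t \<le> T"
      and X: "X \<ge> 0" "norm (S_op \<alpha> M U a t x - S_op \<alpha> M U a s x) \<le> C * X * (t - s) powr (1 - \<alpha>)"
    for T X s t :: real and x :: 'h and F :: "real \<Rightarrow> 'h"
  proof -
    have N: "?N T F \<ge> 0" by (simp add: lp_norm_def)
    have "norm (G_op \<alpha> M U a F t - G_op \<alpha> M U a F s) \<le> K * (t - s) powr (\<alpha> - 1 + 1 / q') * ?N T F"
      unfolding G_op_def K_def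
      by (rule weakly_singular_convolution_holder[OF \<alpha>(2) q assms(4) q'(2) C P_bounds F st(1) less_imp_le[OF st(2)] st(3)])
    also have "(t - s) powr (\<alpha> - 1 + 1 / q') = (t - s) powr e * (t - s) powr (1 - \<alpha>)"
      by (simp add: e_def powr_add[symmetric] algebra_simps)
    also have "K * ((t - s) powr e * (t - s) powr (1 - \<alpha>)) * ?N T F \<le> K * (T powr e * (t - s) powr (1 - \<alpha>)) * ?N T F"
      by (intro mult_right_mono mult_left_mono powr_mono2 K N) (use e st in auto)
    also have "\<dots> \<le> K * (?W T * (t - s) powr (1 - \<alpha>)) * ?N T F"
      by (intro mult_right_mono mult_left_mono K N) (auto simp: e_def)
    finally have G: "norm (G_op \<alpha> M U a F t - G_op \<alpha> M U a F s) \<le> K * (?W T * ?N T F) * (t - s) powr (1 - \<alpha>)"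
      by (simp only: mult_ac)
    have "?u x F t - ?u x F s = (S_op \<alpha> M U a t x - S_op \<alpha> M U a s x) + \<i> *\<^sub>C (G_op \<alpha> M U a F t - G_op \<alpha> M U a F s)"
      by (simp add: mild_solution_def scaleC_diff)
    then have "norm (?u x F t - ?u x F s) \<le> norm (S_op \<alpha> M U a t x - S_op \<alpha> M U a s x) + norm (G_op \<alpha> M U a F t - G_op \<alpha> M U a F s)"
      using norm_triangle_ineq[of "S_op \<alpha> M U a t x - S_op \<alpha> M U a s x" "\<i> *\<^sub>C (G_op \<alpha> M U a F t - G_op \<alpha> M U a F s)"]
      by (simp add: norm_scaleC)
    also have "\<dots> \<le> C * X * (t - s) powr (1 - \<alpha>) + K * (?W T * ?N T F) * (t - s) powr (1 - \<alpha>)"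
      by (rule add_mono[OF X(2) G])
    also have "\<dots> = (C * X + K * (?W T * ?N T F)) * (t - s) powr (1 - \<alpha>)" by (simp add: distrib_right)
    also have "\<dots> \<le> ((C + K + 1) * X + (C + K + 1) * (?W T * ?N T F)) * (t - s) powr (1 - \<alpha>)"
      by (intro mult_right_mono add_mono X mult_nonneg_nonneg add_nonneg_nonneg N) (use C K in auto)
    finally show ?thesis by (simp only: distrib_left)
  qed
  show ?thesis
  proof (intro exI[of _ "C + K + 1"] conjI allI impI ballI)
    show "C + K + 1 > 0" using C K by simp
  next
    fix T \<delta> :: real and x :: 'h and F :: "real \<Rightarrow> 'h"
    assume T: "T > 0" and F: "F \<in> lp_space q (lebesgue_on {0<..<T})" and \<delta>: "0 < \<delta> \<and> \<delta> < T"
    have bd: "norm (?u x F t - ?u x F s) \<le> (C + K + 1) * ((1 + 1 / \<delta>) * T powr \<alpha> * norm x + ?W T * ?N T F) * (t - s) powr (1 - \<alpha>)"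
      if "s \<in> {\<delta>..T}" "t \<in> {\<delta>..T}" "s < t" for s t
    proof (rule step[OF F _ that(3)])
      show "0 \<le> s" "t \<le> T" using that \<delta> by auto
      show "0 \<le> (1 + 1 / \<delta>) * T powr \<alpha> * norm x" using \<delta> by simp
      have s0: "0 < s" using that \<delta> by auto
      have "norm (S_op \<alpha> M U a t x - S_op \<alpha> M U a s x) \<le> C / s * (t - s) * norm x"
        by (rule S1) (use s0 that in auto)
      \<comment> \<open>Converts the Lipschitz estimate to the exponent 1 - \<alpha>; the excess
        power is bounded by \<open>T powr \<alpha>\<close>.\<close>
      also have "t - s = (t - s) powr \<alpha> * (t - s) powr (1 - \<alpha>)" using that by (simp add: powr_add[symmetric])
      also have "C / s * ((t - s) powr \<alpha> * (t - s) powr (1 - \<alpha>)) * norm x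
          \<le> (C * (1 + 1 / \<delta>)) * (T powr \<alpha> * (t - s) powr (1 - \<alpha>)) * norm x"
      proof (intro mult_right_mono mult_mono powr_mono2)
        have "C / s \<le> C / \<delta>" using C \<delta> that by (intro divide_left_mono) auto
        also have "\<dots> \<le> C * (1 + 1 / \<delta>)" using C by (simp add: distrib_left)
        finally show "C / s \<le> C * (1 + 1 / \<delta>)" .
      qed (use \<alpha> C \<delta> that in auto)
      finally show "norm (S_op \<alpha> M U a t x - S_op \<alpha> M U a s x) \<le> C * ((1 + 1 / \<delta>) * T powr \<alpha> * norm x) * (t - s) powr (1 - \<alpha>)"
        by (simp only: mult_ac)
    qed
    have J: "\<delta> \<in> {\<delta>..T}" "T \<in> {\<delta>..T}" "\<delta> < T" using \<delta> by auto
    have \<gamma>: "1 - \<alpha> > 0" using \<alpha> by simp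
    show "?u x F \<in> holder_space (1 - \<alpha>) {\<delta>..T}"
      by (rule holder_space_seminormI(1)[OF \<gamma> bd J])
    show "holder_seminorm (1 - \<alpha>) {\<delta>..T} (?u x F) \<le> (C + K + 1) * ((1 + 1 / \<delta>) * T powr \<alpha> * norm x + ?W T * ?N T F)"
      by (rule holder_space_seminormI(2)[OF \<gamma> bd J])
  next
    fix T :: real and x :: 'h and F :: "real \<Rightarrow> 'h"
    assume T: "T > 0" and F: "F \<in> lp_space q (lebesgue_on {0<..<T})" and x: "x \<in> D"
    have bd: "norm (?u x F t - ?u x F s) \<le> (C + K + 1) * ((T powr (2 * \<alpha> - 1) + T powr (2 * \<alpha>)) * graph_norm A x + ?W T * ?N T F) * (t - s) powr (1 - \<alpha>)"
      if "s \<in> {0..T}" "t \<in> {0..T}" "s < t" for s t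
    proof (rule step[OF F _ that(3)])
      show "0 \<le> s" "t \<le> T" using that by auto
      show "0 \<le> (T powr (2 * \<alpha> - 1) + T powr (2 * \<alpha>)) * graph_norm A x" by (simp add: graph_norm_def)
      have "norm (S_op \<alpha> M U a t x - S_op \<alpha> M U a s x) \<le> C * (t - s) powr \<alpha> * norm (A x)"
        by (rule S2[OF x]) (use that in auto)
      \<comment> \<open>Here the available exponent is only \<alpha>, so the excess is 2 \<alpha> -
        1; it is positive because \<alpha> > 1/2, hence monotonicity up to \<open>T\<close>
        applies.\<close>
      also have "(t - s) powr \<alpha> = (t - s) powr (2 * \<alpha> - 1) * (t - s) powr (1 - \<alpha>)" by (simp add: powr_add[symmetric])
      also have "C * ((t - s) powr (2 * \<alpha> - 1) * (t - s) powr (1 - \<alpha>)) * norm (A x)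
          \<le> C * ((T powr (2 * \<alpha> - 1) + T powr (2 * \<alpha>)) * (t - s) powr (1 - \<alpha>)) * graph_norm A x"
      proof (intro mult_mono mult_left_mono mult_right_mono)
        have "(t - s) powr (2 * \<alpha> - 1) \<le> T powr (2 * \<alpha> - 1)" by (rule powr_mono2) (use assms(1) that in auto)
        then show "(t - s) powr (2 * \<alpha> - 1) \<le> T powr (2 * \<alpha> - 1) + T powr (2 * \<alpha>)" by (simp add: add_increasing2)
      qed (use C in \<open>auto simp: graph_norm_def\<close>)
      finally show "norm (S_op \<alpha> M U a t x - S_op \<alpha> M U a s x) \<le> C * ((T powr (2 * \<alpha> - 1) + T powr (2 * \<alpha>)) * graph_norm A x) * (t - s) powr (1 - \<alpha>)"
        by (simp only: mult_ac)
    qed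
    have J: "0 \<in> {0..T}" "T \<in> {0..T}" "0 < T" using T by auto
    have \<gamma>: "1 - \<alpha> > 0" using \<alpha> by simp
    show "?u x F \<in> holder_space (1 - \<alpha>) {0..T}"
      by (rule holder_space_seminormI(1)[OF \<gamma> bd J])
    show "holder_seminorm (1 - \<alpha>) {0..T} (?u x F) \<le> (C + K + 1) * ((T powr (2 * \<alpha> - 1) + T powr (2 * \<alpha>)) * graph_norm A x + ?W T * ?N T F)"
      by (rule holder_space_seminormI(2)[OF \<gamma> bd J])
  qed
qed

end
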